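(* Let $n\ge 2$, let $\Omega\subset\mathbb{R}^n$ be a bounded domain, and let $F$, $G$ and the constants $g_0,G_0,m_0,M_0,m_1,m_2$ be as in the context. Let $f=f(x,t)$ be a $C^3$ boundary function and $M$ a constant such that on $\Gamma_T=\partial\Omega\times[0,T]$ $$|f_t|,\ |D_{T_i}f|,\ |D_{T_iT_j}f|\le M\qquad (1\le i,j\le n-1).$$ At each boundary point order the principal curvatures of $\partial\Omega$ so that, for some $\alpha$ with $1\le\alpha\le n-1$ (depending on the point), $$k_1\ge\cdots\ge k_\alpha\ge 0>k_{\alpha+1}\ge\cdots\ge k_{n-1},$$ and assume $\max_i|k_i|<\infty$. Set $$\gamma_1:=g_0\Big(\frac{2}{2+M^2}m_0-\sqrt2\,M m_1-m_2\Big),\qquad \gamma_2:=G_0\big(M_0+\sqrt2\,M m_1+m_2\big),$$ and assume $$\gamma_1>0,\qquad \gamma_1\sum_{i=1}^{\alpha}k_i+\gamma_2\sum_{i=\alpha+1}^{n-1}k_i>0 \quad\text{on } \partial\Omega.$$ Then there exists a constant $C=C(u_0,M,\partial\Omega,F,G,n)$ such that every smooth solution $u$ of $$ \begin{cases} u_t = G(Du,-1)\, D^2_{p_ip_j}F(Du,-1)\,u_{x_ix_j} & \text{in } Q_T=\Omega\times[0,T],\\ u=f(\cdot,t) & \text{on } \Gamma_T,\\ u(\cdot,0)=u_0(\cdot) & \text{in } \Omega\times\{0\} \end{cases} $$ satisfies $$\sup_{Q_T}|Du|\le C.$$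
   Context: $Du$ is the spatial gradient; repeated indices $i,j$ in the equation are summed over $1\le i,j\le n$, and $D^2_{p_ip_j}F$ denotes second derivatives of $F$ with respect to its first $n$ variables. Boundary geometry: $N$ is the unit inward normal to $\partial\Omega$. At each $x\in\partial\Omega$, $T_1,\dots,T_{n-1}$ is an orthonormal basis of the tangent space of $\partial\Omega$ consisting of principal directions, with principal curvatures $k_i$, signed so that $D_{T_i}T_i=k_iN$ (so $k_i\ge 0$ for convex domains), and with $D_{T_j}T_i=0$ for $i\ne j$ at the point, $D_{T_i}N=-k_iT_i$. $D_{T_i}f$ and $D_{T_iT_j}f=D_{T_i}D_{T_j}f$ are the first and second tangential derivatives of $f$ along $\partial\Omega$ in this frame. Anisotropy and mobility: $F$ and $G$ are positive functions on the unit sphere $\mathbb{S}^n\subset\mathbb{R}^{n+1}$ extended to $\mathbb{R}^{n+1}$ by homogeneity of degree one ($F(\lambda p)=\lambda F(p)$, $G(\lambda p)=\lambda G(p)$ for $\lambda>0$), smooth away from the origin; $F$ is convex on $\mathbb{R}^{n+1}$. With $\xi=\xi(p)=p/|p|$, $F(\xi)$ is regarded as the degree-zero homogeneous function $p\mapsto F(p/|p|)$, and $D_{p_i}F(\xi)$, $D^2_{p_ip_j}F(\xi)$ are its derivatives in $p$. There are positive constants $g_0,G_0,m_0,M_0,m_1,m_2$ such that for all $p\neq 0$ and $1\le i,j\le n$: $g_0\le G(\xi)\le G_0$; $m_0\le F(\xi)\le M_0$; $|D_{p_i}F(\xi)|<m_1/|p|$; $\|[D^2_{p_ip_j}F(\xi)]_{1\le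 i,j\le n}\|<m_2/|p|^2$, where $\|M\|=\sqrt{\mathrm{tr}(M^TM)}$ is the Frobenius norm. *)

theory Defs
  imports "HOL-Analysis.Analysis" "HOL-Library.Extended_Nat"
begin

section \<open>Classes of differentiable functions\<close>

primrec times_cont_diff :: "nat \<Rightarrow> 'a::real_normed_vector set \<Rightarrow> ('a \<Rightarrow> 'b::real_normed_vector) \<Rightarrow> bool"
  where
    "times_cont_diff 0 U f \<longleftrightarrow> continuous_on U f"
  | "times_cont_diff (Suc m) U f \<longleftrightarrow>
       (\<forall>x\<in>U. f differentiable (at x)) \<and>
       (\<forall>v. times_cont_diff m U (\<lambda>x. frechet_derivative f (at x) v))"

text \<open>\<open>f\<close> is of class \<open>C^k\<close> on \<open>S\<close> (\<open>k = \<infinity>\<close> allowed). For \<open>S\<close> that is not open, for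
  instance a hypersurface, a closed domain, or a cylinder that contains its bottom and top, this
  means as usual that \<open>f\<close> extends to a \<open>C^k\<close> function on an open neighbourhood of \<open>S\<close>.\<close>

definition Ck_on :: "enat \<Rightarrow> 'a::real_normed_vector set \<Rightarrow> ('a \<Rightarrow> 'b::real_normed_vector) \<Rightarrow> bool"
  where "Ck_on k S f \<longleftrightarrow>
    (\<exists>U g. open U \<and> S \<subseteq> U \<and> (\<forall>m. enat m \<le> k \<longrightarrow> times_cont_diff m U g) \<and> (\<forall>x\<in>S. g x = f x))"


section \<open>Derivatives\<close>

definition dir_deriv :: "'a::real_normed_vector \<Rightarrow> ('a \<Rightarrow> real) \<Rightarrow> 'a \<Rightarrow> real"
  where "dir_deriv v g x = frechet_derivative g (at x) v"

definition gradient :: "(real^'n \<Rightarrow> real) \<Rightarrow> real^'n \<Rightarrow> real^'n"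
  where "gradient g x = (\<chi> i. dir_deriv (axis i 1) g x)"

definition hessian :: "(real^'n \<Rightarrow> real) \<Rightarrow> real^'n \<Rightarrow> real^'n^'n"
  where "hessian g x = (\<chi> i j. dir_deriv (axis i 1) (dir_deriv (axis j 1) g) x)"

text \<open>The space of dimension \<open>n + 1\<close> is \<open>(real^'n) \<times> real\<close>. The next two functions only involve
  the derivatives in the first \<open>n\<close> variables.\<close>

definition deriv_p :: "'n \<Rightarrow> ((real^'n) \<times> real \<Rightarrow> real) \<Rightarrow> (real^'n) \<times> real \<Rightarrow> real"
  where "deriv_p i \<Phi> p = dir_deriv (axis i 1, 0) \<Phi> p"

definition hessian_p :: "((real^'n) \<times> real \<Rightarrow> real) \<Rightarrow> (real^'n) \<times> real \<Rightarrow> real^'n^'n"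
  where "hessian_p \<Phi> p = (\<chi> i j. deriv_p i (deriv_p j \<Phi>) p)"

definition frobenius_norm :: "real^'n^'n \<Rightarrow> real"
  where "frobenius_norm A = sqrt (trace (transpose A ** A))"

text \<open>Derivative along a hypersurface \<open>S\<close> in the direction of a tangent field \<open>V\<close>. A derivative
  within \<open>S\<close> is not unique as a linear map, but its values on tangent vectors of \<open>S\<close> are; it is
  used below for tangent \<open>V\<close> only.\<close>

definition deriv_along ::
    "'a::real_normed_vector set \<Rightarrow> ('a \<Rightarrow> 'a) \<Rightarrow> ('a \<Rightarrow> 'b::real_normed_vector) \<Rightarrow> 'a \<Rightarrow> 'b"
  where "deriv_along S V g x = frechet_derivative g (at x within S) (V x)"


section \<open>Boundary geometry\<close>

definition local_defining_function ::
    "enat \<Rightarrow> (real^'n) set \<Rightarrow> real^'n \<Rightarrow> (real^'n) set \<Rightarrow> (real^'n \<Rightarrow> real) \<Rightarrow> bool"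
  where "local_defining_function k \<Omega> x U \<rho> \<longleftrightarrow>
    open U \<and> x \<in> U \<and> Ck_on k U \<rho> \<and> (\<forall>y\<in>U. gradient \<rho> y \<noteq> 0) \<and>
    \<Omega> \<inter> U = {y\<in>U. \<rho> y > 0} \<and> frontier \<Omega> \<inter> U = {y\<in>U. \<rho> y = 0}"

definition Ck_boundary :: "enat \<Rightarrow> (real^'n) set \<Rightarrow> bool"
  where "Ck_boundary k \<Omega> \<longleftrightarrow> (\<forall>x\<in>frontier \<Omega>. \<exists>U \<rho>. local_defining_function k \<Omega> x U \<rho>)"

definition inward_normal :: "(real^'n) set \<Rightarrow> real^'n \<Rightarrow> real^'n"
  where "inward_normal \<Omega> x =
    (THE \<nu>. \<exists>U \<rho>. local_defining_function 1 \<Omega> x U \<rho> \<and> \<nu> = gradient \<rho> x /\<^sub>R norm (gradient \<rho> x))"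

text \<open>\<open>T 1, \<dots>, T (n - 1)\<close> are tangent fields on the boundary near \<open>x\<close>, orthonormal at each
  point, that at \<open>x\<close> itself are principal directions with principal curvatures
  \<open>\<kappa> 1, \<dots>, \<kappa> (n - 1)\<close> and satisfy the frame relations there. Such a frame exists at every
  point of a smooth boundary (extend principal directions at \<open>x\<close> by parallel transport along the
  geodesics through \<open>x\<close>); the fields need not be principal away from \<open>x\<close>.\<close>

definition principal_frame ::
    "(real^'n) set \<Rightarrow> real^'n \<Rightarrow> (nat \<Rightarrow> real^'n \<Rightarrow> real^'n) \<Rightarrow> (nat \<Rightarrow> real) \<Rightarrow> bool"
  where "principal_frame \<Omega> x T \<kappa> \<longleftrightarrow>
    (let S = frontier \<Omega>; N = inward_normal \<Omega>; I = {1..CARD('n) - 1} in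
      (\<exists>U. open U \<and> x \<in> U \<and>
        (\<forall>y\<in>S \<inter> U. \<forall>i\<in>I. T i y \<bullet> N y = 0 \<and> (\<forall>j\<in>I. T i y \<bullet> T j y = (if i = j then 1 else 0)))) \<and>
      (\<forall>i\<in>I. T i differentiable (at x within S)) \<and>
      (\<forall>i\<in>I. \<forall>j\<in>I. deriv_along S (T j) (T i) x = (if i = j then \<kappa> i *\<^sub>R N x else 0)) \<and>
      (\<forall>i\<in>I. deriv_along S (T i) N x = - (\<kappa> i *\<^sub>R T i x)))"


section \<open>Anisotropy, mobility and the structural constants\<close>

definition homogeneous_integrand :: "((real^'n) \<times> real \<Rightarrow> real) \<Rightarrow> bool"
  where "homogeneous_integrand \<Phi> \<longleftrightarrow>
    (\<forall>p. norm p = 1 \<longrightarrow> \<Phi> p > 0) \<and>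
    (\<forall>p. \<forall>c>0. \<Phi> (c *\<^sub>R p) = c * \<Phi> p) \<and>
    Ck_on \<infinity> (- {0}) \<Phi>"

definition on_direction :: "((real^'n) \<times> real \<Rightarrow> real) \<Rightarrow> (real^'n) \<times> real \<Rightarrow> real"
  where "on_direction \<Phi> p = \<Phi> (p /\<^sub>R norm p)"

definition structural_bounds ::
    "((real^'n) \<times> real \<Rightarrow> real) \<Rightarrow> ((real^'n) \<times> real \<Rightarrow> real) \<Rightarrow>
     real \<Rightarrow> real \<Rightarrow> real \<Rightarrow> real \<Rightarrow> real \<Rightarrow> real \<Rightarrow> bool"
  where "structural_bounds F G g0 G0 m0 M0 m1 m2 \<longleftrightarrow>
    0 < g0 \<and> 0 < G0 \<and> 0 < m0 \<and> 0 < M0 \<and> 0 < m1 \<and> 0 < m2 \<and>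
    (\<forall>p. p \<noteq> 0 \<longrightarrow>
      g0 \<le> on_direction G p \<and> on_direction G p \<le> G0 \<and>
      m0 \<le> on_direction F p \<and> on_direction F p \<le> M0 \<and>
      (\<forall>i. \<bar>deriv_p i (on_direction F) p\<bar> < m1 / norm p) \<and>
      frobenius_norm (hessian_p (on_direction F) p) < m2 / (norm p)\<^sup>2)"

definition gamma1 :: "real \<Rightarrow> real \<Rightarrow> real \<Rightarrow> real \<Rightarrow> real \<Rightarrow> real"
  where "gamma1 g0 m0 m1 m2 M = g0 * (2 / (2 + M\<^sup>2) * m0 - sqrt 2 * M * m1 - m2)"

definition gamma2 :: "real \<Rightarrow> real \<Rightarrow> real \<Rightarrow> real \<Rightarrow> real \<Rightarrow> real"
  where "gamma2 G0 M0 m1 m2 M = G0 * (M0 + sqrt 2 * M * m1 + m2)"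


section \<open>The initial boundary value problem\<close>

text \<open>The solution is smooth on \<open>\<Omega> \<times> [0,T]\<close>, including the bottom and the top, but merely
  continuous up to the lateral boundary. The time derivative is one-sided at \<open>t = 0\<close> and \<open>t = T\<close>.\<close>

definition smooth_solution ::
    "((real^'n) \<times> real \<Rightarrow> real) \<Rightarrow> ((real^'n) \<times> real \<Rightarrow> real) \<Rightarrow> (real^'n) set \<Rightarrow> real \<Rightarrow>
     (real^'n \<Rightarrow> real \<Rightarrow> real) \<Rightarrow> (real^'n \<Rightarrow> real) \<Rightarrow> (real^'n \<Rightarrow> real \<Rightarrow> real) \<Rightarrow> bool"
  where "smooth_solution F G \<Omega> T f u0 u \<longleftrightarrow>
    Ck_on \<infinity> (\<Omega> \<times> {0..T}) (\<lambda>(x, t). u x t) \<and>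
    continuous_on (closure \<Omega> \<times> {0..T}) (\<lambda>(x, t). u x t) \<and>
    (\<forall>x\<in>\<Omega>. \<forall>t\<in>{0..T}.
      vector_derivative (\<lambda>s. u x s) (at t within {0..T}) =
        (let p = (gradient (\<lambda>y. u y t) x, -1) in
          G p * (\<Sum>i\<in>UNIV. \<Sum>j\<in>UNIV. hessian_p F p $ i $ j * hessian (\<lambda>y. u y t) x $ i $ j))) \<and>
    (\<forall>x\<in>frontier \<Omega>. \<forall>t\<in>{0..T}. u x t = f x t) \<and>
    (\<forall>x\<in>\<Omega>. u x 0 = u0 x)"

text \<open>Bounds on the boundary data. The second tangential derivatives are iterated derivatives
  along the frame fields.\<close>

definition boundary_data_bound ::
    "(real^'n) set \<Rightarrow> (real^'n \<Rightarrow> nat \<Rightarrow> real) \<Rightarrow> real \<Rightarrow> real \<Rightarrow> (real^'n \<Rightarrow> real \<Rightarrow> real) \<Rightarrow> bool"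
  where "boundary_data_bound \<Omega> \<kappa> T M f \<longleftrightarrow>
    (\<forall>x\<in>frontier \<Omega>. \<exists>E. principal_frame \<Omega> x E (\<kappa> x) \<and>
      (\<forall>t\<in>{0..T}.
        \<bar>vector_derivative (\<lambda>s. f x s) (at t within {0..T})\<bar> \<le> M \<and>
        (\<forall>i\<in>{1..CARD('n) - 1}.
          \<bar>deriv_along (frontier \<Omega>) (E i) (\<lambda>y. f y t) x\<bar> \<le> M \<and>
          (\<forall>j\<in>{1..CARD('n) - 1}.
            \<bar>deriv_along (frontier \<Omega>) (E i)
               (deriv_along (frontier \<Omega>) (E j) (\<lambda>y. f y t)) x\<bar> \<le> M))))"

end

theory Submission
  imports Defs
begin

text \<open>The equation reads \<open>u_t = a (Du, -1) \<bullet> D\<^sup>2u\<close> with \<open>a = G D\<^sup>2F\<close>. The matrix \<open>a p\<close> is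
homogeneous of degree zero in \<open>p\<close>, symmetric and positive semidefinite, but degenerate: \<open>a (q, 0)\<close>
annihilates \<open>q\<close>, so there is no diffusion in the direction of a steep gradient. What survives is
diffusion in the directions \<open>T\<close> orthogonal to the gradient, where \<open>F (p) = \<bar>p\<bar> F (p / \<bar>p\<bar>)\<close> gives
\<open>g0 (m0 - m2) \<le> T \<bullet> a T \<le> G0 (M0 + m2)\<close> (\<open>flow_operator_tangential_bounds\<close>). The assumptions on
\<open>\<gamma>\<^sub>1\<close> and \<open>\<gamma>\<^sub>2\<close> imply that, for all weights in this range, the weighted sum of the principal curvatures is
positive. Hence \<open>a (\<nabla>\<rho>, 0) \<bullet> D\<^sup>2\<rho> < 0\<close> on the boundary for each defining function \<open>\<rho>\<close> of \<open>\<Omega>\<close>.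

\<^emph>\<open>Boundary gradient.\<close> Fix a boundary point \<open>x0\<close> and a time \<open>t0\<close>. For \<open>t \<le> t0\<close> the function
\<open>f(x0,t0) + M (t0 - t) + l \<bullet> (x - x0) + C \<bar>x - x0\<bar>\<^sup>2 + K \<rho>(x)\<close> lies above \<open>u\<close> near \<open>x0\<close>
(\<open>local_barrier\<close>). It is a supersolution for large \<open>K\<close> because by homogeneity \<open>a\<close> is evaluated at
\<open>\<nabla>\<rho> + O(1/K)\<close>, so that \<open>K a \<bullet> D\<^sup>2\<rho>\<close> is a large negative number. Time enters only through the
Lipschitz bound of \<open>f\<close>, and only times before \<open>t0\<close> matter, so that the slope \<open>l\<close> may be frozen at \<open>t0\<close>.
Applied to \<open>-u\<close> as well, this bounds \<open>\<bar>u(x,t) - f(x0,t)\<bar>\<close> by \<open>L \<bar>x - x0\<bar>\<close>.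

\<^emph>\<open>Interior gradient.\<close> Translates of \<open>u\<close> solve the same equation. By comparison, \<open>u(x+h,t) - u(x,t)\<close> is
bounded by its values on the parabolic boundary, that is, by \<open>L \<bar>h\<bar>\<close> (\<open>gradient_estimate\<close>). The
comparison principle only uses second-order conditions at an interior maximum, so continuity of \<open>u\<close> up to
the lateral boundary is enough.

\<^emph>\<open>Uniformity.\<close> The constants may depend neither on \<open>T\<close> nor on \<open>f\<close> itself. Two facts provide this. First, at every
time \<open>f\<close> has a second-order expansion on the whole boundary whose constant depends on \<open>M\<close> and \<open>\<Omega>\<close> only
(\<open>tangential_data_taylor_bounded\<close>): locally one integrates the second tangential derivatives along
boundary curves, and globally one uses that the boundary is connected. Connectedness is a
consequence of the curvature condition: it forces positive mean curvature, and a bounded mean convex domain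
has connected boundary, by the argument of Frankel (\<open>connected_mean_convex_frontier\<close>). Second, the trace of
\<open>a\<close> is bounded below, as the dimension is at least two, so that a paraboloid moving with speed \<open>M\<close> keeps \<open>u\<close>
within a fixed distance of its boundary values for all time (\<open>global_upper_bound\<close>).\<close>

section \<open>Functions of class C^k, gradients and Hessians\<close>

lemma has_derivative_cong_open:
  fixes f g :: "'a::real_normed_vector \<Rightarrow> 'b::real_normed_vector"
  assumes "open U" "x \<in> U" "\<And>x. x \<in> U \<Longrightarrow> f x = g x"
  shows "(f has_derivative D) (at x) \<longleftrightarrow> (g has_derivative D) (at x)"
proof
  assume "(f has_derivative D) (at x)"
  from has_derivative_transform_within_open[OF this assms(1,2)] assms(3)
  show "(g has_derivative D) (at x)" by simp
next
  assume "(g has_derivative D) (at x)"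
  from has_derivative_transform_within_open[OF this assms(1,2)] assms(3)
  show "(f has_derivative D) (at x)" by simp
qed

lemma times_cont_diff_cong_imp:
  assumes "open U" "\<And>x. x \<in> U \<Longrightarrow> f x = g x" "times_cont_diff k U f"
  shows "times_cont_diff k U g"
  using assms(2,3)
proof (induction k arbitrary: f g)
  case 0
  then show ?case by (simp cong: continuous_on_cong)
next
  case (Suc k)
  have eq: "frechet_derivative f (at x) = frechet_derivative g (at x)" if "x \<in> U" for x
    using Suc.prems that \<open>open U\<close> frechet_derivative_transform_within_open by fastforce
  have diff: "g differentiable (at x)" if "x \<in> U" for x
    using Suc.prems that has_derivative_cong_open[of U x f g] \<open>open U\<close>
    unfolding differentiable_def times_cont_diff.simps by blast
  have "times_cont_diff k U (\<lambda>x. frechet_derivative g (at x) v)" for v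
    by (rule Suc.IH[of "\<lambda>x. frechet_derivative f (at x) v"]) (use Suc.prems in \<open>simp_all add: eq\<close>)
  with diff show ?case by simp
qed

lemma times_cont_diff_cong:
  assumes "open U" "\<And>x. x \<in> U \<Longrightarrow> f x = g x"
  shows "times_cont_diff k U f \<longleftrightarrow> times_cont_diff k U g"
  using times_cont_diff_cong_imp[OF assms(1)] assms(2) by metis

lemma times_cont_diff_subset:
  "times_cont_diff k U f \<Longrightarrow> V \<subseteq> U \<Longrightarrow> times_cont_diff k V f"
  by (induction k arbitrary: f) (auto intro: continuous_on_subset)

lemma Ck_on_times_cont_diff:
  assumes "Ck_on k U f" "open U" "enat m \<le> k"
  shows "times_cont_diff m U f"
proof -
  obtain V g where "open V" "U \<subseteq> V" "times_cont_diff m V g" "\<And>x. x \<in> U \<Longrightarrow> g x = f x"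
    using assms unfolding Ck_on_def by blast
  then show ?thesis
    using times_cont_diff_cong[OF \<open>open U\<close>, of g f m] times_cont_diff_subset by blast
qed

text \<open>Slices in time and in the last variable are compositions with the affine maps \<open>x \<mapsto> (x, t)\<close>.\<close>

lemma times_cont_diff_compose_affine:
  assumes "open U" "times_cont_diff k U g"
    and A: "\<And>x. A x = L x + c" and "bounded_linear L"
  shows "times_cont_diff k (A -` U) (\<lambda>x. g (A x))"
  using assms(2)
proof (induction k arbitrary: g)
  case 0
  have "continuous_on UNIV A"
    unfolding A[abs_def] using \<open>bounded_linear L\<close>
    by (intro continuous_intros linear_continuous_on)
  then show ?case
    using 0 continuous_on_compose2[of U g "A -` U" A] continuous_on_subset[of UNIV A] by auto
next
  case (Suc k)
  have der: "((\<lambda>x. g (A x)) has_derivative (\<lambda>h. frechet_derivative g (at (A x)) (L h))) (at x)"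
    if "A x \<in> U" for x
  proof -
    have "(A has_derivative L) (at x)"
      unfolding A[abs_def] using \<open>bounded_linear L\<close>
      by (auto intro!: derivative_eq_intros bounded_linear_imp_has_derivative)
    moreover have "(g has_derivative frechet_derivative g (at (A x))) (at (A x))"
      using Suc.prems that by (simp add: frechet_derivative_works)
    ultimately show ?thesis
      using diff_chain_at[of A L x g] by (simp add: o_def)
  qed
  have "open (A -` U)"
    using \<open>bounded_linear L\<close> \<open>open U\<close> unfolding A[abs_def]
    by (intro open_vimage continuous_intros linear_continuous_on)
  have "times_cont_diff k (A -` U) (\<lambda>x. frechet_derivative (\<lambda>x. g (A x)) (at x) v)" for v
  proof -
    have "times_cont_diff k (A -` U) (\<lambda>x. frechet_derivative g (at (A x)) (L v))"
      using Suc.IH[of "\<lambda>x. frechet_derivative g (at x) (L v)"] Suc.prems by simp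
    then show ?thesis
      by (subst times_cont_diff_cong[OF \<open>open (A -` U)\<close>])
        (auto simp: frechet_derivative_at[OF der, symmetric])
  qed
  then show ?case
    using der by (auto simp: differentiable_def)
qed

lemma dir_deriv_at:
  assumes "(f has_derivative f') (at x)" shows "dir_deriv v f x = f' v"
  using frechet_derivative_at[OF assms] by (simp add: dir_deriv_def)

lemma dir_deriv_eta: "dir_deriv v f = (\<lambda>x. frechet_derivative f (at x) v)"
  by (simp add: dir_deriv_def fun_eq_iff)

lemma times_cont_diff_Suc_dir_deriv:
  fixes f :: "'a::real_normed_vector \<Rightarrow> real"
  shows "times_cont_diff (Suc k) U f \<longleftrightarrow>
    (\<forall>x\<in>U. f differentiable (at x)) \<and> (\<forall>v. times_cont_diff k U (dir_deriv v f))"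
  by (simp add: dir_deriv_eta)

lemma times_cont_diff_continuous:
  "times_cont_diff k U f \<Longrightarrow> continuous_on U f"
  by (cases k) (auto intro!: differentiable_imp_continuous_on
      simp: differentiable_on_def differentiable_at_withinI)

lemma times_cont_diff_mono:
  "times_cont_diff m U f \<Longrightarrow> k \<le> m \<Longrightarrow> times_cont_diff k U f"
proof (induction k arbitrary: m f)
  case 0
  then show ?case by (simp add: times_cont_diff_continuous)
next
  case (Suc k)
  then obtain m' where "m = Suc m'" "k \<le> m'" by (cases m) auto
  with Suc show ?case by auto
qed

lemma has_derivative_dir_deriv:
  assumes "times_cont_diff (Suc k) U f" "x \<in> U"
  shows "(f has_derivative (\<lambda>v. dir_deriv v f x)) (at x)"
  using assms by (simp add: dir_deriv_def frechet_derivative_works[symmetric])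

text \<open>Schwarz's theorem. The second difference of \<open>f\<close> over a small parallelogram is symmetric in
\<open>v\<close> and \<open>w\<close>, and two applications of the mean value theorem turn it into either iterated derivative at a
nearby point; continuity does the rest.\<close>

lemma second_dir_deriv_commute:
  fixes f :: "'a::real_normed_vector \<Rightarrow> real"
  assumes "open U" "times_cont_diff 2 U f" "x \<in> U"
  shows "dir_deriv v (dir_deriv w f) x = dir_deriv w (dir_deriv v f) x"
proof -
  have f: "times_cont_diff (Suc (Suc 0)) U f"
    using assms(2) by (simp add: numeral_2_eq_2)
  have f1: "times_cont_diff (Suc 0) U f"
    by (rule times_cont_diff_mono[OF f]) simp
  have df: "times_cont_diff (Suc 0) U (dir_deriv v f)" for v
    using f unfolding times_cont_diff_Suc_dir_deriv by blast
  have cont: "continuous_on U (dir_deriv v (dir_deriv w f))" for v w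
    using df unfolding times_cont_diff_Suc_dir_deriv times_cont_diff.simps(1) by blast
  obtain e where e: "e > 0" "ball x e \<subseteq> U"
    using \<open>open U\<close> \<open>x \<in> U\<close> open_contains_ball by blast
  have diff_line: "((\<lambda>s. g (y + s *\<^sub>R v)) has_real_derivative dir_deriv v g (y + s *\<^sub>R v)) (at s)"
    if "y + s *\<^sub>R v \<in> U" "times_cont_diff (Suc 0) U g"
    for g :: "'a \<Rightarrow> real" and y v s
  proof -
    have "((\<lambda>s. y + s *\<^sub>R v) has_derivative (\<lambda>s. s *\<^sub>R v)) (at s)"
      by (auto intro!: derivative_eq_intros)
    from diff_chain_at[OF this has_derivative_dir_deriv[OF that(2,1)]]
    have D: "((\<lambda>s. g (y + s *\<^sub>R v)) has_derivative (\<lambda>r. dir_deriv (r *\<^sub>R v) g (y + s *\<^sub>R v))) (at s)"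
      by (simp add: o_def)
    have "dir_deriv (r *\<^sub>R v) g (y + s *\<^sub>R v) = dir_deriv v g (y + s *\<^sub>R v) * r" for r
      using linear_scale[OF has_derivative_linear[OF has_derivative_dir_deriv[OF that(2,1)]]]
      by (simp add: mult.commute)
    then have "(\<lambda>r. dir_deriv (r *\<^sub>R v) g (y + s *\<^sub>R v)) = (*) (dir_deriv v g (y + s *\<^sub>R v))"
      by (rule ext)
    with D show ?thesis
      unfolding has_field_derivative_def by simp
  qed
  define B where "B = norm v + norm w + 1"
  \<comment> \<open>the second difference over the parallelogram spanned by \<open>h v\<close> and \<open>h w\<close>\<close>
  have key: "\<exists>\<xi>\<in>{0<..<h}. \<exists>\<eta>\<in>{0<..<h}.
      f (x + h *\<^sub>R v + h *\<^sub>R w) - f (x + h *\<^sub>R v) - f (x + h *\<^sub>R w) + f x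
        = h * h * dir_deriv w (dir_deriv v f) (x + \<xi> *\<^sub>R v + \<eta> *\<^sub>R w)"
    if h: "0 < h" "h * B < e" and B: "norm v + norm w < B" for h v w B
  proof -
    have inU: "x + s *\<^sub>R v + t *\<^sub>R w \<in> U" if "s \<in> {0..h}" "t \<in> {0..h}" for s t
    proof -
      have "norm (s *\<^sub>R v + t *\<^sub>R w) \<le> s * norm v + t * norm w"
        using that norm_triangle_ineq[of "s *\<^sub>R v" "t *\<^sub>R w"] by simp
      also have "\<dots> \<le> h * norm v + h * norm w"
        using that by (intro add_mono mult_right_mono) auto
      also have "\<dots> \<le> h * B" using h B by (simp add: distrib_left[symmetric])
      finally have "dist x (x + s *\<^sub>R v + t *\<^sub>R w) < e"
        using h norm_minus_cancel[of "s *\<^sub>R v + t *\<^sub>R w"] by (simp add: dist_norm)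
      then show ?thesis using e by auto
    qed
    define g where "g s = f (x + s *\<^sub>R v + h *\<^sub>R w) - f (x + s *\<^sub>R v)" for s
    have g': "(g has_real_derivative
        dir_deriv v f (x + s *\<^sub>R v + h *\<^sub>R w) - dir_deriv v f (x + s *\<^sub>R v)) (at s)"
      if "s \<in> {0..h}" for s
    proof -
      have "((\<lambda>s. f ((x + h *\<^sub>R w) + s *\<^sub>R v)) has_real_derivative dir_deriv v f ((x + h *\<^sub>R w) + s *\<^sub>R v)) (at s)"
        using inU[of s h] that h by (intro diff_line f1) (simp add: algebra_simps)
      moreover have "((\<lambda>s. f (x + s *\<^sub>R v)) has_real_derivative dir_deriv v f (x + s *\<^sub>R v)) (at s)"
        using inU[of s 0] that h by (intro diff_line f1) simp
      ultimately show ?thesis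
        unfolding g_def[abs_def] by (auto intro!: derivative_eq_intros simp: algebra_simps)
    qed
    obtain \<xi> where \<xi>: "0 < \<xi>" "\<xi> < h"
      "g h - g 0 = (h - 0) * (dir_deriv v f (x + \<xi> *\<^sub>R v + h *\<^sub>R w) - dir_deriv v f (x + \<xi> *\<^sub>R v))"
      using MVT2[OF h(1), of g, OF g'] by auto
    define k where "k t = dir_deriv v f (x + \<xi> *\<^sub>R v + t *\<^sub>R w)" for t
    have k': "(k has_real_derivative dir_deriv w (dir_deriv v f) (x + \<xi> *\<^sub>R v + t *\<^sub>R w)) (at t)"
      if "t \<in> {0..h}" for t
      unfolding k_def[abs_def] using inU[of \<xi> t] that \<xi> by (intro diff_line df) simp
    obtain \<eta> where \<eta>: "0 < \<eta>" "\<eta> < h"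
      "k h - k 0 = (h - 0) * dir_deriv w (dir_deriv v f) (x + \<xi> *\<^sub>R v + \<eta> *\<^sub>R w)"
      using MVT2[OF h(1), of k, OF k'] by auto
    have "f (x + h *\<^sub>R v + h *\<^sub>R w) - f (x + h *\<^sub>R v) - f (x + h *\<^sub>R w) + f x = g h - g 0"
      by (simp add: g_def)
    also have "\<dots> = h * (k h - k 0)" using \<xi> by (simp add: k_def)
    finally show ?thesis using \<xi> \<eta> by (intro bexI[of _ \<xi>] bexI[of _ \<eta>]) auto
  qed
  have "B > 0" by (simp add: B_def add_nonneg_pos)
  define H where "H n = e / (2 * B) * inverse (real (Suc n))" for n
  have H: "0 < H n" "H n * B < e" for n
  proof -
    show "0 < H n" using e \<open>B > 0\<close> by (simp add: H_def)
    have "H n * B = e / 2 * inverse (real (Suc n))" using \<open>B > 0\<close> by (simp add: H_def)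
    also have "\<dots> \<le> e / 2 * 1" using e by (intro mult_left_mono) (auto simp: field_simps)
    finally show "H n * B < e" using e by simp
  qed
  have lim: "H \<longlonglongrightarrow> 0"
  proof -
    have "(\<lambda>n. (e / (2 * B)) * inverse (real (Suc n))) \<longlonglongrightarrow> (e / (2 * B)) * 0"
      by (intro tendsto_intros LIMSEQ_inverse_real_of_nat)
    then show ?thesis by (simp add: H_def[abs_def])
  qed
  have conv: "\<exists>p. p \<longlonglongrightarrow> x \<and> (\<forall>n. f (x + H n *\<^sub>R v + H n *\<^sub>R w) - f (x + H n *\<^sub>R v) - f (x + H n *\<^sub>R w) + f x
      = H n * H n * dir_deriv w (dir_deriv v f) (p n))"
    if "norm v + norm w < B" for v w
  proof -
    have "\<forall>n. \<exists>\<xi>. \<exists>\<eta>. \<xi> \<in> {0<..<H n} \<and> \<eta> \<in> {0<..<H n} \<and>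
      f (x + H n *\<^sub>R v + H n *\<^sub>R w) - f (x + H n *\<^sub>R v) - f (x + H n *\<^sub>R w) + f x
        = H n * H n * dir_deriv w (dir_deriv v f) (x + \<xi> *\<^sub>R v + \<eta> *\<^sub>R w)"
      using key[OF H that] by blast
    then obtain \<xi> \<eta> where *: "\<And>n. \<xi> n \<in> {0<..<H n} \<and> \<eta> n \<in> {0<..<H n} \<and>
      f (x + H n *\<^sub>R v + H n *\<^sub>R w) - f (x + H n *\<^sub>R v) - f (x + H n *\<^sub>R w) + f x
        = H n * H n * dir_deriv w (dir_deriv v f) (x + \<xi> n *\<^sub>R v + \<eta> n *\<^sub>R w)"
      by metis
    have "\<xi> \<longlonglongrightarrow> 0" "\<eta> \<longlonglongrightarrow> 0"
      using * by (auto intro!: tendsto_sandwich[OF _ _ tendsto_const lim] always_eventually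
          intro: less_imp_le)
    then have "(\<lambda>n. x + \<xi> n *\<^sub>R v + \<eta> n *\<^sub>R w) \<longlonglongrightarrow> x + 0 *\<^sub>R v + 0 *\<^sub>R w"
      by (intro tendsto_intros)
    then show ?thesis using * by auto
  qed
  obtain p where p: "p \<longlonglongrightarrow> x" "\<And>n. f (x + H n *\<^sub>R v + H n *\<^sub>R w) - f (x + H n *\<^sub>R v) - f (x + H n *\<^sub>R w) + f x
      = H n * H n * dir_deriv w (dir_deriv v f) (p n)"
    using conv[of v w] by (auto simp: B_def)
  obtain q where q: "q \<longlonglongrightarrow> x" "\<And>n. f (x + H n *\<^sub>R w + H n *\<^sub>R v) - f (x + H n *\<^sub>R w) - f (x + H n *\<^sub>R v) + f x
      = H n * H n * dir_deriv v (dir_deriv w f) (q n)"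
    using conv[of w v] by (auto simp: B_def)
  have eq: "dir_deriv w (dir_deriv v f) (p n) = dir_deriv v (dir_deriv w f) (q n)" for n
  proof -
    have "H n * H n * dir_deriv w (dir_deriv v f) (p n) = H n * H n * dir_deriv v (dir_deriv w f) (q n)"
      using p(2)[of n] q(2)[of n] by (simp add: algebra_simps)
    then show ?thesis using H(1)[of n] by simp
  qed
  have isC: "isCont (dir_deriv v (dir_deriv w f)) x" for v w
    using cont continuous_on_eq_continuous_at[OF \<open>open U\<close>] \<open>x \<in> U\<close> by blast
  have "(\<lambda>n. dir_deriv w (dir_deriv v f) (p n)) \<longlonglongrightarrow> dir_deriv w (dir_deriv v f) x"
    "(\<lambda>n. dir_deriv v (dir_deriv w f) (q n)) \<longlonglongrightarrow> dir_deriv v (dir_deriv w f) x"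
    using isCont_tendsto_compose[OF isC] p q by blast+
  then show ?thesis using eq LIMSEQ_unique by simp
qed

lemma times_cont_diff_slice:
  fixes g :: "'a::real_normed_vector \<times> real \<Rightarrow> 'b::real_normed_vector"
  assumes "open U" "times_cont_diff k U g"
  shows "times_cont_diff k {x. (x, t) \<in> U} (\<lambda>x. g (x, t))" "open {x. (x, t) \<in> U}"
proof -
  have L: "bounded_linear (\<lambda>x::'a. (x, 0::real))"
    by (intro bounded_linear_Pair bounded_linear_ident bounded_linear_zero)
  from times_cont_diff_compose_affine[OF assms _ L, of "\<lambda>x. (x, t)" "(0, t)"]
  show "times_cont_diff k {x. (x, t) \<in> U} (\<lambda>x. g (x, t))"
    by (simp add: vimage_def)
  have "open ((\<lambda>x. (x, t)) -` U)"
    by (intro open_vimage assms continuous_intros)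
  then show "open {x. (x, t) \<in> U}" by (simp add: vimage_def)
qed

text \<open>Links the coordinate definition of the gradient with the total derivative, for every direction.\<close>

lemma gradient_inner:
  fixes f :: "real^'n \<Rightarrow> real"
  assumes "(f has_derivative D) (at x)"
  shows "gradient f x \<bullet> v = D v"
proof -
  have lin: "linear D" using assms has_derivative_linear by blast
  have "D v = D (\<Sum>i\<in>UNIV. v $ i *s axis i 1)" by (simp add: basis_expansion)
  also have "\<dots> = (\<Sum>i\<in>UNIV. v $ i * D (axis i 1))"
    by (simp add: linear_sum[OF lin] linear_scale[OF lin] scalar_mult_eq_scaleR)
  also have "\<dots> = gradient f x \<bullet> v"
    by (simp add: gradient_def inner_vec_def dir_deriv_at[OF assms] mult.commute)
  finally show ?thesis by simp
qed

lemma gradient_eqI: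
  fixes f :: "real^'n \<Rightarrow> real"
  assumes "(f has_derivative (\<lambda>h. g \<bullet> h)) (at x)"
  shows "gradient f x = g"
  using gradient_inner[OF assms] vector_eq_rdot by blast

lemma has_derivative_gradient:
  fixes f :: "real^'n \<Rightarrow> real"
  assumes "times_cont_diff (Suc k) U f" "x \<in> U"
  shows "(f has_derivative (\<lambda>h. gradient f x \<bullet> h)) (at x)"
  using has_derivative_dir_deriv[OF assms] by (simp add: gradient_inner[OF has_derivative_dir_deriv[OF assms]])

lemma times_cont_diff_2D:
  assumes "times_cont_diff 2 U f"
  shows "times_cont_diff (Suc 0) U f" "times_cont_diff (Suc (Suc 0)) U f"
  using times_cont_diff_mono[OF assms, of "Suc 0"] times_cont_diff_mono[OF assms, of "Suc (Suc 0)"] by auto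

lemma times_cont_diff_2_dir_deriv:
  fixes f :: "'a::real_normed_vector \<Rightarrow> real"
  assumes "times_cont_diff 2 U f"
  shows "times_cont_diff (Suc 0) U (dir_deriv v f)"
  using times_cont_diff_2D(2)[OF assms] times_cont_diff_Suc_dir_deriv[of "Suc 0" U f] by blast

lemma transpose_hessian:
  fixes f :: "real^'n \<Rightarrow> real"
  assumes "open U" "times_cont_diff 2 U f" "x \<in> U"
  shows "transpose (hessian f x) = hessian f x"
  using second_dir_deriv_commute[OF assms]
  by (simp add: transpose_def hessian_def vec_eq_iff)

lemma has_derivative_gradient_hessian:
  fixes f :: "real^'n \<Rightarrow> real"
  assumes "open U" "times_cont_diff 2 U f" "x \<in> U"
  shows "(gradient f has_derivative (\<lambda>h. hessian f x *v h)) (at x)"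
proof -
  have "((\<lambda>y. gradient f y \<bullet> axis i 1) has_derivative (\<lambda>h. (hessian f x *v h) \<bullet> axis i 1)) (at x)" for i
  proof -
    have D: "(dir_deriv (axis i 1) f has_derivative (\<lambda>h. dir_deriv h (dir_deriv (axis i 1) f) x)) (at x)"
      using has_derivative_dir_deriv[OF times_cont_diff_2_dir_deriv[OF assms(2)] assms(3)] .
    have "dir_deriv h (dir_deriv (axis i 1) f) x = (hessian f x *v h) \<bullet> axis i 1" for h
    proof -
      have "dir_deriv h (dir_deriv (axis i 1) f) x = gradient (dir_deriv (axis i 1) f) x \<bullet> h"
        by (simp add: gradient_inner[OF D])
      also have "\<dots> = (transpose (hessian f x) *v h) $ i"
        by (simp add: gradient_def inner_vec_def transpose_def hessian_def matrix_vector_mult_def)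
      finally show ?thesis by (simp add: transpose_hessian[OF assms] inner_axis)
    qed
    moreover have "(\<lambda>y. gradient f y \<bullet> axis i 1) = dir_deriv (axis i 1) f"
      by (simp add: gradient_def inner_axis fun_eq_iff)
    ultimately show ?thesis using D by simp
  qed
  then show ?thesis
    by (subst has_derivative_componentwise_within) (auto simp: Basis_vec_def)
qed

lemma continuous_on_gradient:
  fixes f :: "real^'n \<Rightarrow> real"
  assumes "times_cont_diff (Suc k) U f"
  shows "continuous_on U (gradient f)"
proof -
  have "continuous_on U (dir_deriv v f)" for v
    using assms times_cont_diff_continuous[of k U "dir_deriv v f"] by (simp add: dir_deriv_eta)
  then show ?thesis
    unfolding gradient_def[abs_def] by (intro continuous_on_vec_lambda)
qed

lemma continuous_on_hessian:
  fixes f :: "real^'n \<Rightarrow> real"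
  assumes "times_cont_diff 2 U f"
  shows "continuous_on U (hessian f)"
proof -
  have "continuous_on U (dir_deriv w (dir_deriv v f))" for v w
    using times_cont_diff_2_dir_deriv[OF assms, of v] by (simp add: dir_deriv_eta[of w])
  then show ?thesis
    unfolding hessian_def[abs_def] by (intro continuous_on_vec_lambda)
qed

lemma line_derivative:
  fixes f :: "real^'n \<Rightarrow> real"
  assumes "times_cont_diff (Suc k) U f" "x + s *\<^sub>R h \<in> U"
  shows "((\<lambda>s. f (x + s *\<^sub>R h)) has_real_derivative gradient f (x + s *\<^sub>R h) \<bullet> h) (at s)"
proof -
  have "((\<lambda>s. x + s *\<^sub>R h) has_derivative (\<lambda>s. s *\<^sub>R h)) (at s)"
    by (auto intro!: derivative_eq_intros)
  from diff_chain_at[OF this has_derivative_gradient[OF assms]] show ?thesis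
    by (simp add: o_def has_field_derivative_def mult.commute[of _ "_ \<bullet> _"])
qed

lemma line_second_derivative:
  fixes f :: "real^'n \<Rightarrow> real"
  assumes "open U" "times_cont_diff 2 U f" "x + s *\<^sub>R h \<in> U"
  shows "((\<lambda>s. gradient f (x + s *\<^sub>R h) \<bullet> k) has_real_derivative (hessian f (x + s *\<^sub>R h) *v h) \<bullet> k) (at s)"
proof -
  have "((\<lambda>s. x + s *\<^sub>R h) has_derivative (\<lambda>s. s *\<^sub>R h)) (at s)"
    by (auto intro!: derivative_eq_intros)
  from diff_chain_at[OF this has_derivative_gradient_hessian[OF assms]]
  have "((\<lambda>s. gradient f (x + s *\<^sub>R h)) has_derivative (\<lambda>r. r *\<^sub>R (hessian f (x + s *\<^sub>R h) *v h))) (at s)"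
    by (simp add: o_def matrix_vector_mult_scaleR)
  from has_derivative_inner_left[OF this, of k] show ?thesis
    by (simp add: has_field_derivative_def mult.commute[of _ "_ \<bullet> _"])
qed

text \<open>If \<open>c\<close> were positive, \<open>g'\<close> would be positive just to the right of \<open>0\<close> and \<open>g\<close> would exceed \<open>g 0\<close>.\<close>

lemma second_derivative_test_max:
  fixes g :: "real \<Rightarrow> real"
  assumes "\<delta> > 0" and g': "\<And>s. \<bar>s\<bar> < \<delta> \<Longrightarrow> (g has_real_derivative g' s) (at s)"
    and "g' 0 = 0" and g'': "(g' has_real_derivative c) (at 0)"
    and max: "\<And>s. \<bar>s\<bar> < \<delta> \<Longrightarrow> g s \<le> g 0"
  shows "c \<le> 0"
proof (rule ccontr)
  assume "\<not> c \<le> 0"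
  then obtain d where d: "d > 0" "\<And>h. 0 < h \<Longrightarrow> h < d \<Longrightarrow> g' 0 < g' (0 + h)"
    using DERIV_pos_inc_right[OF g''] by auto
  define b where "b = min \<delta> d / 2"
  have b: "0 < b" "b < \<delta>" "b < d" using d \<open>\<delta> > 0\<close> by (auto simp: b_def)
  obtain \<xi> where "0 < \<xi>" "\<xi> < b" "g b - g 0 = (b - 0) * g' \<xi>"
    using MVT2[OF b(1), of g g'] g' b by auto
  moreover from this have "g' \<xi> > 0" using d(2)[of \<xi>] b \<open>g' 0 = 0\<close> by auto
  ultimately have "g b > g 0" using b by (simp add: algebra_simps)
  with max[of b] b show False by simp
qed

lemma line_in_open:
  fixes x v :: "'a::real_normed_vector"
  assumes "open U" "x \<in> U"
  obtains d where "d > 0" "\<And>s. \<bar>s\<bar> < d \<Longrightarrow> x + s *\<^sub>R v \<in> U"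
proof -
  have "open ((\<lambda>s. x + s *\<^sub>R v) -` U)" by (intro open_vimage assms continuous_intros)
  moreover have "0 \<in> (\<lambda>s. x + s *\<^sub>R v) -` U" using assms by simp
  ultimately obtain d where "d > 0" "ball 0 d \<subseteq> (\<lambda>s. x + s *\<^sub>R v) -` U"
    using open_contains_ball by blast
  then show ?thesis by (intro that[of d]) (auto simp: subset_iff)
qed

lemma local_max_gradient_hessian:
  fixes f :: "real^'n \<Rightarrow> real"
  assumes "open U" "times_cont_diff 2 U f" "x \<in> U" and max: "\<And>y. y \<in> U \<Longrightarrow> f y \<le> f x"
  shows "gradient f x = 0" "h \<bullet> (hessian f x *v h) \<le> 0"
proof -
  have "(\<lambda>h. gradient f x \<bullet> h) = (\<lambda>h. 0)"
    using differential_zero_maxmin[OF \<open>x \<in> U\<close> \<open>open U\<close>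
        has_derivative_gradient[OF times_cont_diff_2D(1)[OF assms(2)] assms(3)]] max by auto
  then show 0: "gradient f x = 0" by (metis inner_eq_zero_iff)
  obtain \<delta> where \<delta>: "\<delta> > 0" and inU: "\<And>s. \<bar>s\<bar> < \<delta> \<Longrightarrow> x + s *\<^sub>R h \<in> U"
    using line_in_open[OF assms(1,3)] by blast
  have "(hessian f x *v h) \<bullet> h \<le> 0"
  proof (rule second_derivative_test_max[OF \<delta>])
    show "((\<lambda>s. f (x + s *\<^sub>R h)) has_real_derivative gradient f (x + s *\<^sub>R h) \<bullet> h) (at s)"
      if "\<bar>s\<bar> < \<delta>" for s
      using line_derivative[OF times_cont_diff_2D(1)[OF assms(2)] inU[OF that]] .
    show "((\<lambda>s. gradient f (x + s *\<^sub>R h) \<bullet> h) has_real_derivative (hessian f x *v h) \<bullet> h) (at 0)"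
      using line_second_derivative[OF assms(1,2), of x 0 h h] assms(3) by simp
  qed (use 0 max inU in auto)
  then show "h \<bullet> (hessian f x *v h) \<le> 0" by (simp add: inner_commute)
qed

section \<open>Quadratic forms and Hessians\<close>

lemma quadratic_form_sum:
  fixes A :: "real^'n^'n"
  shows "v \<bullet> (A *v w) = (\<Sum>i\<in>UNIV. \<Sum>j\<in>UNIV. v $ i * w $ j * A $ i $ j)"
  by (simp add: inner_vec_def matrix_vector_mult_def sum_distrib_left mult.commute mult.left_commute)

text \<open>Most functions below are given together with their derivatives. This recognises them as twice
continuously differentiable and identifies gradient and Hessian at the same time; the transpose stands for the
order of differentiation in the definition of the Hessian.\<close>

lemma times_cont_diff_2I:
  fixes f :: "real^'n \<Rightarrow> real"
  assumes "open U"
    and f: "\<And>x. x \<in> U \<Longrightarrow> (f has_derivative (\<lambda>h. g x \<bullet> h)) (at x)"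
    and g: "\<And>x. x \<in> U \<Longrightarrow> (g has_derivative (\<lambda>h. H x *v h)) (at x)"
    and H: "continuous_on U H"
  shows "times_cont_diff 2 U f"
    and "x \<in> U \<Longrightarrow> gradient f x = g x"
    and "x \<in> U \<Longrightarrow> hessian f x = transpose (H x)"
proof -
  have 1: "dir_deriv v f x = g x \<bullet> v" if "x \<in> U" for x v
    using dir_deriv_at[OF f[OF that]] .
  have 2: "(dir_deriv v f has_derivative (\<lambda>h. (H x *v h) \<bullet> v)) (at x)" if "x \<in> U" for x v
    using has_derivative_inner_left[OF g[OF that], of v]
    by (rule has_derivative_transform_within_open[OF _ \<open>open U\<close> that]) (simp add: 1)
  have 3: "dir_deriv w (dir_deriv v f) x = (H x *v w) \<bullet> v" if "x \<in> U" for x v w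
    using dir_deriv_at[OF 2[OF that]] .
  have "continuous_on U (dir_deriv w (dir_deriv v f))" for v w
    by (rule continuous_on_eq[of _ "\<lambda>x. v \<bullet> (H x *v w)"])
      (auto simp: 3 quadratic_form_sum inner_commute[of _ v]
        intro!: continuous_on_sum continuous_on_mult continuous_on_const continuous_on_component H)
  then have "times_cont_diff (Suc (Suc 0)) U f"
    unfolding times_cont_diff_Suc_dir_deriv times_cont_diff.simps(1) differentiable_def
    using f 2 by blast
  then show "times_cont_diff 2 U f" by (simp add: numeral_2_eq_2)
  show "gradient f x = g x" if "x \<in> U" using gradient_eqI[OF f[OF that]] .
  show "hessian f x = transpose (H x)" if "x \<in> U"
    by (simp add: hessian_def 3[OF that] transpose_def vec_eq_iff inner_axis
        matrix_vector_mult_basis column_def)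
qed

lemma times_cont_diff_2_diff:
  fixes f g :: "real^'n \<Rightarrow> real"
  assumes "open U" "times_cont_diff 2 U f" "times_cont_diff 2 U g"
  shows "times_cont_diff 2 U (\<lambda>x. f x - g x)"
    and "x \<in> U \<Longrightarrow> gradient (\<lambda>x. f x - g x) x = gradient f x - gradient g x"
    and "x \<in> U \<Longrightarrow> hessian (\<lambda>x. f x - g x) x = hessian f x - hessian g x"
proof -
  have 1: "((\<lambda>x. f x - g x) has_derivative (\<lambda>h. (gradient f x - gradient g x) \<bullet> h)) (at x)"
    if "x \<in> U" for x
    using has_derivative_gradient[OF times_cont_diff_2D(1)[OF assms(2)] that]
      has_derivative_gradient[OF times_cont_diff_2D(1)[OF assms(3)] that]
    by (auto intro!: derivative_eq_intros simp: inner_diff_left)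
  have 2: "((\<lambda>x. gradient f x - gradient g x) has_derivative (\<lambda>h. (hessian f x - hessian g x) *v h)) (at x)"
    if "x \<in> U" for x
    using has_derivative_gradient_hessian[OF assms(1,2) that]
      has_derivative_gradient_hessian[OF assms(1,3) that]
    by (auto intro!: derivative_eq_intros simp: matrix_vector_mult_diff_rdistrib)
  have 3: "continuous_on U (\<lambda>x. hessian f x - hessian g x)"
    by (intro continuous_intros continuous_on_hessian assms)
  note * = times_cont_diff_2I[OF \<open>open U\<close> 1 2 3]
  have tr: "transpose (A - B) = transpose A - transpose B" for A B :: "real^'n^'n"
    by (simp add: transpose_def vec_eq_iff)
  show "times_cont_diff 2 U (\<lambda>x. f x - g x)"
    "x \<in> U \<Longrightarrow> gradient (\<lambda>x. f x - g x) x = gradient f x - gradient g x"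
    "x \<in> U \<Longrightarrow> hessian (\<lambda>x. f x - g x) x = hessian f x - hessian g x"
    using * transpose_hessian[OF assms(1,2)] transpose_hessian[OF assms(1,3)] by (auto simp: tr)
qed

lemma quadratic_form_commute:
  fixes A :: "real^'n^'n"
  assumes "transpose A = A"
  shows "v \<bullet> (A *v w) = w \<bullet> (A *v v)"
  by (metis assms dot_lmul_matrix inner_commute transpose_matrix_vector)

text \<open>The quadratic \<open>t \<mapsto> (v + t w) \<bullet> A (v + t w)\<close> has no negative values, hence no positive
discriminant.\<close>

lemma positive_semidefinite_Cauchy_Schwarz:
  fixes A :: "real^'n^'n"
  assumes sym: "transpose A = A" and psd: "\<And>h. 0 \<le> h \<bullet> (A *v h)"
  shows "(v \<bullet> (A *v w))\<^sup>2 \<le> (v \<bullet> (A *v v)) * (w \<bullet> (A *v w))"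
proof -
  let ?a = "v \<bullet> (A *v v)" and ?b = "v \<bullet> (A *v w)" and ?c = "w \<bullet> (A *v w)"
  have q: "0 \<le> ?a + 2 * t * ?b + t * t * ?c" for t
    using psd[of "v + t *\<^sub>R w"] quadratic_form_commute[OF sym, of w v]
    by (simp add: matrix_vector_right_distrib inner_add_left inner_add_right
        matrix_vector_mult_scaleR algebra_simps)
  show ?thesis
  proof (cases "?c = 0")
    case True
    have "?b = 0"
    proof (rule ccontr)
      assume "?b \<noteq> 0"
      then have "2 * (- (?a + 1) / (2 * ?b)) * ?b = - (?a + 1)" by (simp add: field_simps)
      with q[of "- (?a + 1) / (2 * ?b)"] True show False by simp
    qed
    with True show ?thesis by simp
  next
    case False
    then have "?c > 0" using psd[of w] by simp
    have "0 \<le> (?a + 2 * (- ?b / ?c) * ?b + (- ?b / ?c) * (- ?b / ?c) * ?c) * ?c"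
      using q[of "- ?b / ?c"] \<open>?c > 0\<close> by simp
    also have "\<dots> = ?a * ?c - ?b\<^sup>2"
      using \<open>?c > 0\<close> by (simp add: field_simps power2_eq_square)
    finally show ?thesis by simp
  qed
qed

text \<open>The pairing of a positive with a negative semidefinite matrix, which decides the sign of
\<open>a \<bullet> D\<^sup>2(w - v)\<close> at a maximum. The proof is Gaussian elimination: subtracting
\<open>A e\<^sub>k (A e\<^sub>k)\<^sup>T / A\<^sub>k\<^sub>k\<close> clears row \<open>k\<close> and keeps \<open>A\<close> positive semidefinite by the Cauchy-Schwarz inequality,
while the subtracted square contributes \<open>(A e\<^sub>k) \<bullet> X (A e\<^sub>k) / A\<^sub>k\<^sub>k \<le> 0\<close>.\<close>

lemma inner_psd_nsd_nonpos:
  fixes A X :: "real^'n^'n"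
  assumes "transpose A = A" and "\<And>h. 0 \<le> h \<bullet> (A *v h)" and X: "\<And>h. h \<bullet> (X *v h) \<le> 0"
  shows "A \<bullet> X \<le> 0"
proof -
  have "A \<bullet> X \<le> 0"
    if "finite S" "\<And>i. i \<notin> S \<Longrightarrow> A $ i = 0" "transpose A = A" "\<And>h. 0 \<le> h \<bullet> (A *v h)" for S and A :: "real^'n^'n"
    using that
  proof (induction S arbitrary: A rule: finite_psubset_induct)
    case (psubset S)
    show ?case
    proof (cases "S = {}")
      case True
      then have "A = 0" using psubset.prems by (simp add: vec_eq_iff)
      then show ?thesis by simp
    next
      case False
      then obtain k where k: "k \<in> S" by blast
      define \<alpha> where "\<alpha> = A $ k $ k"
      have entry: "v \<bullet> (A *v axis k 1) = A $ k \<bullet> v" for v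
        using quadratic_form_commute[OF psubset.prems(2), of v "axis k 1"]
        by (simp add: inner_axis' matrix_vector_mul_component)
      have \<alpha>: "axis k 1 \<bullet> (A *v axis k 1) = \<alpha>"
        by (simp add: entry \<alpha>_def inner_axis)
      have CS: "(A $ k \<bullet> v)\<^sup>2 \<le> (v \<bullet> (A *v v)) * \<alpha>" for v
        using positive_semidefinite_Cauchy_Schwarz[OF psubset.prems(2,3), of v "axis k 1"]
        by (simp only: \<alpha>) (simp only: entry)
      have sub: "S - {k} \<subset> S" using k by blast
      show ?thesis
      proof (cases "\<alpha> = 0")
        case True
        have "(A $ k \<bullet> A $ k)\<^sup>2 \<le> 0" using CS[of "A $ k"] True by simp
        then have "A $ k = 0" by simp
        then show ?thesis
          by (intro psubset.IH[OF sub, of A] psubset.prems(2,3)) (use psubset.prems(1) in blast)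
      next
        case False
        then have "\<alpha> > 0" using psubset.prems(3)[of "axis k 1"] \<alpha> by simp
        define B where "B = (\<chi> i j. A $ i $ j - A $ k $ i * A $ k $ j / \<alpha>)"
        have symk: "A $ i $ k = A $ k $ i" for i
          using arg_cong[OF psubset.prems(2), of "\<lambda>B. B $ k $ i"] by (simp add: transpose_def)
        have form: "v \<bullet> (B *v v) = v \<bullet> (A *v v) - (A $ k \<bullet> v)\<^sup>2 / \<alpha>" for v
          by (simp only: quadratic_form_sum) (simp add: B_def power2_eq_square inner_vec_def
              sum_product sum_divide_distrib sum_subtractf[symmetric] algebra_simps)
        have "B \<bullet> X \<le> 0"
        proof (rule psubset.IH[OF sub])
          show "B $ i = 0" if "i \<notin> S - {k}" for i
          proof (cases "i = k")
            case True
            then show ?thesis using \<open>\<alpha> > 0\<close> by (simp add: B_def vec_eq_iff \<alpha>_def)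
          next
            case False
            then have "A $ i = 0" using that psubset.prems(1) by simp
            then show ?thesis using symk[of i] by (simp add: B_def vec_eq_iff)
          qed
          show "transpose B = B"
            using psubset.prems(2) by (simp add: B_def transpose_def vec_eq_iff)
          show "0 \<le> h \<bullet> (B *v h)" for h
            using CS[of h] \<open>\<alpha> > 0\<close> by (simp add: form field_simps)
        qed
        moreover have "A \<bullet> X = B \<bullet> X + (A $ k \<bullet> (X *v (A $ k))) / \<alpha>"
          by (simp only: quadratic_form_sum) (simp add: B_def inner_vec_def
              sum_divide_distrib sum.distrib[symmetric] algebra_simps)
        moreover have "(A $ k \<bullet> (X *v (A $ k))) / \<alpha> \<le> 0"
          using X[of "A $ k"] \<open>\<alpha> > 0\<close> by (simp add: divide_le_0_iff)
        ultimately show ?thesis by simp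
      qed
    qed
  qed
  from this[of UNIV A] assms show ?thesis by simp
qed

section \<open>The comparison principle\<close>

text \<open>Regularity is required inside \<open>D\<close> only, with mere continuity up to the boundary. The operator \<open>a\<close> takes its
argument in the form \<open>(Du, -1)\<close>.\<close>

definition subsolution ::
    "((real^'n) \<times> real \<Rightarrow> real^'n^'n) \<Rightarrow> (real^'n) set \<Rightarrow> real \<Rightarrow> (real^'n \<Rightarrow> real \<Rightarrow> real) \<Rightarrow> bool"
  where "subsolution a D T w \<longleftrightarrow>
    continuous_on (closure D \<times> {0..T}) (\<lambda>(x, t). w x t) \<and>
    (\<forall>t\<in>{0..T}. times_cont_diff 2 D (\<lambda>y. w y t)) \<and>
    (\<forall>x\<in>D. \<forall>t\<in>{0..T}. \<exists>\<tau>. ((\<lambda>s. w x s) has_real_derivative \<tau>) (at t within {0..T}) \<and>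
      \<tau> \<le> a (gradient (\<lambda>y. w y t) x, -1) \<bullet> hessian (\<lambda>y. w y t) x)"

definition supersolution ::
    "((real^'n) \<times> real \<Rightarrow> real^'n^'n) \<Rightarrow> (real^'n) set \<Rightarrow> real \<Rightarrow> (real^'n \<Rightarrow> real \<Rightarrow> real) \<Rightarrow> bool"
  where "supersolution a D T w \<longleftrightarrow>
    continuous_on (closure D \<times> {0..T}) (\<lambda>(x, t). w x t) \<and>
    (\<forall>t\<in>{0..T}. times_cont_diff 2 D (\<lambda>y. w y t)) \<and>
    (\<forall>x\<in>D. \<forall>t\<in>{0..T}. \<exists>\<tau>. ((\<lambda>s. w x s) has_real_derivative \<tau>) (at t within {0..T}) \<and>
      \<tau> \<ge> a (gradient (\<lambda>y. w y t) x, -1) \<bullet> hessian (\<lambda>y. w y t) x)"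

lemma left_max_derivative_nonneg:
  fixes \<psi> :: "real \<Rightarrow> real"
  assumes "(\<psi> has_real_derivative c) (at t within {0..T})" "0 < t" "t \<le> T"
    and "\<And>s. s \<in> {0..T} \<Longrightarrow> \<psi> s \<le> \<psi> t"
  shows "c \<ge> 0"
proof (rule ccontr)
  assume "\<not> c \<ge> 0"
  then obtain d where d: "d > 0" "\<And>h. 0 < h \<Longrightarrow> t - h \<in> {0..T} \<Longrightarrow> h < d \<Longrightarrow> \<psi> t < \<psi> (t - h)"
    using has_real_derivative_neg_dec_left[OF assms(1)] by (metis not_le_imp_less)
  define h where "h = min d t / 2"
  have "0 < h" "h < d" "t - h \<in> {0..T}" using d assms by (auto simp: h_def)
  with d(2)[of h] assms(4)[of "t - h"] show False by simp
qed

text \<open>At an interior maximum of \<open>w - v - \<epsilon> t\<close> the two gradients agree, so both Hessians are paired with the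
same matrix and the difference of the two sides has a sign, although the equation is nonlinear and
degenerate.\<close>

lemma comparison_principle:
  assumes "open D" "bounded D"
    and sym: "\<And>q. transpose (a (q, -1)) = a (q, -1)"
    and psd: "\<And>q h. 0 \<le> h \<bullet> (a (q, -1) *v h)"
    and sub: "subsolution a D T w" and super: "supersolution a D T v"
    and init: "\<And>x. x \<in> closure D \<Longrightarrow> w x 0 \<le> v x 0"
    and lateral: "\<And>x t. x \<in> frontier D \<Longrightarrow> t \<in> {0..T} \<Longrightarrow> w x t \<le> v x t"
    and x: "x \<in> closure D" and t: "t \<in> {0..T}"
  shows "w x t \<le> v x t"
proof (rule ccontr)
  assume "\<not> w x t \<le> v x t"
  \<comment> \<open>so small that \<open>\<epsilon> t\<close> is at most half of the assumed excess\<close>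
  define \<epsilon> where "\<epsilon> = (w x t - v x t) / (2 * (T + 1))"
  have "T \<ge> 0" using t by simp
  then have "\<epsilon> > 0" using \<open>\<not> w x t \<le> v x t\<close> by (simp add: \<epsilon>_def)
  have "\<epsilon> * t \<le> \<epsilon> * (T + 1)" using \<open>\<epsilon> > 0\<close> t by (intro mult_left_mono) auto
  also have "\<dots> = (w x t - v x t) / 2" using \<open>T \<ge> 0\<close> by (simp add: \<epsilon>_def field_simps)
  also have "\<dots> < w x t - v x t" using \<open>\<not> w x t \<le> v x t\<close> by simp
  finally have pos: "0 < w x t - v x t - \<epsilon> * t" by simp
  define \<phi> where "\<phi> = (\<lambda>z. (\<lambda>(x, t). w x t) z - (\<lambda>(x, t). v x t) z - \<epsilon> * snd z)"
  have "compact (closure D \<times> {0..T})"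
    using \<open>bounded D\<close> by (intro compact_Times) (auto simp: compact_closure)
  moreover have "continuous_on (closure D \<times> {0..T}) \<phi>"
    using sub super unfolding \<phi>_def subsolution_def supersolution_def by (intro continuous_intros) auto
  moreover have "closure D \<times> {0..T} \<noteq> {}" using x t by auto
  ultimately obtain z where "z \<in> closure D \<times> {0..T}" "\<And>y. y \<in> closure D \<times> {0..T} \<Longrightarrow> \<phi> y \<le> \<phi> z"
    using continuous_attains_sup[of "closure D \<times> {0..T}" \<phi>] by blast
  then obtain x1 t1 where z: "x1 \<in> closure D" "t1 \<in> {0..T}"
    and max: "\<And>y s. y \<in> closure D \<Longrightarrow> s \<in> {0..T} \<Longrightarrow> \<phi> (y, s) \<le> \<phi> (x1, t1)"
    by (metis mem_Times_iff prod.collapse SigmaI)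
  have pos1: "\<phi> (x1, t1) > 0" using max[OF x t] pos by (simp add: \<phi>_def)
  have "t1 \<noteq> 0"
    using pos1 init[OF z(1)] by (auto simp: \<phi>_def)
  moreover have "x1 \<notin> frontier D"
  proof
    assume "x1 \<in> frontier D"
    moreover have "0 \<le> \<epsilon> * t1" using \<open>\<epsilon> > 0\<close> z by simp
    ultimately show False using lateral[of x1 t1] pos1 z by (simp add: \<phi>_def)
  qed
  ultimately have "0 < t1" "x1 \<in> D"
    using z \<open>open D\<close> by (auto simp: frontier_def interior_open)
  obtain \<tau>1 where \<tau>1: "((\<lambda>s. w x1 s) has_real_derivative \<tau>1) (at t1 within {0..T})"
      "\<tau>1 \<le> a (gradient (\<lambda>y. w y t1) x1, -1) \<bullet> hessian (\<lambda>y. w y t1) x1"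
    using sub \<open>x1 \<in> D\<close> z unfolding subsolution_def by blast
  obtain \<tau>2 where \<tau>2: "((\<lambda>s. v x1 s) has_real_derivative \<tau>2) (at t1 within {0..T})"
      "\<tau>2 \<ge> a (gradient (\<lambda>y. v y t1) x1, -1) \<bullet> hessian (\<lambda>y. v y t1) x1"
    using super \<open>x1 \<in> D\<close> z unfolding supersolution_def by blast
  have "((\<lambda>s. w x1 s - v x1 s - \<epsilon> * s) has_real_derivative (\<tau>1 - \<tau>2 - \<epsilon>)) (at t1 within {0..T})"
    using \<tau>1 \<tau>2 by (auto intro!: derivative_eq_intros)
  then have time: "\<tau>1 - \<tau>2 - \<epsilon> \<ge> 0"
    by (rule left_max_derivative_nonneg) (use \<open>0 < t1\<close> z max[of x1] in \<open>auto simp: \<phi>_def\<close>)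
  have C2: "times_cont_diff 2 D (\<lambda>y. w y t1)" "times_cont_diff 2 D (\<lambda>y. v y t1)"
    using sub super z unfolding subsolution_def supersolution_def by auto
  have max': "w y t1 - v y t1 \<le> w x1 t1 - v x1 t1" if "y \<in> D" for y
    using max[of y t1] z that closure_subset by (auto simp: \<phi>_def)
  note diff = times_cont_diff_2_diff[OF \<open>open D\<close> C2]
  note test = local_max_gradient_hessian[OF \<open>open D\<close> diff(1) \<open>x1 \<in> D\<close> max']
  have grad: "gradient (\<lambda>y. w y t1) x1 = gradient (\<lambda>y. v y t1) x1"
    using test(1) diff(2)[OF \<open>x1 \<in> D\<close>] by simp
  have "a (gradient (\<lambda>y. w y t1) x1, -1) \<bullet> (hessian (\<lambda>y. w y t1) x1 - hessian (\<lambda>y. v y t1) x1) \<le> 0"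
    using test(2) diff(3)[OF \<open>x1 \<in> D\<close>] by (intro inner_psd_nsd_nonpos sym psd) simp
  then have "\<tau>1 \<le> \<tau>2"
    using \<tau>1(2) \<tau>2(2) by (simp add: inner_diff_right grad)
  with time \<open>\<epsilon> > 0\<close> show False by simp
qed

lemma subsolution_restrict:
  assumes "subsolution a D T w" "D' \<subseteq> D" "T' \<le> T"
  shows "subsolution a D' T' w"
  unfolding subsolution_def
proof (intro conjI ballI)
  have "closure D' \<times> {0..T'} \<subseteq> closure D \<times> {0..T}"
    using closure_mono[OF assms(2)] assms(3) by (intro Sigma_mono) auto
  then show "continuous_on (closure D' \<times> {0..T'}) (\<lambda>(x, t). w x t)"
    using assms(1) continuous_on_subset unfolding subsolution_def by blast
  show "times_cont_diff 2 D' (\<lambda>y. w y t)" if "t \<in> {0..T'}" for t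
  proof -
    have "t \<in> {0..T}" using that assms(3) by simp
    then show ?thesis
      using assms(1) times_cont_diff_subset[OF _ assms(2)] unfolding subsolution_def by blast
  qed
  fix x t assume x: "x \<in> D'" and t: "t \<in> {0..T'}"
  then have "x \<in> D" "t \<in> {0..T}" using assms by auto
  then obtain \<tau> where \<tau>: "((\<lambda>s. w x s) has_real_derivative \<tau>) (at t within {0..T})"
      "\<tau> \<le> a (gradient (\<lambda>y. w y t) x, -1) \<bullet> hessian (\<lambda>y. w y t) x"
    using assms(1) unfolding subsolution_def by blast
  have "((\<lambda>s. w x s) has_real_derivative \<tau>) (at t within {0..T'})"
    by (rule DERIV_subset[OF \<tau>(1)]) (use assms in auto)
  with \<tau>(2) show "\<exists>\<tau>. ((\<lambda>s. w x s) has_real_derivative \<tau>) (at t within {0..T'}) \<and>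
      \<tau> \<le> a (gradient (\<lambda>y. w y t) x, -1) \<bullet> hessian (\<lambda>y. w y t) x" by blast
qed

lemma times_cont_diff_2_uminus:
  fixes f :: "real^'n \<Rightarrow> real"
  assumes "open U" "times_cont_diff 2 U f"
  shows "times_cont_diff 2 U (\<lambda>x. - f x)"
    and "x \<in> U \<Longrightarrow> gradient (\<lambda>x. - f x) x = - gradient f x"
    and "x \<in> U \<Longrightarrow> hessian (\<lambda>x. - f x) x = - hessian f x"
proof -
  have D0: "((\<lambda>x. 0::real) has_derivative (\<lambda>h. 0 \<bullet> h)) (at x)"
    "((\<lambda>x. 0::real^'n) has_derivative (\<lambda>h. 0 *v h)) (at x)" for x :: "real^'n"
    by auto
  note Z = times_cont_diff_2I[OF \<open>open U\<close> D0 continuous_on_const]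
  show "times_cont_diff 2 U (\<lambda>x. - f x)"
    "x \<in> U \<Longrightarrow> gradient (\<lambda>x. - f x) x = - gradient f x"
    "x \<in> U \<Longrightarrow> hessian (\<lambda>x. - f x) x = - hessian f x"
    using times_cont_diff_2_diff[OF \<open>open U\<close> Z(1) assms(2)] Z(2,3)[of x]
    by (auto simp: transpose_def zero_vec_def)
qed

text \<open>The negative of a solution solves the equation of the reflected operator. This turns lower bounds
into upper bounds.\<close>

lemma subsolution_uminus:
  assumes "open D" "supersolution a D T w"
  shows "subsolution (\<lambda>p. a (- fst p, snd p)) D T (\<lambda>x t. - w x t)"
  unfolding subsolution_def
proof (intro conjI ballI)
  show "continuous_on (closure D \<times> {0..T}) (\<lambda>(x, t). - w x t)"
    using assms(2) continuous_on_minus[of _ "\<lambda>(x, t). w x t"]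
    unfolding supersolution_def by (simp add: case_prod_beta')
  have C2: "times_cont_diff 2 D (\<lambda>y. w y t)" if "t \<in> {0..T}" for t
    using assms(2) that unfolding supersolution_def by auto
  note neg = times_cont_diff_2_uminus[OF assms(1) C2]
  show "times_cont_diff 2 D (\<lambda>y. - w y t)" if "t \<in> {0..T}" for t
    using neg(1)[OF that] .
  fix x t assume x: "x \<in> D" and t: "t \<in> {0..T}"
  then obtain \<tau> where \<tau>: "((\<lambda>s. w x s) has_real_derivative \<tau>) (at t within {0..T})"
      "\<tau> \<ge> a (gradient (\<lambda>y. w y t) x, -1) \<bullet> hessian (\<lambda>y. w y t) x"
    using assms(2) unfolding supersolution_def by blast
  have "((\<lambda>s. - w x s) has_real_derivative - \<tau>) (at t within {0..T})"
    using \<tau>(1) by (auto intro!: derivative_eq_intros)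
  then show "\<exists>\<tau>. ((\<lambda>s. - w x s) has_real_derivative \<tau>) (at t within {0..T}) \<and>
      \<tau> \<le> a (- fst (gradient (\<lambda>y. - w y t) x, - 1 :: real), snd (gradient (\<lambda>y. - w y t) x, - 1))
        \<bullet> hessian (\<lambda>y. - w y t) x"
    using \<tau>(2) neg(2,3)[OF t x] by (intro exI[of _ "- \<tau>"]) simp
qed

section \<open>Barriers for degenerate anisotropic operators\<close>

text \<open>The properties of \<open>G D\<^sup>2F\<close> that the barriers use. Homogeneity of degree zero identifies
\<open>a (Dv, -1)\<close> for steep \<open>v\<close> with values near the horizontal directions \<open>(q, 0)\<close>; the lower bound of the trace
is all the ellipticity that is left.\<close>

locale anisotropic_operator =
  fixes a :: "(real^'n) \<times> real \<Rightarrow> real^'n^'n" and c :: real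
  assumes continuous_a: "continuous_on (- {0}) a"
    and scale: "p \<noteq> 0 \<Longrightarrow> r > 0 \<Longrightarrow> a (r *\<^sub>R p) = a p"
    and symmetric: "p \<noteq> 0 \<Longrightarrow> transpose (a p) = a p"
    and psd: "p \<noteq> 0 \<Longrightarrow> 0 \<le> h \<bullet> (a p *v h)"
    and c_pos: "c > 0"
    and trace_ge: "p \<noteq> 0 \<Longrightarrow> c \<le> a p \<bullet> mat 1"

text \<open>The form in which the bounds on the spatial derivatives of the boundary data enter the barriers. The slope
\<open>l\<close> may depend on \<open>x\<close>, and in particular carry arbitrary normal components; its size and the remainder are
controlled by the same constant.\<close>

definition taylor_bounded :: "real \<Rightarrow> (real^'n) set \<Rightarrow> (real^'n \<Rightarrow> real) \<Rightarrow> bool"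
  where "taylor_bounded C S \<phi> \<longleftrightarrow>
    (\<forall>x\<in>S. \<exists>l. norm l \<le> C \<and> (\<forall>y\<in>S. \<bar>\<phi> y - \<phi> x - l \<bullet> (y - x)\<bar> \<le> C * (norm (y - x))\<^sup>2))"

text \<open>In time, a Lipschitz bound is kept: the slopes of \<open>taylor_bounded\<close> at different times are unrelated.\<close>

definition boundary_data :: "real \<Rightarrow> real \<Rightarrow> (real^'n) set \<Rightarrow> real \<Rightarrow> (real^'n \<Rightarrow> real \<Rightarrow> real) \<Rightarrow> bool"
  where "boundary_data C M S T f \<longleftrightarrow>
    (\<forall>t\<in>{0..T}. taylor_bounded C S (\<lambda>y. f y t)) \<and>
    (\<forall>x\<in>S. \<forall>s\<in>{0..T}. \<forall>t\<in>{0..T}. \<bar>f x s - f x t\<bar> \<le> M * \<bar>s - t\<bar>)"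

definition attains_data ::
    "(real^'n) set \<Rightarrow> real \<Rightarrow> (real^'n \<Rightarrow> real \<Rightarrow> real) \<Rightarrow> (real^'n \<Rightarrow> real) \<Rightarrow> (real^'n \<Rightarrow> real \<Rightarrow> real) \<Rightarrow> bool"
  where "attains_data \<Omega> T f u0 u \<longleftrightarrow>
    (\<forall>x\<in>frontier \<Omega>. \<forall>t\<in>{0..T}. u x t = f x t) \<and> (\<forall>x\<in>closure \<Omega>. u x 0 = u0 x)"

text \<open>The convexity of the boundary that the operator sees. For the isotropic operator
\<open>I - p p\<^sup>T / \<bar>p\<bar>\<^sup>2\<close> the condition is positivity of the mean curvature.\<close>

definition operator_convex_boundary ::
    "((real^'n) \<times> real \<Rightarrow> real^'n^'n) \<Rightarrow> (real^'n) set \<Rightarrow> bool"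
  where "operator_convex_boundary a \<Omega> \<longleftrightarrow> (\<forall>x\<in>frontier \<Omega>. \<exists>U \<rho>.
    local_defining_function 2 \<Omega> x U \<rho> \<and> a (gradient \<rho> x, 0) \<bullet> hessian \<rho> x < 0)"

text \<open>All barriers have this shape. They decrease in time at speed \<open>M\<close> so as to stay above boundary data
which at earlier times may have been larger by \<open>M (T - t)\<close>.\<close>

lemma quadratic_barrier:
  fixes \<rho> :: "real^'n \<Rightarrow> real"
  assumes "open U" "times_cont_diff 2 U \<rho>" "open D" "closure D \<subseteq> U"
    and op: "\<And>x. x \<in> D \<Longrightarrow>
      a (K *\<^sub>R gradient \<rho> x + l + (2 * C) *\<^sub>R (x - x0), -1) \<bullet> ((2 * C) *\<^sub>R mat 1 + K *\<^sub>R hessian \<rho> x) \<le> - M"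
  shows "supersolution a D T
    (\<lambda>x t. \<alpha> + M * (T - t) + l \<bullet> (x - x0) + C * (norm (x - x0))\<^sup>2 + K * \<rho> x)"
  unfolding supersolution_def
proof (intro conjI ballI)
  have cont_\<rho>: "continuous_on (closure D) \<rho>"
    using times_cont_diff_continuous[OF assms(2)] assms(4) continuous_on_subset by blast
  have "continuous_on (closure D \<times> {0..T}) (\<lambda>z. \<rho> (fst z))"
    by (rule continuous_on_compose2[OF cont_\<rho>]) (auto intro!: continuous_intros)
  then show "continuous_on (closure D \<times> {0..T})
      (\<lambda>(x, t). \<alpha> + M * (T - t) + l \<bullet> (x - x0) + C * (norm (x - x0))\<^sup>2 + K * \<rho> x)"
    unfolding case_prod_beta' by (intro continuous_intros)
  have DU: "D \<subseteq> U" using assms(4) closure_subset by blast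
  have sq: "(norm (x - x0))\<^sup>2 = (x - x0) \<bullet> (x - x0)" for x
    by (simp add: power2_norm_eq_inner)
  have 1: "((\<lambda>x. \<alpha> + M * (T - t) + l \<bullet> (x - x0) + C * (norm (x - x0))\<^sup>2 + K * \<rho> x) has_derivative
      (\<lambda>h. (K *\<^sub>R gradient \<rho> x + l + (2 * C) *\<^sub>R (x - x0)) \<bullet> h)) (at x)" if "x \<in> D" for x t
    unfolding sq
    using has_derivative_gradient[OF times_cont_diff_2D(1)[OF assms(2)], of x] that DU
    by (auto intro!: derivative_eq_intros simp: fun_eq_iff algebra_simps inner_commute)
  have 2: "((\<lambda>x. K *\<^sub>R gradient \<rho> x + l + (2 * C) *\<^sub>R (x - x0)) has_derivative
      (\<lambda>h. ((2 * C) *\<^sub>R mat 1 + K *\<^sub>R hessian \<rho> x) *v h)) (at x)" if "x \<in> D" for x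
    using has_derivative_gradient_hessian[OF assms(1,2), of x] that DU
    by (auto intro!: derivative_eq_intros
        simp: fun_eq_iff algebra_simps matrix_vector_mult_add_rdistrib scaleR_matrix_vector_assoc[symmetric])
  have 3: "continuous_on D (\<lambda>x. (2 * C) *\<^sub>R mat 1 + K *\<^sub>R hessian \<rho> x)"
    by (intro continuous_intros continuous_on_subset[OF continuous_on_hessian[OF assms(2)] DU])
  note v = times_cont_diff_2I[OF assms(3) 1 2 3]
  show "times_cont_diff 2 D (\<lambda>x. \<alpha> + M * (T - t) + l \<bullet> (x - x0) + C * (norm (x - x0))\<^sup>2 + K * \<rho> x)" for t
    using v(1) by blast
  fix x t assume x: "x \<in> D"
  have tr: "transpose ((2 * C) *\<^sub>R mat 1 + K *\<^sub>R hessian \<rho> x) = (2 * C) *\<^sub>R mat 1 + K *\<^sub>R hessian \<rho> x"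
    using transpose_hessian[OF assms(1,2), of x] x DU
    by (auto simp: transpose_def vec_eq_iff mat_def)
  let ?v = "\<lambda>t x. \<alpha> + M * (T - t) + l \<bullet> (x - x0) + C * (norm (x - x0))\<^sup>2 + K * \<rho> x"
  have v2: "gradient (?v t) x = K *\<^sub>R gradient \<rho> x + l + (2 * C) *\<^sub>R (x - x0)"
    and v3: "hessian (?v t) x = transpose ((2 * C) *\<^sub>R mat 1 + K *\<^sub>R hessian \<rho> x)"
    using v(2,3) x by blast+
  have "((\<lambda>s. \<alpha> + M * (T - s) + l \<bullet> (x - x0) + C * (norm (x - x0))\<^sup>2 + K * \<rho> x) has_real_derivative - M)
      (at t within {0..T})"
    by (auto intro!: derivative_eq_intros)
  then show "\<exists>\<tau>. ((\<lambda>s. \<alpha> + M * (T - s) + l \<bullet> (x - x0) + C * (norm (x - x0))\<^sup>2 + K * \<rho> x) has_real_derivative \<tau>)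
      (at t within {0..T}) \<and>
    a (gradient (\<lambda>x. \<alpha> + M * (T - t) + l \<bullet> (x - x0) + C * (norm (x - x0))\<^sup>2 + K * \<rho> x) x, - 1)
      \<bullet> hessian (\<lambda>x. \<alpha> + M * (T - t) + l \<bullet> (x - x0) + C * (norm (x - x0))\<^sup>2 + K * \<rho> x) x \<le> \<tau>"
    using op[OF x] v2 v3 by (intro exI[of _ "- M"]) (simp only: tr)
qed

lemma taylor_bounded_oscillation:
  assumes "taylor_bounded C S \<phi>" "x \<in> S" "y \<in> S" "norm (y - x) \<le> d"
  shows "\<bar>\<phi> y - \<phi> x\<bar> \<le> C * d + C * d\<^sup>2"
proof -
  obtain l where l: "norm l \<le> C" "\<bar>\<phi> y - \<phi> x - l \<bullet> (y - x)\<bar> \<le> C * (norm (y - x))\<^sup>2"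
    using assms unfolding taylor_bounded_def by blast
  have "C \<ge> 0" using l(1) norm_ge_zero order_trans by blast
  have "\<bar>l \<bullet> (y - x)\<bar> \<le> C * d"
    using Cauchy_Schwarz_ineq2[of l "y - x"] mult_mono[OF l(1) assms(4)] \<open>C \<ge> 0\<close> by simp
  moreover have "C * (norm (y - x))\<^sup>2 \<le> C * d\<^sup>2"
    using \<open>C \<ge> 0\<close> assms(4) by (intro mult_left_mono power_mono) auto
  ultimately show ?thesis using l(2) by linarith
qed

context anisotropic_operator
begin

lemma uminus_operator: "anisotropic_operator (\<lambda>p. a (- fst p, snd p)) c"
proof
  have ne: "(- fst p, snd p) \<noteq> 0" if "p \<noteq> 0" for p :: "(real^'n) \<times> real"
    using that by (auto simp: prod_eq_iff)
  show "continuous_on (- {0}) (\<lambda>p. a (- fst p, snd p))"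
    by (rule continuous_on_compose2[OF continuous_a]) (auto intro!: continuous_intros simp: prod_eq_iff)
  fix p :: "(real^'n) \<times> real" assume p: "p \<noteq> 0"
  show "a (- fst (r *\<^sub>R p), snd (r *\<^sub>R p)) = a (- fst p, snd p)" if "r > 0" for r
    using scale[OF ne[OF p] that] by simp
  show "transpose (a (- fst p, snd p)) = a (- fst p, snd p)" by (rule symmetric[OF ne[OF p]])
  show "0 \<le> h \<bullet> (a (- fst p, snd p) *v h)" for h by (rule psd[OF ne[OF p]])
  show "c \<le> a (- fst p, snd p) \<bullet> mat 1" by (rule trace_ge[OF ne[OF p]])
qed (rule c_pos)

lemma trace_bounded: obtains A where "A > 0" "\<And>p. p \<noteq> 0 \<Longrightarrow> a p \<bullet> mat 1 \<le> A"
proof -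
  have "continuous_on (sphere 0 1) (\<lambda>p. a p \<bullet> mat 1)"
    by (intro continuous_intros continuous_on_subset[OF continuous_a]) auto
  then have "compact ((\<lambda>p. a p \<bullet> mat 1) ` sphere 0 1)"
    by (intro compact_continuous_image) auto
  then have "bounded ((\<lambda>p. a p \<bullet> mat 1) ` sphere 0 1)" by (rule compact_imp_bounded)
  then obtain A where A: "A > 0" "\<And>p. p \<in> sphere 0 1 \<Longrightarrow> norm (a p \<bullet> mat 1) \<le> A"
    unfolding bounded_pos by blast
  have "a p \<bullet> mat 1 \<le> A" if "p \<noteq> 0" for p
  proof -
    have "a ((1 / norm p) *\<^sub>R p) = a p" using that by (intro scale) auto
    moreover have "(1 / norm p) *\<^sub>R p \<in> sphere 0 1" using that by simp
    ultimately show ?thesis using A(2)[of "(1 / norm p) *\<^sub>R p"] by simp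
  qed
  with A(1) show ?thesis by (rule that)
qed

lemma comparison:
  assumes "open D" "bounded D" "subsolution a D T w" "supersolution a D T v"
    and "\<And>x. x \<in> closure D \<Longrightarrow> w x 0 \<le> v x 0"
    and "\<And>x t. x \<in> frontier D \<Longrightarrow> t \<in> {0..T} \<Longrightarrow> w x t \<le> v x t"
    and "x \<in> closure D" "t \<in> {0..T}"
  shows "w x t \<le> v x t"
  by (rule comparison_principle[OF assms(1,2) symmetric psd assms(3-8)]) (auto simp: prod_eq_iff)

text \<open>The solution stays within a distance of its boundary values that is independent of \<open>T\<close>. The
barrier is a concave paraboloid that descends with speed \<open>M\<close> to its position at the time \<open>t0\<close> of interest: the
lower bound of the trace makes it a supersolution once its curvature is \<open>M / c\<close>, and then its height
over \<open>\<Omega>\<close> is fixed.\<close>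

lemma global_upper_bound:
  assumes "open \<Omega>" "bounded \<Omega>" "C \<ge> 0" "M \<ge> 0" and u0: "continuous_on (closure \<Omega>) u0"
  obtains B where "B \<ge> 0"
    "\<And>T f u y x t. boundary_data C M (frontier \<Omega>) T f \<Longrightarrow> subsolution a \<Omega> T u \<Longrightarrow>
      attains_data \<Omega> T f u0 u \<Longrightarrow> y \<in> frontier \<Omega> \<Longrightarrow> x \<in> closure \<Omega> \<Longrightarrow> t \<in> {0..T} \<Longrightarrow>
      u x t \<le> f y t + B"
proof -
  have "bounded (closure \<Omega>)" using assms by (simp add: bounded_closure)
  then obtain R where R: "R > 0" "\<And>x. x \<in> closure \<Omega> \<Longrightarrow> norm x \<le> R"
    unfolding bounded_pos by blast
  have "bounded (u0 ` closure \<Omega>)"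
    using assms by (intro compact_imp_bounded compact_continuous_image u0) (simp add: compact_closure)
  then obtain m where m: "m > 0" "\<And>x. x \<in> closure \<Omega> \<Longrightarrow> \<bar>u0 x\<bar> \<le> m"
    unfolding bounded_pos by auto
  define osc where "osc = C * (2 * R) + C * (2 * R)\<^sup>2"
  \<comment> \<open>with this curvature the trace bound \<open>c\<close> just balances the speed \<open>M\<close>\<close>
  define b where "b = M / (2 * c)"
  have "osc \<ge> 0" using R \<open>C \<ge> 0\<close> by (simp add: osc_def)
  have "b \<ge> 0" using c_pos \<open>M \<ge> 0\<close> by (simp add: b_def)
  show thesis
  proof (rule that[of "osc + 2 * m + b * R\<^sup>2"])
    show "0 \<le> osc + 2 * m + b * R\<^sup>2" using \<open>osc \<ge> 0\<close> \<open>b \<ge> 0\<close> m by simp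
    fix T f u y x t0
    assume f: "boundary_data C M (frontier \<Omega>) T f" and sub: "subsolution a \<Omega> T u"
      and u: "attains_data \<Omega> T f u0 u" and y: "y \<in> frontier \<Omega>" and x: "x \<in> closure \<Omega>" and t0: "t0 \<in> {0..T}"
    define \<alpha> where "\<alpha> = f y t0 + osc + 2 * m + b * R\<^sup>2"
    have fr: "z \<in> closure \<Omega>" if "z \<in> frontier \<Omega>" for z using that by (simp add: frontier_def)
    have ft: "\<bar>f z s - f z t\<bar> \<le> M * \<bar>s - t\<bar>" if "z \<in> frontier \<Omega>" "s \<in> {0..T}" "t \<in> {0..T}" for z s t
      using f that unfolding boundary_data_def by blast
    have osc: "\<bar>f z t - f y t\<bar> \<le> osc" if "z \<in> frontier \<Omega>" "t \<in> {0..T}" for z t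
      unfolding osc_def
    proof (rule taylor_bounded_oscillation)
      show "taylor_bounded C (frontier \<Omega>) (\<lambda>y. f y t)"
        using f that unfolding boundary_data_def by blast
      show "norm (z - y) \<le> 2 * R"
        using norm_triangle_ineq4[of z y] R(2)[OF fr[OF that(1)]] R(2)[OF fr[OF y]] by simp
    qed (use that y in auto)
    have D0: "((\<lambda>x. 0::real) has_derivative (\<lambda>h. 0 \<bullet> h)) (at x)"
      "((\<lambda>x. 0::real^'n) has_derivative (\<lambda>h. 0 *v h)) (at x)" for x :: "real^'n"
      by auto
    note Z = times_cont_diff_2I(1)[OF open_UNIV D0 continuous_on_const]
    have "a (0 *\<^sub>R gradient (\<lambda>x. 0) x + 0 + (2 * - b) *\<^sub>R (x - 0), -1) \<bullet>
        ((2 * - b) *\<^sub>R mat 1 + 0 *\<^sub>R hessian (\<lambda>x. 0) x) \<le> - M" for x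
    proof -
      have "2 * b * c \<le> 2 * b * (a ((2 * - b) *\<^sub>R x, -1) \<bullet> mat 1)"
        using \<open>b \<ge> 0\<close> by (intro mult_left_mono trace_ge) (auto simp: prod_eq_iff)
      moreover have "2 * b * c = M" using c_pos by (simp add: b_def)
      ultimately show ?thesis by simp
    qed
    from quadratic_barrier[OF open_UNIV Z assms(1) subset_UNIV this, where T = t0 and \<alpha> = \<alpha>]
    have super: "supersolution a \<Omega> t0 (\<lambda>x t. \<alpha> + M * (t0 - t) - b * (norm x)\<^sup>2)"
      by simp
    have \<alpha>: "f y t0 + osc + 2 * m \<le> \<alpha> - b * (norm z)\<^sup>2" if "z \<in> closure \<Omega>" for z
    proof -
      have "b * (norm z)\<^sup>2 \<le> b * R\<^sup>2"
        using \<open>b \<ge> 0\<close> R(2)[OF that] by (intro mult_left_mono power_mono) auto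
      then show ?thesis by (simp add: \<alpha>_def)
    qed
    have "u x t0 \<le> \<alpha> + M * (t0 - t0) - b * (norm x)\<^sup>2"
    proof (rule comparison[OF assms(1,2) subsolution_restrict[OF sub order_refl] super])
      show "t0 \<le> T" using t0 by simp
      show "u z 0 \<le> \<alpha> + M * (t0 - 0) - b * (norm z)\<^sup>2" if z: "z \<in> closure \<Omega>" for z
      proof -
        have "u z 0 \<le> m" using u z m(2)[OF z] unfolding attains_data_def by auto
        moreover have "f y 0 \<ge> - m"
          using u y m(2)[OF fr[OF y]] fr[OF y] t0 unfolding attains_data_def by force
        moreover have "f y 0 \<le> f y t0 + M * t0"
          using ft[OF y, of 0 t0] t0 by auto
        ultimately show ?thesis using \<alpha>[OF z] \<open>osc \<ge> 0\<close> by simp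
      qed
      show "u z t \<le> \<alpha> + M * (t0 - t) - b * (norm z)\<^sup>2" if z: "z \<in> frontier \<Omega>" and t: "t \<in> {0..t0}" for z t
      proof -
        have tT: "t \<in> {0..T}" using t t0 by auto
        have "u z t = f z t" using u z tT unfolding attains_data_def by blast
        moreover have "f z t \<le> f y t + osc" using osc[OF z tT] by simp
        moreover have "f y t \<le> f y t0 + M * (t0 - t)"
          using ft[OF y tT t0] t by auto
        ultimately show ?thesis using \<alpha>[OF fr[OF z]] m(1) by simp
      qed
    qed (use x t0 in auto)
    also have "\<dots> \<le> \<alpha>" using \<open>b \<ge> 0\<close> by simp
    finally show "u x t0 \<le> f y t0 + (osc + 2 * m + b * R\<^sup>2)" by (simp add: \<alpha>_def)
  qed
qed

end

lemma compact_uniform_constant: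
  fixes S :: "'a::metric_space set" and P :: "real \<Rightarrow> 'a \<Rightarrow> bool"
  assumes "compact S" and local: "\<And>x. x \<in> S \<Longrightarrow> \<exists>r>0. \<exists>L. \<forall>y\<in>S \<inter> ball x r. P L y"
    and mono: "\<And>L L' y. P L y \<Longrightarrow> L \<le> L' \<Longrightarrow> P L' y"
  obtains L where "L \<ge> 0" "\<And>y. y \<in> S \<Longrightarrow> P L y"
proof -
  obtain r L where rL: "\<And>x. x \<in> S \<Longrightarrow> r x > 0" "\<And>x y. x \<in> S \<Longrightarrow> y \<in> S \<inter> ball x (r x) \<Longrightarrow> P (L x) y"
    using local by metis
  have "S \<subseteq> (\<Union>x\<in>S. ball x (r x))" using rL(1) by force
  from compactE_image[OF \<open>compact S\<close> _ this] obtain X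
    where X: "X \<subseteq> S" "finite X" "S \<subseteq> (\<Union>x\<in>X. ball x (r x))" by auto
  define L0 where "L0 = (\<Sum>x\<in>X. \<bar>L x\<bar>)"
  show thesis
  proof (rule that[of L0])
    show "L0 \<ge> 0" by (simp add: L0_def sum_nonneg)
    fix y assume "y \<in> S"
    then obtain x where x: "x \<in> X" "y \<in> ball x (r x)" using X by blast
    have "L x \<le> \<bar>L x\<bar>" by simp
    also have "\<dots> \<le> L0" unfolding L0_def using x X by (intro member_le_sum) auto
    finally show "P L0 y" using rL(2)[of x y] x X \<open>y \<in> S\<close> mono by blast
  qed
qed

lemma defining_functionD:
  fixes \<Omega> :: "(real^'n) set"
  assumes "local_defining_function k \<Omega> x U \<rho>"
  shows "open U" "x \<in> U" "\<And>m. enat m \<le> k \<Longrightarrow> times_cont_diff m U \<rho>"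
    "\<And>y. y \<in> U \<Longrightarrow> gradient \<rho> y \<noteq> 0"
    "\<And>y. y \<in> U \<Longrightarrow> y \<in> \<Omega> \<longleftrightarrow> \<rho> y > 0" "\<And>y. y \<in> U \<Longrightarrow> y \<in> frontier \<Omega> \<longleftrightarrow> \<rho> y = 0"
  using assms Ck_on_times_cont_diff[of k U \<rho>] unfolding local_defining_function_def by blast+

lemma enat_2_le_2: "enat 2 \<le> 2"
  by (simp add: numeral_eq_enat)

lemma mvt_segment_le:
  fixes f :: "real^'n \<Rightarrow> real"
  assumes "times_cont_diff (Suc 0) U f" "closed_segment x y \<subseteq> U"
  obtains z where "z \<in> closed_segment x y" "f y - f x = gradient f z \<bullet> (y - x)"
proof -
  have inU: "x + s *\<^sub>R (y - x) \<in> closed_segment x y" if "0 \<le> s" "s \<le> 1" for s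
    using that by (auto simp: in_segment algebra_simps intro!: exI[of _ s])
  have "((\<lambda>s. f (x + s *\<^sub>R (y - x))) has_real_derivative gradient f (x + s *\<^sub>R (y - x)) \<bullet> (y - x)) (at s)"
    if "0 \<le> s" "s \<le> 1" for s
    using line_derivative[OF assms(1), of x s "y - x"] inU[OF that] assms(2) by blast
  from MVT2[OF zero_less_one this] obtain s where s: "0 < s" "s < 1"
    "f (x + 1 *\<^sub>R (y - x)) - f (x + 0 *\<^sub>R (y - x)) = (1 - 0) * (gradient f (x + s *\<^sub>R (y - x)) \<bullet> (y - x))"
    by blast
  then show ?thesis using that[OF inU[of s]] by simp
qed

text \<open>Near a boundary point the defining function increases in one fixed direction \<open>\<nu>\<close>, at a rate
comparable to the length of its gradient.\<close>

lemma normal_neighbourhood: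
  fixes \<rho> :: "real^'n \<Rightarrow> real"
  assumes U: "open U" "x1 \<in> U" and C1: "times_cont_diff (Suc 0) U \<rho>" and g1: "gradient \<rho> x1 \<noteq> 0"
  defines "\<nu> \<equiv> gradient \<rho> x1 /\<^sub>R norm (gradient \<rho> x1)"
  shows "\<exists>c>0. \<exists>\<delta>>0. ball x1 \<delta> \<subseteq> U \<and> norm \<nu> = 1 \<and> gradient \<rho> x1 \<bullet> \<nu> = 2 * c \<and>
    (\<forall>x\<in>ball x1 \<delta>. norm (gradient \<rho> x) \<le> 3 * c \<and> c \<le> gradient \<rho> x \<bullet> \<nu>)"
proof -
  let ?g = "gradient \<rho>"
  have \<nu>: "norm \<nu> = 1" using g1 by (simp add: \<nu>_def)
  define c where "c = norm (?g x1) / 2"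
  have "c > 0" using g1 by (simp add: c_def)
  have g1\<nu>: "?g x1 \<bullet> \<nu> = 2 * c"
    using g1 by (simp add: \<nu>_def c_def power2_norm_eq_inner[symmetric] power2_eq_square)
  have "isCont ?g x1"
    using continuous_on_gradient[OF C1] U continuous_on_eq_continuous_at by blast
  then obtain d where d: "d > 0" "\<And>x. dist x x1 < d \<Longrightarrow> dist (?g x) (?g x1) < c"
    using \<open>c > 0\<close> unfolding continuous_at_eps_delta by blast
  obtain d' where d': "d' > 0" "ball x1 d' \<subseteq> U" using U open_contains_ball by blast
  have "norm (?g x) \<le> 3 * c \<and> c \<le> ?g x \<bullet> \<nu>" if "x \<in> ball x1 (min d d')" for x
  proof
    have near: "norm (?g x - ?g x1) < c"
      using d(2)[of x] that by (simp add: dist_norm norm_minus_commute)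
    have "norm (?g x) \<le> norm (?g x1) + norm (?g x - ?g x1)" by (rule norm_triangle_sub)
    then show "norm (?g x) \<le> 3 * c" using near by (simp add: c_def)
    have "\<bar>(?g x - ?g x1) \<bullet> \<nu>\<bar> \<le> c"
      using Cauchy_Schwarz_ineq2[of "?g x - ?g x1" \<nu>] near \<nu> by simp
    then show "c \<le> ?g x \<bullet> \<nu>" using g1\<nu> by (simp add: inner_diff_left)
  qed
  moreover have "min d d' > 0" "ball x1 (min d d') \<subseteq> U" using d d' by auto
  ultimately show ?thesis using \<open>c > 0\<close> \<nu> g1\<nu> by blast
qed

context anisotropic_operator
begin

text \<open>The one-sided boundary gradient estimate, with a constant that is uniform for \<open>x0\<close> near \<open>x1\<close>. The barrier is
\<open>f(x0,t0) + M (t0 - t) + l \<bullet> (x - x0) + C \<bar>x - x0\<bar>\<^sup>2 + K \<rho>(x)\<close> on \<open>\<Omega> \<inter> ball x0 r\<close>. The radius \<open>r\<close> depends on the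
geometry only, then \<open>C\<close> is chosen so that the barrier wins on the sphere \<open>\<bar>x - x0\<bar> = r\<close>, and at last \<open>K\<close>. Since \<open>a\<close>
has degree zero, \<open>a (Dv, -1)\<close> is its value at \<open>(\<nabla>\<rho> + \<eta>1, \<eta>2)\<close> with \<open>\<eta>1, \<eta>2 = O(1/K)\<close>, so a
neighbourhood of \<open>(\<nabla>\<rho>(x1), 0)\<close> in which \<open>a \<bullet> D\<^sup>2\<rho>\<close> stays below \<open>- c0\<close> suffices and no quantitative
expansion of \<open>a\<close> enters.\<close>

lemma local_barrier:
  assumes \<Omega>: "open \<Omega>" "bounded \<Omega>" and "C0 \<ge> 0" "M \<ge> 0"
    and u0: "\<And>x y. x \<in> closure \<Omega> \<Longrightarrow> y \<in> closure \<Omega> \<Longrightarrow> \<bar>u0 x - u0 y\<bar> \<le> L0 * norm (x - y)"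
    and "L0 \<ge> 0" "B \<ge> 0"
    and convex: "operator_convex_boundary a \<Omega>" and x1: "x1 \<in> frontier \<Omega>"
    and B: "\<And>T f u y x t. boundary_data C0 M (frontier \<Omega>) T f \<Longrightarrow> subsolution a \<Omega> T u \<Longrightarrow>
      attains_data \<Omega> T f u0 u \<Longrightarrow> y \<in> frontier \<Omega> \<Longrightarrow> x \<in> closure \<Omega> \<Longrightarrow> t \<in> {0..T} \<Longrightarrow>
      u x t \<le> f y t + B"
  shows "\<exists>r>0. \<exists>L. \<forall>x0\<in>frontier \<Omega> \<inter> ball x1 r. \<forall>T f u x t.
      boundary_data C0 M (frontier \<Omega>) T f \<longrightarrow> subsolution a \<Omega> T u \<longrightarrow>
      attains_data \<Omega> T f u0 u \<longrightarrow> x \<in> closure \<Omega> \<longrightarrow> t \<in> {0..T} \<longrightarrow>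
      u x t \<le> f x0 t + L * norm (x - x0)"
proof -
  obtain U \<rho> where def: "local_defining_function 2 \<Omega> x1 U \<rho>"
    and neg: "a (gradient \<rho> x1, 0) \<bullet> hessian \<rho> x1 < 0"
    using convex x1 unfolding operator_convex_boundary_def by blast
  note U = defining_functionD[OF def]
  have C2: "times_cont_diff 2 U \<rho>" by (rule U(3)[OF enat_2_le_2])
  note C1 = times_cont_diff_2D(1)[OF C2]
  let ?g = "gradient \<rho>" and ?H = "hessian \<rho>"
  have cont_g: "continuous_on U ?g" by (rule continuous_on_gradient[OF C1])
  have cont_H: "continuous_on U ?H" by (rule continuous_on_hessian[OF C2])
  have g1: "?g x1 \<noteq> 0" using U(2,4) by blast
  define \<nu> where "\<nu> = ?g x1 /\<^sub>R norm (?g x1)"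
  obtain k \<delta>1 where "k > 0" and \<delta>1: "\<delta>1 > 0" "ball x1 \<delta>1 \<subseteq> U"
    and \<nu>: "norm \<nu> = 1" "?g x1 \<bullet> \<nu> = 2 * k"
    and near: "\<forall>x\<in>ball x1 \<delta>1. norm (?g x) \<le> 3 * k \<and> k \<le> ?g x \<bullet> \<nu>"
    using normal_neighbourhood[OF U(1,2) C1 g1, folded \<nu>_def] by blast
  have isg: "isCont ?g x1" and isH: "isCont ?H x1"
    using cont_g cont_H U(1,2) continuous_on_eq_continuous_at by blast+
  define c0 where "c0 = - (a (?g x1, 0) \<bullet> ?H x1) / 2"
  have "c0 > 0" using neg by (simp add: c0_def)
  \<comment> \<open>continuity of the operator at the boundary point\<close>
  have "isCont (\<lambda>z. a (?g (fst z) + fst (snd z), snd (snd z)) \<bullet> ?H (fst z)) (x1, 0)"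
  proof (intro continuous_intros)
    have ne: "(?g (fst (x1, 0::(real^'n)\<times>real)) + fst (snd (x1, 0::(real^'n)\<times>real)), snd (snd (x1, 0::(real^'n)\<times>real))) \<in> - {0}"
      using g1 by (simp add: prod_eq_iff)
    have a: "isCont a (?g (fst (x1, 0::(real^'n)\<times>real)) + fst (snd (x1, 0::(real^'n)\<times>real)), snd (snd (x1, 0::(real^'n)\<times>real)))"
      using continuous_a ne continuous_on_eq_continuous_at[of "- {0}" a] by (simp add: open_Compl)
    show "isCont (\<lambda>z. a (?g (fst z) + fst (snd z), snd (snd z))) (x1, 0)"
    proof (rule isCont_o2[where g = a and f = "\<lambda>z. (?g (fst z) + fst (snd z), snd (snd z))"])
      have "isCont (\<lambda>z. ?g (fst z)) (x1, 0::(real^'n)\<times>real)"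
        by (rule isCont_o2[where f = fst and g = ?g]) (simp_all add: isg)
      then show "isCont (\<lambda>z. (?g (fst z) + fst (snd z), snd (snd z))) (x1, 0::(real^'n)\<times>real)"
        by (intro continuous_intros)
    qed (rule a)
    show "isCont (\<lambda>z. ?H (fst z)) (x1, 0)"
      by (rule isCont_o2[where f = fst and g = ?H]) (simp_all add: isH)
  qed
  then have "\<forall>\<^sub>F z in at (x1, 0). a (?g (fst z) + fst (snd z), snd (snd z)) \<bullet> ?H (fst z) < - c0"
    unfolding isCont_def by (rule order_tendstoD) (use \<open>c0 > 0\<close> in \<open>simp add: c0_def\<close>)
  then obtain \<epsilon> where \<epsilon>: "\<epsilon> > 0" "\<And>z. z \<noteq> (x1, 0) \<Longrightarrow> dist z (x1, 0) < \<epsilon> \<Longrightarrow>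
      a (?g (fst z) + fst (snd z), snd (snd z)) \<bullet> ?H (fst z) < - c0"
    unfolding eventually_at by blast
  have op: "a (?g x + \<eta>1, \<eta>2) \<bullet> ?H x \<le> - c0" if "dist x x1 < \<epsilon> / 2" "norm \<eta>1 < \<epsilon> / 4" "\<bar>\<eta>2\<bar> < \<epsilon> / 4" for x \<eta>1 \<eta>2
  proof (cases "(x, \<eta>1, \<eta>2) = (x1, 0)")
    case True
    then show ?thesis using \<open>c0 > 0\<close> by (simp add: c0_def zero_prod_def)
  next
    case False
    have "dist (x, \<eta>1, \<eta>2) (x1, 0) \<le> dist x x1 + norm (\<eta>1, \<eta>2)"
      using sqrt_sum_squares_le_sum_abs[of "dist x x1" "norm (\<eta>1, \<eta>2)"] by (simp add: dist_Pair_Pair zero_prod_def[symmetric])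
    also have "norm (\<eta>1, \<eta>2) \<le> norm \<eta>1 + \<bar>\<eta>2\<bar>"
      using sqrt_sum_squares_le_sum_abs[of "norm \<eta>1" "norm \<eta>2"] by (simp add: norm_Pair)
    finally have "dist (x, \<eta>1, \<eta>2) (x1, 0) < \<epsilon>" using that by simp
    from \<epsilon>(2)[OF False this] show ?thesis by simp
  qed
  define \<delta> where "\<delta> = min \<delta>1 (\<epsilon> / 2)"
  have \<delta>: "\<delta> > 0" "\<delta> \<le> \<delta>1" "\<delta> \<le> \<epsilon> / 2"
    using \<delta>1 \<epsilon> by (auto simp: \<delta>_def)
  have ballU: "ball x1 \<delta> \<subseteq> U" using \<delta>1 \<delta> by auto
  define G where "G = 3 * k"
  have g_near: "norm (?g x) \<le> G" "k \<le> ?g x \<bullet> \<nu>" if "x \<in> ball x1 \<delta>" for x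
    using near that \<delta>(2) by (auto simp: G_def)
  have \<rho>_lip: "\<bar>\<rho> y - \<rho> x\<bar> \<le> G * norm (y - x)" if "x \<in> ball x1 \<delta>" "y \<in> ball x1 \<delta>" for x y
  proof -
    have seg: "closed_segment x y \<subseteq> ball x1 \<delta>" using that by (simp add: closed_segment_subset)
    then obtain z where "z \<in> closed_segment x y" "\<rho> y - \<rho> x = ?g z \<bullet> (y - x)"
      using mvt_segment_le[OF C1, of x y] ballU by blast
    then show ?thesis
      using Cauchy_Schwarz_ineq2[of "?g z" "y - x"] g_near(1)[of z] seg
        mult_right_mono[of "norm (?g z)" G "norm (y - x)"] by force
  qed
  define r where "r = \<delta> / (2 + G / k)"
  have "G / k = 3" using \<open>k > 0\<close> by (simp add: G_def)
  then have r: "r > 0" "5 * r = \<delta>" using \<delta> by (auto simp: r_def)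
  obtain A where A: "A > 0" "\<And>p. p \<noteq> 0 \<Longrightarrow> a p \<bullet> mat 1 \<le> A"
    using trace_bounded by blast
  \<comment> \<open>on the sphere of radius \<open>r\<close> the paraboloid exceeds the global bound \<open>B\<close>\<close>
  define C where "C = C0 + (B + C0 * r) / r\<^sup>2"
  have C: "C0 \<le> C" "B + C0 * r \<le> C * r\<^sup>2"
    using r \<open>B \<ge> 0\<close> \<open>C0 \<ge> 0\<close> by (auto simp: C_def field_simps)
  then have "C \<ge> 0" using \<open>C0 \<ge> 0\<close> by simp
  \<comment> \<open>the entries make, in this order, the rescaled gradient close to \<open>\<nabla>\<rho>\<close>, the function a supersolution, and its initial values large enough\<close>
  define K where "K = Max {(4 * (C0 + 2 * C * r + 1)) / \<epsilon> + 1, (M + 2 * C * A) / c0, (L0 + C0 + 4 * C * \<delta>) / k}"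
  have K: "(4 * (C0 + 2 * C * r + 1)) / \<epsilon> < K" "(M + 2 * C * A) / c0 \<le> K" "(L0 + C0 + 4 * C * \<delta>) / k \<le> K"
    by (auto simp: K_def)
  have "0 \<le> (4 * (C0 + 2 * C * r + 1)) / \<epsilon>" using \<epsilon> r \<open>C \<ge> 0\<close> \<open>C0 \<ge> 0\<close> by simp
  then have "K > 0" using K(1) by simp
  define L where "L = C0 + C * r + K * G + B / r"
  have Lge: "C0 + C * r + K * G \<le> L" "B / r \<le> L"
    using r \<open>B \<ge> 0\<close> \<open>C \<ge> 0\<close> \<open>C0 \<ge> 0\<close> \<open>K > 0\<close> \<open>k > 0\<close> by (auto simp: L_def G_def)
  have fr: "z \<in> closure \<Omega>" if "z \<in> frontier \<Omega>" for z using that by (simp add: frontier_def)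
  have "u x t0 \<le> f x0 t0 + L * norm (x - x0)"
    if x0: "x0 \<in> frontier \<Omega> \<inter> ball x1 r" and f: "boundary_data C0 M (frontier \<Omega>) T f"
      and sub: "subsolution a \<Omega> T u" and u: "attains_data \<Omega> T f u0 u"
      and x: "x \<in> closure \<Omega>" and t0: "t0 \<in> {0..T}" for x0 T f u x t0
  proof (cases "norm (x - x0) < r")
    case False
    then have "1 \<le> norm (x - x0) / r" using r by simp
    then have "B * 1 \<le> B * (norm (x - x0) / r)" using \<open>B \<ge> 0\<close> by (rule mult_left_mono)
    also have "\<dots> = B / r * norm (x - x0)" by simp
    also have "\<dots> \<le> L * norm (x - x0)" using Lge by (intro mult_right_mono) auto
    finally show ?thesis using B[OF f sub u _ x t0, of x0] x0 by simp
  next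
    case True
    have x0f: "x0 \<in> frontier \<Omega>" and x0b: "dist x1 x0 < r" using x0 by auto
    have x0\<delta>: "x0 \<in> ball x1 \<delta>" using x0b r by simp
    then have \<rho>x0: "\<rho> x0 = 0" using U(6)[of x0] x0f ballU by blast
    have ft: "f z s \<le> f z t + M * \<bar>s - t\<bar>" if "z \<in> frontier \<Omega>" "s \<in> {0..T}" "t \<in> {0..T}" for z s t
      using f that unfolding boundary_data_def by (smt (verit))
    obtain l where l: "norm l \<le> C0"
      and taylor: "\<And>y. y \<in> frontier \<Omega> \<Longrightarrow> \<bar>f y t0 - f x0 t0 - l \<bullet> (y - x0)\<bar> \<le> C0 * (norm (y - x0))\<^sup>2"
      using f t0 x0f unfolding boundary_data_def taylor_bounded_def by blast
    define v where "v = (\<lambda>x t. f x0 t0 + M * (t0 - t) + l \<bullet> (x - x0) + C * (norm (x - x0))\<^sup>2 + K * \<rho> x)"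
    define D where "D = \<Omega> \<inter> ball x0 r"
    have D: "open D" "bounded D" "D \<subseteq> \<Omega>" using \<Omega> by (auto simp: D_def)
    have clD: "z \<in> closure \<Omega>" "norm (z - x0) \<le> r" "z \<in> ball x1 (2 * r)" if "z \<in> closure D" for z
    proof -
      show "z \<in> closure \<Omega>" using that closure_mono[OF D(3)] by blast
      have "closure D \<subseteq> cball x0 r" by (rule closure_minimal) (auto simp: D_def)
      then have z: "dist x0 z \<le> r" using that by auto
      then show "norm (z - x0) \<le> r" by (simp add: dist_norm norm_minus_commute)
      show "z \<in> ball x1 (2 * r)" using z x0b dist_triangle[of x1 z x0] by simp
    qed
    have b2: "ball x1 (2 * r) \<subseteq> ball x1 \<delta>" using r by (intro subset_ball) simp
    have clDU: "closure D \<subseteq> U" using clD(3) b2 ballU by blast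
    have \<rho>_nonneg: "\<rho> z \<ge> 0" if "z \<in> closure D" for z
    proof -
      have "z \<in> \<Omega> \<or> z \<in> frontier \<Omega>"
        using clD(1)[OF that] \<Omega>(1) by (auto simp: frontier_def interior_open)
      then show ?thesis using U(5)[of z] U(6)[of z] clDU that by force
    qed
    have l_le: "\<bar>l \<bullet> z\<bar> \<le> C0 * norm z" for z
      using Cauchy_Schwarz_ineq2[of l z] mult_right_mono[OF l, of "norm z"] by simp
    have super: "supersolution a D t0 v"
      unfolding v_def
    proof (rule quadratic_barrier[OF U(1) C2 D(1) clDU])
      fix x assume "x \<in> D"
      then have xD: "x \<in> closure D" using closure_subset by blast
      define \<eta>1 where "\<eta>1 = (l + (2 * C) *\<^sub>R (x - x0)) /\<^sub>R K"
      define \<eta>2 where "\<eta>2 = - 1 / K"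
      have "norm (l + (2 * C) *\<^sub>R (x - x0)) \<le> C0 + 2 * C * r"
        using norm_triangle_ineq[of l "(2 * C) *\<^sub>R (x - x0)"] l \<open>C \<ge> 0\<close>
          mult_left_mono[OF clD(2)[OF xD], of "2 * C"] by simp
      also have "\<dots> < C0 + 2 * C * r + 1" by simp
      also have small: "C0 + 2 * C * r + 1 < K * \<epsilon> / 4"
        using K(1) \<epsilon>(1) by (simp add: field_simps)
      finally have lt: "norm (l + (2 * C) *\<^sub>R (x - x0)) < K * \<epsilon> / 4" .
      have "norm \<eta>1 = norm (l + (2 * C) *\<^sub>R (x - x0)) / K"
        unfolding \<eta>1_def norm_scaleR using \<open>K > 0\<close> by (simp add: divide_inverse mult.commute)
      then have "norm \<eta>1 < \<epsilon> / 4"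
        using \<open>K > 0\<close> lt by (simp add: divide_less_eq mult.commute)
      moreover have "1 < K * \<epsilon> / 4"
      proof -
        have "0 \<le> C0 + 2 * C * r" using \<open>C0 \<ge> 0\<close> \<open>C \<ge> 0\<close> r by simp
        then show ?thesis using small by linarith
      qed
      then have "\<bar>\<eta>2\<bar> < \<epsilon> / 4"
        using \<open>K > 0\<close> by (simp add: \<eta>2_def field_simps)
      moreover have "dist x x1 < \<epsilon> / 2"
        using clD(3)[OF xD] b2 \<delta>(3) by (auto simp: dist_commute)
      ultimately have Hneg: "a (?g x + \<eta>1, \<eta>2) \<bullet> ?H x \<le> - c0" by (intro op)
      have "(K *\<^sub>R ?g x + l + (2 * C) *\<^sub>R (x - x0), -1) = K *\<^sub>R (?g x + \<eta>1, \<eta>2)"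
      proof -
        have "K *\<^sub>R \<eta>1 = l + (2 * C) *\<^sub>R (x - x0)" "K * \<eta>2 = -1"
          unfolding \<eta>1_def \<eta>2_def scaleR_scaleR using \<open>K > 0\<close> by simp_all
        then show ?thesis by (simp add: scaleR_right_distrib add.assoc)
      qed
      moreover have ne: "(?g x + \<eta>1, \<eta>2) \<noteq> 0" using \<open>K > 0\<close> by (simp add: \<eta>2_def prod_eq_iff)
      ultimately have eq: "a (K *\<^sub>R ?g x + l + (2 * C) *\<^sub>R (x - x0), -1) = a (?g x + \<eta>1, \<eta>2)"
        using scale[OF ne \<open>K > 0\<close>] by simp
      have "2 * C * (a (?g x + \<eta>1, \<eta>2) \<bullet> mat 1) \<le> 2 * C * A"
        using A(2)[OF ne] \<open>C \<ge> 0\<close> by (intro mult_left_mono) auto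
      moreover have "K * (a (?g x + \<eta>1, \<eta>2) \<bullet> ?H x) \<le> K * - c0"
        using Hneg \<open>K > 0\<close> by (intro mult_left_mono) auto
      moreover have "M + 2 * C * A \<le> K * c0"
        using K(2) \<open>c0 > 0\<close> by (simp add: field_simps)
      ultimately show "a (K *\<^sub>R ?g x + l + (2 * C) *\<^sub>R (x - x0), -1) \<bullet>
          ((2 * C) *\<^sub>R mat 1 + K *\<^sub>R ?H x) \<le> - M"
        unfolding eq by (simp add: inner_add_right)
    qed
    have init: "u z 0 \<le> v z 0" if z: "z \<in> closure D" for z
    proof -
      \<comment> \<open>going down by \<open>\<tau>0\<close> in the direction \<open>- \<nu>\<close> makes \<open>\<rho>\<close> nonpositive, so there is a boundary point \<open>y\<close> on the way; the initial datum at \<open>z\<close> is compared with the one at \<open>y\<close>\<close>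
      define \<tau>0 where "\<tau>0 = \<rho> z / k"
      have \<tau>0: "\<tau>0 \<ge> 0" using \<rho>_nonneg[OF z] \<open>k > 0\<close> by (simp add: \<tau>0_def)
      have "\<rho> z \<le> G * norm (z - x0)"
        using \<rho>_lip[OF x0\<delta>, of z] clD(3)[OF z] b2 \<rho>x0 by auto
      also have "\<dots> \<le> 3 * k * r"
        using clD(2)[OF z] \<open>k > 0\<close> by (simp add: G_def)
      finally have "\<tau>0 \<le> 3 * r" using \<open>k > 0\<close> by (simp add: \<tau>0_def field_simps)
      have path: "z - s *\<^sub>R \<nu> \<in> ball x1 \<delta>" if "0 \<le> s" "s \<le> \<tau>0" for s
      proof -
        have "dist x1 (z - s *\<^sub>R \<nu>) \<le> dist x1 z + dist z (z - s *\<^sub>R \<nu>)" by (rule dist_triangle)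
        also have "dist z (z - s *\<^sub>R \<nu>) = s" using that \<nu> by (simp add: dist_norm)
        finally show ?thesis using clD(3)[OF z] that \<open>\<tau>0 \<le> 3 * r\<close> r by simp
      qed
      have end_le: "\<rho> (z - \<tau>0 *\<^sub>R \<nu>) \<le> 0"
      proof -
        have seg: "closed_segment z (z - \<tau>0 *\<^sub>R \<nu>) \<subseteq> ball x1 \<delta>"
          using path[of 0] path[of \<tau>0] \<tau>0 by (simp add: closed_segment_subset)
        then obtain w where w: "w \<in> closed_segment z (z - \<tau>0 *\<^sub>R \<nu>)"
          "\<rho> (z - \<tau>0 *\<^sub>R \<nu>) - \<rho> z = ?g w \<bullet> ((z - \<tau>0 *\<^sub>R \<nu>) - z)"
          using mvt_segment_le[OF C1, of z "z - \<tau>0 *\<^sub>R \<nu>"] ballU by blast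
        have "\<tau>0 * k \<le> \<tau>0 * (?g w \<bullet> \<nu>)" using g_near(2)[of w] w seg \<tau>0 by (intro mult_left_mono) auto
        moreover have "\<tau>0 * k = \<rho> z" using \<open>k > 0\<close> by (simp add: \<tau>0_def)
        ultimately show ?thesis using w(2) by simp
      qed
      have "continuous_on {0..\<tau>0} (\<lambda>s. \<rho> (z - s *\<^sub>R \<nu>))"
        by (rule continuous_on_compose2[OF times_cont_diff_continuous[OF C2]])
          (use path ballU in \<open>auto intro!: continuous_intros\<close>)
      then obtain s where s: "0 \<le> s" "s \<le> \<tau>0" "\<rho> (z - s *\<^sub>R \<nu>) = 0"
        using IVT2'[of "\<lambda>s. \<rho> (z - s *\<^sub>R \<nu>)" \<tau>0 0 0] end_le \<tau>0 \<rho>_nonneg[OF z] by auto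
      define y where "y = z - s *\<^sub>R \<nu>"
      have yb: "y \<in> ball x1 \<delta>" using path[OF s(1,2)] by (simp add: y_def)
      then have y: "y \<in> frontier \<Omega>" using U(6)[of y] s(3) ballU by (auto simp: y_def)
      have zy: "norm (z - y) = s" using s \<nu> by (simp add: y_def)
      have dz: "norm (z - x0) \<le> \<delta>" using clD(2)[OF z] r by simp
      have "dist y x0 \<le> dist x1 y + dist x1 x0" by (rule dist_triangle3)
      then have dy: "norm (y - x0) \<le> 2 * \<delta>" using yb x0b r by (simp add: dist_norm)
      have "u z 0 = u0 z" "u y 0 = u0 y" "u y 0 = f y 0"
        using u clD(1)[OF z] y fr[OF y] t0 unfolding attains_data_def by auto
      then have "u z 0 \<le> f y 0 + L0 * s"
        using u0[OF clD(1)[OF z] fr[OF y]] zy by simp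
      also have "f y 0 \<le> f y t0 + M * t0" using ft[OF y, of 0 t0] t0 by auto
      also have "f y t0 \<le> f x0 t0 + l \<bullet> (y - x0) + C0 * (norm (y - x0))\<^sup>2" using taylor[OF y] by simp
      also have "l \<bullet> (y - x0) \<le> l \<bullet> (z - x0) + C0 * s"
        using l_le[of "y - z"] zy by (simp add: inner_diff_right norm_minus_commute)
      also have "C0 * (norm (y - x0))\<^sup>2 \<le> C * (norm (y - x0))\<^sup>2"
        using C(1) by (intro mult_right_mono) auto
      also have "C * (norm (y - x0))\<^sup>2 \<le> C * ((norm (z - x0))\<^sup>2 + 4 * \<delta> * s)"
      proof (intro mult_left_mono \<open>C \<ge> 0\<close>)
        have "norm (y - x0) \<le> norm (z - x0) + s"
          using norm_triangle_ineq[of "z - x0" "y - z"] zy by (simp add: norm_minus_commute)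
        then have "(norm (y - x0) - norm (z - x0)) * (norm (y - x0) + norm (z - x0))
            \<le> s * (norm (y - x0) + norm (z - x0))"
          by (intro mult_right_mono) auto
        also have "\<dots> \<le> s * (4 * \<delta>)"
          using dy dz s(1) \<delta>(1) by (intro mult_left_mono) auto
        finally show "(norm (y - x0))\<^sup>2 \<le> (norm (z - x0))\<^sup>2 + 4 * \<delta> * s"
          by (simp add: power2_eq_square algebra_simps)
      qed
      finally have "u z 0 \<le> f x0 t0 + M * t0 + l \<bullet> (z - x0) + C * (norm (z - x0))\<^sup>2 + (L0 + C0 + 4 * C * \<delta>) * s"
        by (simp add: algebra_simps)
      also have "(L0 + C0 + 4 * C * \<delta>) * s \<le> (L0 + C0 + 4 * C * \<delta>) * (\<rho> z / k)"
        using s(2) \<open>L0 \<ge> 0\<close> \<open>C0 \<ge> 0\<close> \<open>C \<ge> 0\<close> \<delta>(1) by (intro mult_left_mono) (auto simp: \<tau>0_def)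
      also have "\<dots> = (L0 + C0 + 4 * C * \<delta>) / k * \<rho> z" by simp
      also have "\<dots> \<le> K * \<rho> z"
        using K(3) \<rho>_nonneg[OF z] by (rule mult_right_mono)
      finally show ?thesis by (simp add: v_def)
    qed
    have lateral: "u z t \<le> v z t" if z: "z \<in> frontier D" and t: "t \<in> {0..t0}" for z t
    proof -
      have tT: "t \<in> {0..T}" using t t0 by auto
      have zD: "z \<in> closure D" using z by (simp add: frontier_def)
      show ?thesis
      proof (cases "z \<in> \<Omega>")
        case False
        then have zf: "z \<in> frontier \<Omega>"
          using clD(1)[OF zD] \<Omega>(1) by (auto simp: frontier_def interior_open)
        have "u z t = f z t" using u zf tT unfolding attains_data_def by blast
        moreover have "f z t \<le> f z t0 + M * (t0 - t)" using ft[OF zf tT t0] t by simp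
        moreover have "f z t0 \<le> f x0 t0 + l \<bullet> (z - x0) + C0 * (norm (z - x0))\<^sup>2" using taylor[OF zf] by simp
        moreover have "C0 * (norm (z - x0))\<^sup>2 \<le> C * (norm (z - x0))\<^sup>2"
          using C(1) by (intro mult_right_mono) auto
        moreover have "0 \<le> K * \<rho> z" using \<rho>_nonneg[OF zD] \<open>K > 0\<close> by simp
        ultimately show ?thesis unfolding v_def by linarith
      next
        case True
        have "z \<notin> D" using z D(1) by (auto simp: frontier_def interior_open)
        then have nz: "norm (z - x0) = r"
          using True clD(2)[OF zD] by (auto simp: D_def dist_norm norm_minus_commute)
        have "u z t \<le> f x0 t + B" by (rule B[OF f sub u x0f clD(1)[OF zD] tT])
        moreover have "f x0 t \<le> f x0 t0 + M * (t0 - t)" using ft[OF x0f tT t0] t by simp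
        moreover have "B \<le> C * r\<^sup>2 + l \<bullet> (z - x0)" using C(2) l_le[of "z - x0"] nz by simp
        moreover have "0 \<le> K * \<rho> z" using \<rho>_nonneg[OF zD] \<open>K > 0\<close> by simp
        ultimately show ?thesis unfolding v_def nz by linarith
      qed
    qed
    have xD: "x \<in> closure D"
      using True x open_Int_closure_subset[of "ball x0 r" \<Omega>]
      by (auto simp: D_def Int_commute dist_norm norm_minus_commute)
    have "u x t0 \<le> v x t0"
      by (rule comparison[OF D(1,2) subsolution_restrict[OF sub D(3)] super init lateral xD])
        (use t0 in auto)
    also have "v x t0 = f x0 t0 + l \<bullet> (x - x0) + C * (norm (x - x0))\<^sup>2 + K * \<rho> x" by (simp add: v_def)
    also have "l \<bullet> (x - x0) \<le> C0 * norm (x - x0)" using l_le[of "x - x0"] by simp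
    also have "C * (norm (x - x0))\<^sup>2 \<le> C * (r * norm (x - x0))"
      unfolding power2_eq_square using True \<open>C \<ge> 0\<close> by (intro mult_left_mono mult_right_mono) auto
    also have "K * \<rho> x \<le> K * (G * norm (x - x0))"
    proof (intro mult_left_mono)
      show "\<rho> x \<le> G * norm (x - x0)"
        using \<rho>_lip[OF x0\<delta>, of x] clD(3)[OF xD] b2 \<rho>x0 by auto
    qed (use \<open>K > 0\<close> in simp)
    finally have "u x t0 \<le> f x0 t0 + (C0 + C * r + K * G) * norm (x - x0)" by (simp add: algebra_simps)
    also have "\<dots> \<le> f x0 t0 + L * norm (x - x0)" using Lge(1) by (simp add: mult_right_mono)
    finally show ?thesis .
  qed
  with r(1) show ?thesis by blast
qed

end

section \<open>From the boundary to the interior\<close>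

lemma subsolution_translate:
  assumes "subsolution a \<Omega> T u" "open \<Omega>" "open D" and shift: "\<And>x. x \<in> D \<Longrightarrow> x + h \<in> \<Omega>"
  shows "subsolution a D T (\<lambda>x t. u (x + h) t)"
  unfolding subsolution_def
proof (intro conjI ballI)
  have cl: "x + h \<in> closure \<Omega>" if "x \<in> closure D" for x
  proof -
    have "(\<lambda>x. x + h) ` closure D \<subseteq> closure ((\<lambda>x. x + h) ` D)"
      by (rule image_closure_subset) (auto intro!: continuous_intros closure_subset[THEN subsetD])
    also have "\<dots> \<subseteq> closure \<Omega>" using shift by (intro closure_mono) auto
    finally show ?thesis using that by blast
  qed
  have "continuous_on (closure \<Omega> \<times> {0..T}) (\<lambda>(x, t). u x t)"
    using assms(1) unfolding subsolution_def by blast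
  from continuous_on_compose2[OF this, of "closure D \<times> {0..T}" "\<lambda>z. (fst z + h, snd z)"]
  show "continuous_on (closure D \<times> {0..T}) (\<lambda>(x, t). u (x + h) t)"
    using cl by (force intro!: continuous_intros simp: case_prod_beta')
  have C2: "times_cont_diff 2 \<Omega> (\<lambda>y. u y t)" if "t \<in> {0..T}" for t
    using assms(1) that unfolding subsolution_def by blast
  have D: "times_cont_diff 2 D (\<lambda>y. u (y + h) t)"
    "x \<in> D \<Longrightarrow> gradient (\<lambda>y. u (y + h) t) x = gradient (\<lambda>y. u y t) (x + h)"
    "x \<in> D \<Longrightarrow> hessian (\<lambda>y. u (y + h) t) x = hessian (\<lambda>y. u y t) (x + h)"
    if t: "t \<in> {0..T}" for x t
  proof -
    have tr: "((\<lambda>y. y + h) has_derivative (\<lambda>k. k)) (at y)" for y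
      by (auto intro!: derivative_eq_intros)
    have 1: "((\<lambda>y. u (y + h) t) has_derivative (\<lambda>k. gradient (\<lambda>y. u y t) (y + h) \<bullet> k)) (at y)" if "y \<in> D" for y
      using diff_chain_at[OF tr has_derivative_gradient[OF times_cont_diff_2D(1)[OF C2[OF t]] shift[OF that]]]
      by (simp add: o_def)
    have 2: "((\<lambda>y. gradient (\<lambda>y. u y t) (y + h)) has_derivative (\<lambda>k. hessian (\<lambda>y. u y t) (y + h) *v k)) (at y)"
      if "y \<in> D" for y
      using diff_chain_at[OF tr has_derivative_gradient_hessian[OF assms(2) C2[OF t] shift[OF that]]]
      by (simp add: o_def)
    have 3: "continuous_on D (\<lambda>y. hessian (\<lambda>y. u y t) (y + h))"
      by (rule continuous_on_compose2[OF continuous_on_hessian[OF C2[OF t]]])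
        (auto intro!: continuous_intros shift)
    note * = times_cont_diff_2I[OF \<open>open D\<close> 1 2 3]
    show "times_cont_diff 2 D (\<lambda>y. u (y + h) t)" using *(1) by blast
    show "gradient (\<lambda>y. u (y + h) t) x = gradient (\<lambda>y. u y t) (x + h)" if "x \<in> D"
      using *(2) that by blast
    have "hessian (\<lambda>y. u (y + h) t) x = transpose (hessian (\<lambda>y. u y t) (x + h))" if "x \<in> D"
      using *(3) that by blast
    then show "hessian (\<lambda>y. u (y + h) t) x = hessian (\<lambda>y. u y t) (x + h)" if "x \<in> D"
      using transpose_hessian[OF assms(2) C2[OF t] shift[OF that]] that by simp
  qed
  show "times_cont_diff 2 D (\<lambda>y. u (y + h) t)" if "t \<in> {0..T}" for t using D(1)[OF that] .
  fix x t assume x: "x \<in> D" and t: "t \<in> {0..T}"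
  show "\<exists>\<tau>. ((\<lambda>s. u (x + h) s) has_real_derivative \<tau>) (at t within {0..T}) \<and>
      \<tau> \<le> a (gradient (\<lambda>y. u (y + h) t) x, -1) \<bullet> hessian (\<lambda>y. u (y + h) t) x"
    using assms(1) shift[OF x] t D(2,3)[OF t x] unfolding subsolution_def by simp
qed

lemma supersolution_add_const:
  assumes "supersolution a \<Omega> T u" "open D" "D \<subseteq> \<Omega>" "open \<Omega>"
  shows "supersolution a D T (\<lambda>x t. u x t + b)"
  unfolding supersolution_def
proof (intro conjI ballI)
  have "closure D \<times> {0..T} \<subseteq> closure \<Omega> \<times> {0..T}"
    using closure_mono[OF assms(3)] by auto
  then have "continuous_on (closure D \<times> {0..T}) (\<lambda>(x, t). u x t)"
    using assms(1) continuous_on_subset unfolding supersolution_def by blast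
  from continuous_on_add[OF this continuous_on_const[of _ b]]
  show "continuous_on (closure D \<times> {0..T}) (\<lambda>(x, t). u x t + b)"
    by (simp add: case_prod_beta')
  have C2: "times_cont_diff 2 D (\<lambda>y. u y t)" if "t \<in> {0..T}" for t
    using assms(1) that times_cont_diff_subset[OF _ assms(3)] unfolding supersolution_def by blast
  have D0: "((\<lambda>x. - b) has_derivative (\<lambda>h. 0 \<bullet> h)) (at x)"
    "((\<lambda>x. 0::real^'n) has_derivative (\<lambda>h. 0 *v h)) (at x)" for x :: "real^'n"
    by auto
  note Z = times_cont_diff_2I[OF \<open>open D\<close> D0 continuous_on_const]
  note * = times_cont_diff_2_diff[OF \<open>open D\<close> C2 Z(1)]
  show "times_cont_diff 2 D (\<lambda>y. u y t + b)" if "t \<in> {0..T}" for t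
    using *(1)[OF that] by simp
  fix x t assume x: "x \<in> D" and t: "t \<in> {0..T}"
  have g: "gradient (\<lambda>y. u y t + b) x = gradient (\<lambda>y. u y t) x"
    using *(2)[OF t x] Z(2) x by simp
  have h: "hessian (\<lambda>y. u y t + b) x = hessian (\<lambda>y. u y t) x"
    using *(3)[OF t x] Z(3) x by (simp add: transpose_def zero_vec_def vec_eq_iff)
  obtain \<tau> where \<tau>: "((\<lambda>s. u x s) has_real_derivative \<tau>) (at t within {0..T})"
      "\<tau> \<ge> a (gradient (\<lambda>y. u y t) x, -1) \<bullet> hessian (\<lambda>y. u y t) x"
    using assms(1,3) x t unfolding supersolution_def by blast
  have "((\<lambda>s. u x s + b) has_real_derivative \<tau>) (at t within {0..T})"
    using \<tau>(1) by (auto intro!: derivative_eq_intros)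
  then show "\<exists>\<tau>. ((\<lambda>s. u x s + b) has_real_derivative \<tau>) (at t within {0..T}) \<and>
      \<tau> \<ge> a (gradient (\<lambda>y. u y t + b) x, -1) \<bullet> hessian (\<lambda>y. u y t + b) x"
    using \<tau>(2) g h by auto
qed

text \<open>A one-sided difference bound in the direction of the gradient itself bounds its length.\<close>

lemma norm_gradient_le:
  fixes f :: "real^'n \<Rightarrow> real"
  assumes "open U" "times_cont_diff (Suc 0) U f" "x \<in> U" "L \<ge> 0"
    and lip: "\<And>h. x + h \<in> U \<Longrightarrow> f (x + h) - f x \<le> L * norm h"
  shows "norm (gradient f x) \<le> L"
proof (rule ccontr)
  assume "\<not> norm (gradient f x) \<le> L"
  define g where "g = gradient f x"
  have g: "norm g > L" "norm g > 0" using \<open>\<not> _\<close> \<open>L \<ge> 0\<close> by (auto simp: g_def)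
  have "((\<lambda>s. f (x + s *\<^sub>R g)) has_real_derivative g \<bullet> g) (at 0)"
    using line_derivative[OF assms(2), of x 0 g] \<open>x \<in> U\<close> by (simp add: g_def)
  then have "((\<lambda>s. f (x + s *\<^sub>R g) - L * norm g * s) has_real_derivative g \<bullet> g - L * norm g) (at 0)"
    by (auto intro!: derivative_eq_intros)
  moreover have "g \<bullet> g - L * norm g > 0"
    using g mult_strict_right_mono[OF g(1) g(2)] by (simp add: power2_norm_eq_inner[symmetric] power2_eq_square)
  ultimately obtain d where d: "d > 0"
    "\<And>s. 0 < s \<Longrightarrow> s < d \<Longrightarrow> f (x + 0 *\<^sub>R g) - L * norm g * 0 < f (x + (0 + s) *\<^sub>R g) - L * norm g * (0 + s)"
    using DERIV_pos_inc_right by blast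
  obtain e where e: "e > 0" "\<And>s. \<bar>s\<bar> < e \<Longrightarrow> x + s *\<^sub>R g \<in> U"
    using line_in_open[OF assms(1,3)] by blast
  define s where "s = min d e / 2"
  have s: "0 < s" "s < d" "s < e" using d e by (auto simp: s_def)
  then have "x + s *\<^sub>R g \<in> U" using e(2) by simp
  with lip[of "s *\<^sub>R g"] d(2)[OF s(1,2)] s(1) show False by (simp add: mult.commute mult.left_commute)
qed

text \<open>The boundary estimate, for the solution and for its negative, is propagated into the interior by comparing the
solution with its translates.\<close>

theorem gradient_estimate:
  assumes op: "anisotropic_operator a c"
    and \<Omega>: "open \<Omega>" "bounded \<Omega>" and "C0 \<ge> 0" "M \<ge> 0"
    and u0: "\<And>x y. x \<in> closure \<Omega> \<Longrightarrow> y \<in> closure \<Omega> \<Longrightarrow> \<bar>u0 x - u0 y\<bar> \<le> L0 * norm (x - y)"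
    and "L0 \<ge> 0"
    and convex: "operator_convex_boundary a \<Omega>"
      "operator_convex_boundary (\<lambda>p. a (- fst p, snd p)) \<Omega>"
  obtains L where "\<And>T f u x t. boundary_data C0 M (frontier \<Omega>) T f \<Longrightarrow>
    subsolution a \<Omega> T u \<Longrightarrow> supersolution a \<Omega> T u \<Longrightarrow> attains_data \<Omega> T f u0 u \<Longrightarrow>
    x \<in> \<Omega> \<Longrightarrow> t \<in> {0..T} \<Longrightarrow> norm (gradient (\<lambda>y. u y t) x) \<le> L"
proof -
  have boundary: "\<exists>L\<ge>0. \<forall>y\<in>frontier \<Omega>. \<forall>T f u x t.
      boundary_data C0 M (frontier \<Omega>) T f \<longrightarrow> subsolution a \<Omega> T u \<longrightarrow>
      attains_data \<Omega> T f u0 u \<longrightarrow> x \<in> closure \<Omega> \<longrightarrow> t \<in> {0..T} \<longrightarrow>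
      u x t \<le> f y t + L * norm (x - y)"
    if op: "anisotropic_operator a c" and convex: "operator_convex_boundary a \<Omega>"
      and u0: "\<And>x y. x \<in> closure \<Omega> \<Longrightarrow> y \<in> closure \<Omega> \<Longrightarrow> \<bar>u0 x - u0 y\<bar> \<le> L0 * norm (x - y)"
    for a u0
  proof -
    interpret anisotropic_operator a c by (rule op)
    have "L0-lipschitz_on (closure \<Omega>) u0"
      using u0 \<open>L0 \<ge> 0\<close> by (auto simp: lipschitz_on_def dist_norm)
    then have "continuous_on (closure \<Omega>) u0" by (rule lipschitz_on_continuous_on)
    then obtain B where B: "B \<ge> 0"
      "\<And>T f u y x t. boundary_data C0 M (frontier \<Omega>) T f \<Longrightarrow> subsolution a \<Omega> T u \<Longrightarrow>
        attains_data \<Omega> T f u0 u \<Longrightarrow> y \<in> frontier \<Omega> \<Longrightarrow> x \<in> closure \<Omega> \<Longrightarrow> t \<in> {0..T} \<Longrightarrow>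
        u x t \<le> f y t + B"
      using global_upper_bound[OF \<Omega> \<open>C0 \<ge> 0\<close> \<open>M \<ge> 0\<close>] by metis
    have comp: "compact (frontier \<Omega>)" using \<Omega> by (simp add: compact_frontier_bounded)
    let ?P = "\<lambda>L y. \<forall>T f u x t.
      boundary_data C0 M (frontier \<Omega>) T f \<longrightarrow> subsolution a \<Omega> T u \<longrightarrow>
      attains_data \<Omega> T f u0 u \<longrightarrow> x \<in> closure \<Omega> \<longrightarrow> t \<in> {0..T} \<longrightarrow>
      u x t \<le> f y t + L * norm (x - y)"
    have loc: "\<exists>r>0. \<exists>L. \<forall>y\<in>frontier \<Omega> \<inter> ball x1 r. ?P L y" if "x1 \<in> frontier \<Omega>" for x1
      by (rule local_barrier[OF \<Omega> \<open>C0 \<ge> 0\<close> \<open>M \<ge> 0\<close> _ \<open>L0 \<ge> 0\<close> B(1) convex that,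
            where ?u0.0 = u0]) (fact u0, fact B(2))
    have mono: "?P L' y" if "?P L y" "L \<le> L'" for L L' y
    proof (intro allI impI)
      fix T f u x t
      assume "boundary_data C0 M (frontier \<Omega>) T f" "subsolution a \<Omega> T u"
        "attains_data \<Omega> T f u0 u" "x \<in> closure \<Omega>" "t \<in> {0..T}"
      then have "u x t \<le> f y t + L * norm (x - y)" using that(1) by blast
      moreover have "L * norm (x - y) \<le> L' * norm (x - y)" using that(2) by (simp add: mult_right_mono)
      ultimately show "u x t \<le> f y t + L' * norm (x - y)" by simp
    qed
    show ?thesis
    proof (rule compact_uniform_constant[OF comp, of ?P])
      show "\<exists>r>0. \<exists>L. \<forall>y\<in>frontier \<Omega> \<inter> ball x1 r. ?P L y" if "x1 \<in> frontier \<Omega>" for x1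
        by (rule loc[OF that])
      show "?P L' y" if "?P L y" "L \<le> L'" for L L' y
        by (rule mono[OF that])
      fix L assume "L \<ge> 0" and L: "\<And>y. y \<in> frontier \<Omega> \<Longrightarrow> ?P L y"
      show ?thesis
        by (intro exI[of _ L] conjI ballI \<open>L \<ge> 0\<close>) (rule L)
    qed
  qed
  interpret anisotropic_operator a c by (rule op)
  obtain L1 where L1: "L1 \<ge> 0" "\<And>y T f u x t. y \<in> frontier \<Omega> \<Longrightarrow>
      boundary_data C0 M (frontier \<Omega>) T f \<Longrightarrow> subsolution a \<Omega> T u \<Longrightarrow>
      attains_data \<Omega> T f u0 u \<Longrightarrow> x \<in> closure \<Omega> \<Longrightarrow> t \<in> {0..T} \<Longrightarrow>
      u x t \<le> f y t + L1 * norm (x - y)"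
    using boundary[OF op convex(1) u0] by blast
  have "\<bar>- u0 x - (- u0 y)\<bar> \<le> L0 * norm (x - y)" if "x \<in> closure \<Omega>" "y \<in> closure \<Omega>" for x y
    using u0[OF that] by simp
  from boundary[OF uminus_operator convex(2) this]
  obtain L2 where L2: "L2 \<ge> 0" "\<And>y T f u x t. y \<in> frontier \<Omega> \<Longrightarrow>
      boundary_data C0 M (frontier \<Omega>) T f \<Longrightarrow> subsolution (\<lambda>p. a (- fst p, snd p)) \<Omega> T u \<Longrightarrow>
      attains_data \<Omega> T f (\<lambda>x. - u0 x) u \<Longrightarrow> x \<in> closure \<Omega> \<Longrightarrow> t \<in> {0..T} \<Longrightarrow>
      u x t \<le> f y t + L2 * norm (x - y)"
    by blast
  define L where "L = L0 + L1 + L2"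
  have L: "L0 \<le> L" "L1 \<le> L" "L2 \<le> L" "L \<ge> 0"
    using \<open>L0 \<ge> 0\<close> L1(1) L2(1) by (auto simp: L_def)
  show thesis
  proof (rule that[of L])
    fix T f u x t
    assume f: "boundary_data C0 M (frontier \<Omega>) T f" and sub: "subsolution a \<Omega> T u"
      and super: "supersolution a \<Omega> T u" and u: "attains_data \<Omega> T f u0 u"
      and x: "x \<in> \<Omega>" and t: "t \<in> {0..T}"
    have up: "u z s \<le> f y s + L * norm (z - y)"
      if "y \<in> frontier \<Omega>" "z \<in> closure \<Omega>" "s \<in> {0..T}" for y z s
      using L1(2)[OF that(1) f sub u that(2,3)] mult_right_mono[OF L(2), of "norm (z - y)"] by simp
    have f': "boundary_data C0 M (frontier \<Omega>) T (\<lambda>x t. - f x t)"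
      unfolding boundary_data_def
    proof (intro conjI ballI)
      show "taylor_bounded C0 (frontier \<Omega>) (\<lambda>y. - f y s)" if s: "s \<in> {0..T}" for s
        unfolding taylor_bounded_def
      proof
        fix y assume "y \<in> frontier \<Omega>"
        then obtain l where l: "norm l \<le> C0"
          "\<And>z. z \<in> frontier \<Omega> \<Longrightarrow> \<bar>f z s - f y s - l \<bullet> (z - y)\<bar> \<le> C0 * (norm (z - y))\<^sup>2"
          using f s unfolding boundary_data_def taylor_bounded_def by blast
        have "\<bar>- f z s - - f y s - - l \<bullet> (z - y)\<bar> \<le> C0 * (norm (z - y))\<^sup>2" if "z \<in> frontier \<Omega>" for z
          using l(2)[OF that] by (simp add: abs_minus_commute)
        then show "\<exists>l. norm l \<le> C0 \<and> (\<forall>z\<in>frontier \<Omega>. \<bar>- f z s - - f y s - l \<bullet> (z - y)\<bar> \<le> C0 * (norm (z - y))\<^sup>2)"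
          using l(1) by (intro exI[of _ "- l"]) auto
      qed
      show "\<bar>- f y s - - f y s'\<bar> \<le> M * \<bar>s - s'\<bar>"
        if "y \<in> frontier \<Omega>" "s \<in> {0..T}" "s' \<in> {0..T}" for y s s'
        using f that unfolding boundary_data_def by (simp add: abs_minus_commute)
    qed
    have u': "attains_data \<Omega> T (\<lambda>x t. - f x t) (\<lambda>x. - u0 x) (\<lambda>x t. - u x t)"
      using u unfolding attains_data_def by simp
    have low: "f y s \<le> u z s + L * norm (z - y)"
      if "y \<in> frontier \<Omega>" "z \<in> closure \<Omega>" "s \<in> {0..T}" for y z s
      using L2(2)[OF that(1) f' subsolution_uminus[OF \<Omega>(1) super] u' that(2,3)]
        mult_right_mono[OF L(3), of "norm (z - y)"] by simp
    have lip: "u (x + h) t - u x t \<le> L * norm h" if xh: "x + h \<in> \<Omega>" for h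
    proof -
      \<comment> \<open>where both the solution and its translate are defined; at a boundary point of \<open>D\<close> one of them attains its boundary values\<close>
      define D where "D = \<Omega> \<inter> (\<lambda>x. x + h) -` \<Omega>"
      have D: "open D" "D \<subseteq> \<Omega>"
        unfolding D_def using \<Omega> by (auto intro!: open_Int open_vimage continuous_intros)
      have "bounded D" using D(2) \<Omega>(2) bounded_subset by blast
      have cl: "z \<in> closure \<Omega>" "z + h \<in> closure \<Omega>" if "z \<in> closure D" for z
      proof -
        show "z \<in> closure \<Omega>" using closure_mono[OF D(2)] that by blast
        have "(\<lambda>x. x + h) ` closure D \<subseteq> closure ((\<lambda>x. x + h) ` D)"
          by (rule image_closure_subset) (auto intro!: continuous_intros closure_subset[THEN subsetD])
        also have "\<dots> \<subseteq> closure \<Omega>" by (intro closure_mono) (auto simp: D_def)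
        finally show "z + h \<in> closure \<Omega>" using that by blast
      qed
      have "u (x + h) t \<le> u x t + L * norm h"
      proof (rule comparison[OF D(1) \<open>bounded D\<close>
            subsolution_translate[OF sub \<Omega>(1) D(1)] supersolution_add_const[OF super D(1,2) \<Omega>(1)]])
        show "z + h \<in> \<Omega>" if "z \<in> D" for z using that by (simp add: D_def)
        show "u (z + h) 0 \<le> u z 0 + L * norm h" if "z \<in> closure D" for z
          using u cl[OF that] u0[OF cl(2,1)[OF that]] mult_right_mono[OF L(1), of "norm h"]
          unfolding attains_data_def by auto
        show "u (z + h) s \<le> u z s + L * norm h" if z: "z \<in> frontier D" and s: "s \<in> {0..T}" for z s
        proof -
          have zc: "z \<in> closure D" and "z \<notin> D"
            using z D(1) by (auto simp: frontier_def interior_open)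
          then consider "z \<in> frontier \<Omega>" | "z + h \<in> frontier \<Omega>"
            using cl[OF zc] \<Omega>(1) by (auto simp: D_def frontier_def interior_open)
          then show ?thesis
          proof cases
            case 1
            have "u z s = f z s" using u 1 s unfolding attains_data_def by blast
            then show ?thesis using up[OF 1 cl(2)[OF zc] s] by simp
          next
            case 2
            have "u (z + h) s = f (z + h) s" using u 2 s unfolding attains_data_def by blast
            then show ?thesis using low[OF 2 cl(1)[OF zc] s] by simp
          qed
        qed
        show "x \<in> closure D" by (rule closure_subset[THEN subsetD]) (use x xh in \<open>simp add: D_def\<close>)
      qed (rule t)
      then show ?thesis by simp
    qed
    have "times_cont_diff (Suc 0) \<Omega> (\<lambda>y. u y t)"
      using sub t unfolding subsolution_def by (intro times_cont_diff_2D(1)) blast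
    then show "norm (gradient (\<lambda>y. u y t) x) \<le> L"
      by (rule norm_gradient_le[OF \<Omega>(1) _ x L(4) lip])
  qed
qed

section \<open>Tangential derivatives on the boundary\<close>

lemma Ck_on_mono: "Ck_on k S f \<Longrightarrow> j \<le> k \<Longrightarrow> Ck_on j S f"
  unfolding Ck_on_def by (meson order_trans)

lemma local_defining_function_mono:
  "local_defining_function k \<Omega> x U \<rho> \<Longrightarrow> j \<le> k \<Longrightarrow> local_defining_function j \<Omega> x U \<rho>"
  unfolding local_defining_function_def using Ck_on_mono by blast

lemma local_defining_function_move:
  "local_defining_function k \<Omega> x U \<rho> \<Longrightarrow> y \<in> U \<Longrightarrow> local_defining_function k \<Omega> y U \<rho>"
  unfolding local_defining_function_def by blast

lemma ray_pos:
  fixes \<rho> :: "real^'n \<Rightarrow> real"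
  assumes "open U" "times_cont_diff (Suc 0) U \<rho>" "x \<in> U" "\<rho> x = 0" "gradient \<rho> x \<bullet> v > 0"
  obtains d where "d > 0" "\<And>s. 0 < s \<Longrightarrow> s < d \<Longrightarrow> x + s *\<^sub>R v \<in> U \<and> \<rho> (x + s *\<^sub>R v) > 0"
proof -
  have "((\<lambda>s. \<rho> (x + s *\<^sub>R v)) has_real_derivative gradient \<rho> x \<bullet> v) (at 0)"
    using line_derivative[OF assms(2), of x 0 v] \<open>x \<in> U\<close> by simp
  from DERIV_pos_inc_right[OF this assms(5)] obtain d where d: "d > 0"
    "\<And>s. 0 < s \<Longrightarrow> s < d \<Longrightarrow> \<rho> (x + s *\<^sub>R v) > 0" using \<open>\<rho> x = 0\<close> by auto
  obtain e where "e > 0" "\<And>s. \<bar>s\<bar> < e \<Longrightarrow> x + s *\<^sub>R v \<in> U"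
    using line_in_open[OF assms(1,3)] by blast
  with d show ?thesis by (intro that[of "min d e"]) auto
qed

lemma ray_neg:
  fixes \<rho> :: "real^'n \<Rightarrow> real"
  assumes "open U" "times_cont_diff (Suc 0) U \<rho>" "x \<in> U" "\<rho> x = 0" "gradient \<rho> x \<bullet> v < 0"
  obtains d where "d > 0" "\<And>s. 0 < s \<Longrightarrow> s < d \<Longrightarrow> x + s *\<^sub>R v \<in> U \<and> \<rho> (x + s *\<^sub>R v) < 0"
proof -
  have "((\<lambda>s. \<rho> (x + s *\<^sub>R v)) has_real_derivative gradient \<rho> x \<bullet> v) (at 0)"
    using line_derivative[OF assms(2), of x 0 v] \<open>x \<in> U\<close> by simp
  from DERIV_neg_dec_right[OF this assms(5)] obtain d where d: "d > 0"
    "\<And>s. 0 < s \<Longrightarrow> s < d \<Longrightarrow> \<rho> (x + s *\<^sub>R v) < 0" using \<open>\<rho> x = 0\<close> by auto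
  obtain e where "e > 0" "\<And>s. \<bar>s\<bar> < e \<Longrightarrow> x + s *\<^sub>R v \<in> U"
    using line_in_open[OF assms(1,3)] by blast
  with d show ?thesis by (intro that[of "min d e"]) auto
qed

text \<open>If the unit gradients \<open>p\<close> and \<open>q\<close> of two defining functions were different, a short step in the
direction \<open>p - q\<close> would enter \<open>\<Omega>\<close> according to the first and leave it according to the second.\<close>

lemma unit_gradient_unique:
  fixes \<Omega> :: "(real^'n) set"
  assumes 1: "local_defining_function 1 \<Omega> x U \<rho>" and 2: "local_defining_function 1 \<Omega> x V \<sigma>"
    and x: "x \<in> frontier \<Omega>"
  shows "gradient \<rho> x /\<^sub>R norm (gradient \<rho> x) = gradient \<sigma> x /\<^sub>R norm (gradient \<sigma> x)"
proof (rule ccontr)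
  note U = defining_functionD[OF 1] and V = defining_functionD[OF 2]
  define p where "p = gradient \<rho> x /\<^sub>R norm (gradient \<rho> x)"
  define q where "q = gradient \<sigma> x /\<^sub>R norm (gradient \<sigma> x)"
  have \<rho>: "norm (gradient \<rho> x) > 0" and \<sigma>: "norm (gradient \<sigma> x) > 0"
    using U(2,4) V(2,4) by auto
  have n: "norm p = 1" "norm q = 1" using \<rho> \<sigma> by (auto simp: p_def q_def)
  assume "\<not> ?thesis"
  then have "p \<noteq> q" by (simp add: p_def q_def)
  then have "(p - q) \<bullet> (p - q) > 0" by simp
  moreover have "p \<bullet> p = 1" "q \<bullet> q = 1" using n by (simp_all add: norm_eq_1)
  ultimately have pq: "p \<bullet> q < 1"
    by (simp add: inner_diff_left inner_diff_right inner_commute)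
  have "gradient \<rho> x = norm (gradient \<rho> x) *\<^sub>R p" "gradient \<sigma> x = norm (gradient \<sigma> x) *\<^sub>R q"
    using \<rho> \<sigma> by (auto simp: p_def q_def)
  then have pos: "gradient \<rho> x \<bullet> (p - q) > 0" and neg: "gradient \<sigma> x \<bullet> (p - q) < 0"
    using \<rho> \<sigma> pq \<open>p \<bullet> p = 1\<close> \<open>q \<bullet> q = 1\<close>
    by (metis inner_diff_right inner_scaleR_left zero_less_mult_iff diff_gt_0_iff_gt,
      metis inner_diff_right inner_scaleR_left mult_pos_neg diff_less_0_iff_less inner_commute)
  have "enat (Suc 0) \<le> 1" by (simp add: one_enat_def)
  note C1 = U(3)[OF this] V(3)[OF this]
  have zero: "\<rho> x = 0" "\<sigma> x = 0" using U(2,6) V(2,6) x by auto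
  obtain d where d: "d > 0" "\<And>s. 0 < s \<Longrightarrow> s < d \<Longrightarrow> x + s *\<^sub>R (p - q) \<in> U \<and> \<rho> (x + s *\<^sub>R (p - q)) > 0"
    using ray_pos[OF U(1) C1(1) U(2) zero(1) pos] by blast
  obtain e where e: "e > 0" "\<And>s. 0 < s \<Longrightarrow> s < e \<Longrightarrow> x + s *\<^sub>R (p - q) \<in> V \<and> \<sigma> (x + s *\<^sub>R (p - q)) < 0"
    using ray_neg[OF V(1) C1(2) V(2) zero(2) neg] by blast
  define s where "s = min d e / 2"
  have s: "0 < s" "s < d" "s < e" using d e by (auto simp: s_def)
  show False using d(2)[OF s(1,2)] e(2)[OF s(1,3)] U(5) V(5) by fastforce
qed

lemma inward_normal_eq:
  fixes \<Omega> :: "(real^'n) set"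
  assumes "local_defining_function k \<Omega> x U \<rho>" "1 \<le> k" "y \<in> frontier \<Omega> \<inter> U"
  shows "inward_normal \<Omega> y = gradient \<rho> y /\<^sub>R norm (gradient \<rho> y)"
proof -
  have def: "local_defining_function 1 \<Omega> y U \<rho>"
    using local_defining_function_mono[OF assms(1,2)] local_defining_function_move assms(3) by blast
  show ?thesis
    unfolding inward_normal_def
  proof (rule the_equality)
    show "\<exists>U \<rho>'. local_defining_function 1 \<Omega> y U \<rho>' \<and>
        gradient \<rho> y /\<^sub>R norm (gradient \<rho> y) = gradient \<rho>' y /\<^sub>R norm (gradient \<rho>' y)"
      using def by blast
    show "\<nu> = gradient \<rho> y /\<^sub>R norm (gradient \<rho> y)"
      if "\<exists>U \<rho>'. local_defining_function 1 \<Omega> y U \<rho>' \<and> \<nu> = gradient \<rho>' y /\<^sub>R norm (gradient \<rho>' y)" for \<nu>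
      using that unit_gradient_unique[OF _ def] assms(3) by blast
  qed
qed

text \<open>A derivative within the boundary is determined on tangent vectors, because every tangent
direction is a limit of directions from \<open>y\<close> to other boundary points. By the intermediate value theorem there is
a boundary point on the segment between \<open>y + s (v - e \<nu>)\<close> and \<open>y + s (v + e \<nu>)\<close> for small \<open>s\<close>.\<close>

lemma within_derivative_tangent_unique:
  fixes \<Omega> :: "(real^'n) set" and g :: "real^'n \<Rightarrow> 'b::real_normed_vector"
  assumes def: "local_defining_function k \<Omega> x0 U \<rho>" "1 \<le> k" and y: "y \<in> frontier \<Omega> \<inter> U"
    and D1: "(g has_derivative D1) (at y within frontier \<Omega>)"
    and D2: "(g has_derivative D2) (at y within frontier \<Omega>)"
    and v: "gradient \<rho> y \<bullet> v = 0"
  shows "D1 v = D2 v"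
proof -
  note U = defining_functionD[OF def(1)]
  have C1: "times_cont_diff (Suc 0) U \<rho>"
    using U(3)[of "Suc 0"] def(2) by (simp add: one_enat_def del: times_cont_diff.simps)
  define D where "D = (\<lambda>h. D1 h - D2 h)"
  have "((\<lambda>x. 0) has_derivative D) (at y within frontier \<Omega>)"
    unfolding D_def using has_derivative_diff[OF D1 D2] by simp
  then have bl: "bounded_linear D" and small: "\<And>e. e > 0 \<Longrightarrow> \<exists>d>0. \<forall>z\<in>frontier \<Omega>. norm (z - y) < d \<longrightarrow>
      norm (D (z - y)) \<le> e * norm (z - y)"
    unfolding has_derivative_within_alt by auto
  interpret D: bounded_linear D by (rule bl)
  obtain B where B: "B > 0" "\<And>h. norm (D h) \<le> norm h * B" using D.pos_bounded by blast
  define \<nu> where "\<nu> = gradient \<rho> y"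
  have \<nu>: "norm \<nu> > 0" using U(4) y by (simp add: \<nu>_def)
  have "norm (D v) \<le> e * (norm v + norm \<nu> + norm \<nu> * B)" if e: "0 < e" "e \<le> 1" for e
  proof -
    obtain d where d: "d > 0" "\<And>z. z \<in> frontier \<Omega> \<Longrightarrow> norm (z - y) < d \<Longrightarrow> norm (D (z - y)) \<le> e * norm (z - y)"
      using small[OF e(1)] by blast
    have zero: "\<rho> y = 0" using U(6) y by blast
    have pos: "gradient \<rho> y \<bullet> (v + e *\<^sub>R \<nu>) > 0" and neg: "gradient \<rho> y \<bullet> (v - e *\<^sub>R \<nu>) < 0"
      using v e \<nu> by (auto simp: \<nu>_def inner_add_right inner_diff_right)
    obtain d1 where d1: "d1 > 0" "\<And>s. 0 < s \<Longrightarrow> s < d1 \<Longrightarrow> y + s *\<^sub>R (v + e *\<^sub>R \<nu>) \<in> U \<and> \<rho> (y + s *\<^sub>R (v + e *\<^sub>R \<nu>)) > 0"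
      using ray_pos[OF U(1) C1 _ zero pos] y by blast
    obtain d2 where d2: "d2 > 0" "\<And>s. 0 < s \<Longrightarrow> s < d2 \<Longrightarrow> y + s *\<^sub>R (v - e *\<^sub>R \<nu>) \<in> U \<and> \<rho> (y + s *\<^sub>R (v - e *\<^sub>R \<nu>)) < 0"
      using ray_neg[OF U(1) C1 _ zero neg] y by blast
    obtain d3 where d3: "d3 > 0" "ball y d3 \<subseteq> U" using U(1) y open_contains_ball by blast
    define b where "b = norm v + norm \<nu>"
    have "b > 0" using \<nu> by (simp add: b_def add_nonneg_pos)
    define m where "m = min (min d1 d2) (min (d3 / b) (d / b))"
    have m: "m \<le> d1" "m \<le> d2" "m \<le> d3 / b" "m \<le> d / b" by (auto simp: m_def)
    have "0 < d3 / b" "0 < d / b" using d3(1) d(1) \<open>b > 0\<close> by auto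
    then have "m > 0" using d1(1) d2(1) by (simp add: m_def)
    define s where "s = m / 2"
    have s: "0 < s" "s < d1" "s < d2" "s < d3 / b" "s < d / b"
      using m \<open>m > 0\<close> unfolding s_def by linarith+
    have nrm: "norm (v + t *\<^sub>R \<nu>) \<le> norm v + e * norm \<nu>" if "\<bar>t\<bar> \<le> e" for t
      using norm_triangle_ineq[of v "t *\<^sub>R \<nu>"] mult_right_mono[OF that, of "norm \<nu>"] by simp
    have nrm': "norm (v + t *\<^sub>R \<nu>) \<le> b" if "\<bar>t\<bar> \<le> e" for t
      using nrm[OF that] mult_right_mono[OF e(2), of "norm \<nu>"] by (simp add: b_def)
    have inU: "y + s *\<^sub>R (v + t *\<^sub>R \<nu>) \<in> U" if "\<bar>t\<bar> \<le> e" for t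
    proof -
      have "norm (s *\<^sub>R (v + t *\<^sub>R \<nu>)) \<le> s * b" using nrm'[OF that] s(1) by simp
      also have "\<dots> < d3" using s(4) \<open>b > 0\<close> by (simp add: field_simps)
      finally show ?thesis using d3(2) by (auto simp: dist_norm subset_iff)
    qed
    have "continuous_on {-e..e} (\<lambda>t. \<rho> (y + s *\<^sub>R (v + t *\<^sub>R \<nu>)))"
      by (rule continuous_on_compose2[OF times_cont_diff_continuous[OF C1]])
        (use inU in \<open>auto intro!: continuous_intros\<close>)
    moreover have "\<rho> (y + s *\<^sub>R (v + (-e) *\<^sub>R \<nu>)) \<le> 0" using d2(2)[OF s(1,3)] by simp
    moreover have "0 \<le> \<rho> (y + s *\<^sub>R (v + e *\<^sub>R \<nu>))" using d1(2)[OF s(1,2)] by simp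
    ultimately obtain t where t: "-e \<le> t" "t \<le> e" "\<rho> (y + s *\<^sub>R (v + t *\<^sub>R \<nu>)) = 0"
      using IVT'[of "\<lambda>t. \<rho> (y + s *\<^sub>R (v + t *\<^sub>R \<nu>))" "-e" 0 e] e by auto
    then have te: "\<bar>t\<bar> \<le> e" by simp
    have fr: "y + s *\<^sub>R (v + t *\<^sub>R \<nu>) \<in> frontier \<Omega>" using U(6)[OF inU[OF te]] t(3) by blast
    have "norm (s *\<^sub>R (v + t *\<^sub>R \<nu>)) \<le> s * b" using nrm'[OF te] s(1) by simp
    also have "\<dots> < d" using s(5) \<open>b > 0\<close> by (simp add: field_simps)
    finally have "norm (D (s *\<^sub>R (v + t *\<^sub>R \<nu>))) \<le> e * norm (s *\<^sub>R (v + t *\<^sub>R \<nu>))"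
      using d(2)[OF fr] by simp
    then have "s * norm (D (v + t *\<^sub>R \<nu>)) \<le> s * (e * norm (v + t *\<^sub>R \<nu>))"
      using s(1) by (simp add: D.scaleR mult.left_commute)
    then have 1: "norm (D (v + t *\<^sub>R \<nu>)) \<le> e * norm (v + t *\<^sub>R \<nu>)" using s(1) by simp
    have 2: "e * norm (v + t *\<^sub>R \<nu>) \<le> e * b" using nrm'[OF te] e by (intro mult_left_mono) auto
    have "norm (D (t *\<^sub>R \<nu>)) \<le> norm (t *\<^sub>R \<nu>) * B" by (rule B(2))
    also have "\<dots> \<le> e * norm \<nu> * B" using te B(1) by (simp add: mult_right_mono)
    finally have 3: "norm (D (t *\<^sub>R \<nu>)) \<le> e * norm \<nu> * B" .
    have "D v = D (v + t *\<^sub>R \<nu>) - D (t *\<^sub>R \<nu>)" by (simp add: D.add)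
    then have "norm (D v) \<le> norm (D (v + t *\<^sub>R \<nu>)) + norm (D (t *\<^sub>R \<nu>))" by (metis norm_triangle_ineq4)
    with 1 2 3 show ?thesis by (simp add: b_def algebra_simps)
  qed
  note bound = this
  define K where "K = norm v + norm \<nu> + norm \<nu> * B"
  have K: "K > 0" using \<nu> B(1) by (simp add: K_def add_nonneg_pos add_pos_nonneg)
  have "D v = 0"
  proof (rule ccontr)
    assume "D v \<noteq> 0"
    define e where "e = min 1 (norm (D v) / (2 * K))"
    have e: "0 < e" "e \<le> 1" using \<open>D v \<noteq> 0\<close> K by (auto simp: e_def)
    have "norm (D v) \<le> e * K" using bound[OF e] by (simp add: K_def)
    also have "\<dots> \<le> norm (D v) / (2 * K) * K" using K by (intro mult_right_mono) (auto simp: e_def)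
    also have "\<dots> = norm (D v) / 2" using K by simp
    finally show False using \<open>D v \<noteq> 0\<close> by simp
  qed
  then show ?thesis by (simp add: D_def)
qed

text \<open>Consequently, derivatives along the boundary can be computed from any derivative of any extension.\<close>

lemma deriv_along_eq:
  fixes \<Omega> :: "(real^'n) set"
  assumes "local_defining_function k \<Omega> x0 U \<rho>" "1 \<le> k" "y \<in> frontier \<Omega> \<inter> U"
    and D: "(g has_derivative D) (at y within frontier \<Omega>)" and "gradient \<rho> y \<bullet> V y = 0"
  shows "deriv_along (frontier \<Omega>) V g y = D (V y)"
proof -
  have "(g has_derivative frechet_derivative g (at y within frontier \<Omega>)) (at y within frontier \<Omega>)"
    using D frechet_derivative_works differentiable_def by blast
  then show ?thesis
    unfolding deriv_along_def by (rule within_derivative_tangent_unique[OF assms(1-3) _ D assms(5)])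
qed

text \<open>The \<open>CARD('n) - 1\<close> frame vectors and \<open>\<nu>\<close> are as many as the dimension, hence a basis.\<close>

lemma orthonormal_frame_expand:
  fixes E :: "nat \<Rightarrow> real^'n" and \<nu> :: "real^'n"
  assumes \<nu>: "norm \<nu> = 1"
    and E: "\<And>i. i \<in> {1..CARD('n) - 1} \<Longrightarrow> E i \<bullet> \<nu> = 0"
      "\<And>i j. i \<in> {1..CARD('n) - 1} \<Longrightarrow> j \<in> {1..CARD('n) - 1} \<Longrightarrow> E i \<bullet> E j = (if i = j then 1 else 0)"
  shows "w = (w \<bullet> \<nu>) *\<^sub>R \<nu> + (\<Sum>i=1..CARD('n) - 1. (w \<bullet> E i) *\<^sub>R E i)"
proof -
  let ?I = "{1..CARD('n) - 1}"
  define B where "B = insert \<nu> (E ` ?I)"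
  have nE: "norm (E i) = 1" if "i \<in> ?I" for i using E(2)[OF that that] by (simp add: norm_eq_1)
  have inj: "inj_on E ?I"
  proof (rule inj_onI)
    fix i j assume ij: "i \<in> ?I" "j \<in> ?I" "E i = E j"
    then have "E i \<bullet> E j = 1" using E(2)[OF ij(1,1)] by simp
    then show "i = j" using E(2)[OF ij(1,2)] by (auto split: if_splits)
  qed
  have \<nu>nE: "\<nu> \<notin> E ` ?I"
  proof
    assume "\<nu> \<in> E ` ?I"
    then obtain i where "i \<in> ?I" "\<nu> = E i" by auto
    then have "\<nu> \<bullet> \<nu> = 0" using E(1)[of i] by simp
    then show False using \<nu> by simp
  qed
  have orth: "pairwise orthogonal B"
    unfolding B_def pairwise_insert pairwise_image
    using E by (auto simp: pairwise_def orthogonal_def inner_commute)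
  have n1: "norm b = 1" if "b \<in> B" for b using that nE \<nu> by (auto simp: B_def)
  have "0 \<notin> B" using n1 by force
  then have indep: "independent B" using orth pairwise_orthogonal_independent by blast
  have "card B = CARD('n)"
    using \<nu>nE inj by (simp add: B_def card_image)
  then have "span B = UNIV"
    using card_ge_dim_independent[of B UNIV] indep by (auto simp: dim_UNIV)
  then have "(\<Sum>b\<in>B. (w \<bullet> b) *\<^sub>R b) = w"
    by (intro orthonormal_basis_expand orth n1) (auto simp: B_def)
  moreover have "(\<Sum>b\<in>B. (w \<bullet> b) *\<^sub>R b) = (w \<bullet> \<nu>) *\<^sub>R \<nu> + (\<Sum>i\<in>?I. (w \<bullet> E i) *\<^sub>R E i)"
    using \<nu>nE inj by (simp add: B_def sum.reindex)
  ultimately show ?thesis by simp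
qed

text \<open>The trace \<open>Q \<bullet> mat 1\<close> can be computed in any orthonormal basis, here adapted to the normal.\<close>

lemma inner_mat_1_orthonormal:
  fixes E :: "nat \<Rightarrow> real^'n" and \<nu> :: "real^'n" and Q :: "real^'n^'n"
  assumes frame: "norm \<nu> = 1"
    "\<And>i. i \<in> {1..CARD('n) - 1} \<Longrightarrow> E i \<bullet> \<nu> = 0"
    "\<And>i j. i \<in> {1..CARD('n) - 1} \<Longrightarrow> j \<in> {1..CARD('n) - 1} \<Longrightarrow> E i \<bullet> E j = (if i = j then 1 else 0)"
  shows "Q \<bullet> mat 1 = \<nu> \<bullet> (Q *v \<nu>) + (\<Sum>i=1..CARD('n) - 1. E i \<bullet> (Q *v E i))"
proof -
  have parseval: "(\<Sum>k\<in>UNIV. (axis k 1 \<bullet> u) * (axis k 1 \<bullet> v)) = u \<bullet> v" for u v :: "real^'n"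
    by (simp add: inner_axis') (simp add: inner_vec_def)
  have expand: "axis k 1 \<bullet> (Q *v axis k 1) = (axis k 1 \<bullet> \<nu>) * (axis k 1 \<bullet> (Q *v \<nu>))
      + (\<Sum>i=1..CARD('n) - 1. (axis k 1 \<bullet> E i) * (axis k 1 \<bullet> (Q *v E i)))" for k
  proof -
    have "Q *v axis k 1 = Q *v ((axis k 1 \<bullet> \<nu>) *\<^sub>R \<nu> + (\<Sum>i=1..CARD('n) - 1. (axis k 1 \<bullet> E i) *\<^sub>R E i))"
      using orthonormal_frame_expand[OF frame, of "axis k 1"] by (rule arg_cong[where f = "\<lambda>w. Q *v w"])
    also have "\<dots> = (axis k 1 \<bullet> \<nu>) *\<^sub>R (Q *v \<nu>) + (\<Sum>i=1..CARD('n) - 1. (axis k 1 \<bullet> E i) *\<^sub>R (Q *v E i))"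
      by (simp add: matrix_vector_right_distrib matrix_vector_mult_scaleR
          linear_sum[OF matrix_vector_mul_linear])
    finally show ?thesis by (simp add: inner_add_right inner_sum_right)
  qed
  have "Q \<bullet> mat 1 = (\<Sum>k\<in>UNIV. axis k 1 \<bullet> (Q *v axis k 1))"
  proof -
    have "(Q $ k) \<bullet> (mat 1 :: real^'n^'n) $ k = Q $ k $ k" for k
    proof -
      have "(mat 1 :: real^'n^'n) $ k = axis k 1" by (simp add: mat_def axis_def vec_eq_iff)
      then show ?thesis by (simp add: inner_axis)
    qed
    moreover have "axis k 1 \<bullet> (Q *v axis k 1) = Q $ k $ k" for k
      by (simp add: inner_axis' matrix_vector_mul_component inner_axis)
    ultimately show ?thesis by (simp add: inner_vec_def[of Q])
  qed
  also have "\<dots> = \<nu> \<bullet> (Q *v \<nu>) + (\<Sum>i=1..CARD('n) - 1. E i \<bullet> (Q *v E i))"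
    unfolding expand sum.distrib
    by (subst sum.swap) (simp add: parseval)
  finally show ?thesis .
qed

text \<open>Translates a principal frame into statements on the gradient and the Hessian of a defining function. As
\<open>N = \<nabla>\<rho> / \<bar>\<nabla>\<rho>\<bar>\<close>, the tangential part of \<open>D\<^sub>i N = - \<kappa>\<^sub>i E\<^sub>i\<close> says that the Hessian of \<open>\<rho>\<close> is diagonal
on the tangent space, with entries \<open>- \<bar>\<nabla>\<rho>\<bar> \<kappa>\<^sub>i\<close>.\<close>

lemma principal_frameD:
  fixes \<Omega> :: "(real^'n) set" and E :: "nat \<Rightarrow> real^'n \<Rightarrow> real^'n"
  assumes pf: "principal_frame \<Omega> x E \<kappa>" and def: "local_defining_function k \<Omega> x U \<rho>" "2 \<le> k"
    and x: "x \<in> frontier \<Omega>"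
  defines "I \<equiv> {1..CARD('n) - 1}"
  shows "\<exists>W. open W \<and> x \<in> W \<and> W \<subseteq> U \<and> (\<forall>y\<in>frontier \<Omega> \<inter> W. \<forall>i\<in>I. gradient \<rho> y \<bullet> E i y = 0)"
    and "i \<in> I \<Longrightarrow> gradient \<rho> x \<bullet> E i x = 0"
    and "i \<in> I \<Longrightarrow> j \<in> I \<Longrightarrow> E i x \<bullet> E j x = (if i = j then 1 else 0)"
    and "i \<in> I \<Longrightarrow> j \<in> I \<Longrightarrow> E j x \<bullet> (hessian \<rho> x *v E i x) = (if i = j then - (norm (gradient \<rho> x) * \<kappa> i) else 0)"
    and "i \<in> I \<Longrightarrow> E i differentiable (at x within frontier \<Omega>)"
    and "i \<in> I \<Longrightarrow> j \<in> I \<Longrightarrow> deriv_along (frontier \<Omega>) (E j) (E i) x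
      = (if i = j then \<kappa> i *\<^sub>R (gradient \<rho> x /\<^sub>R norm (gradient \<rho> x)) else 0)"
proof -
  note U = defining_functionD[OF def(1)]
  have k: "enat 2 \<le> k" "1 \<le> k" using def(2) enat_2_le_2 order_trans[of 1 2 k]
    by (auto simp: one_le_numeral)
  have C2: "times_cont_diff 2 U \<rho>" by (rule U(3)[OF k(1)])
  have N: "inward_normal \<Omega> y = gradient \<rho> y /\<^sub>R norm (gradient \<rho> y)" if "y \<in> frontier \<Omega>" "y \<in> U" for y
    using inward_normal_eq[OF def(1) k(2)] that by blast
  have "\<exists>V. open V \<and> x \<in> V \<and> (\<forall>y\<in>frontier \<Omega> \<inter> V. \<forall>i\<in>I. E i y \<bullet> inward_normal \<Omega> y = 0 \<and>
      (\<forall>j\<in>I. E i y \<bullet> E j y = (if i = j then 1 else 0)))"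
    using pf unfolding principal_frame_def Let_def I_def by (rule conjunct1)
  then obtain V where V12: "open V" "x \<in> V" and V': "\<forall>y\<in>frontier \<Omega> \<inter> V. \<forall>i\<in>I. E i y \<bullet> inward_normal \<Omega> y = 0 \<and>
      (\<forall>j\<in>I. E i y \<bullet> E j y = (if i = j then 1 else 0))" by (elim exE conjE)
  have V3: "E i y \<bullet> inward_normal \<Omega> y = 0" if "y \<in> frontier \<Omega> \<inter> V" "i \<in> I" for y i
    using V'[rule_format, OF that] by (rule conjunct1)
  have V4: "E i y \<bullet> E j y = (if i = j then 1 else 0)" if "y \<in> frontier \<Omega> \<inter> V" "i \<in> I" "j \<in> I" for y i j
    using V'[rule_format, OF that(1,2), THEN conjunct2] that(3) by (rule bspec)
  note V = V12 V3 V4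
  have tang: "gradient \<rho> y \<bullet> E i y = 0" if "y \<in> frontier \<Omega>" "y \<in> V" "y \<in> U" "i \<in> I" for y i
    using V(3)[of y i] N[of y] that U(4)[of y] by (simp add: inner_commute)
  show "\<exists>W. open W \<and> x \<in> W \<and> W \<subseteq> U \<and> (\<forall>y\<in>frontier \<Omega> \<inter> W. \<forall>i\<in>I. gradient \<rho> y \<bullet> E i y = 0)"
    using V(1,2) U(1,2) tang by (intro exI[of _ "V \<inter> U"]) auto
  have tx: "gradient \<rho> x \<bullet> E i x = 0" if "i \<in> I" for i
    using tang[OF x V(2) U(2) that] .
  then show "i \<in> I \<Longrightarrow> gradient \<rho> x \<bullet> E i x = 0" .
  have orth: "E i x \<bullet> E j x = (if i = j then 1 else 0)" if "i \<in> I" "j \<in> I" for i j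
    using V(4)[of x i j] x V(2) that by blast
  then show "i \<in> I \<Longrightarrow> j \<in> I \<Longrightarrow> E i x \<bullet> E j x = (if i = j then 1 else 0)" .
  show "i \<in> I \<Longrightarrow> E i differentiable (at x within frontier \<Omega>)"
    using pf unfolding principal_frame_def Let_def I_def by blast
  show "i \<in> I \<Longrightarrow> j \<in> I \<Longrightarrow> deriv_along (frontier \<Omega>) (E j) (E i) x
      = (if i = j then \<kappa> i *\<^sub>R (gradient \<rho> x /\<^sub>R norm (gradient \<rho> x)) else 0)"
    using pf unfolding principal_frame_def Let_def I_def N[OF x U(2), symmetric] by blast
  define q where "q = (\<lambda>y. inverse (norm (gradient \<rho> y)))"
  have gne: "gradient \<rho> x \<noteq> 0" using U(2,4) by blast
  have dg: "(gradient \<rho> has_derivative (\<lambda>h. hessian \<rho> x *v h)) (at x)"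
    by (rule has_derivative_gradient_hessian[OF U(1) C2 U(2)])
  have "q differentiable (at x)"
    unfolding q_def
  proof (intro differentiable_inverse)
    have "norm differentiable (at (gradient \<rho> x))"
      using gne by (rule differentiable_norm_at)
    moreover have "gradient \<rho> differentiable (at x)"
      using dg by (rule differentiableI)
    ultimately show "(\<lambda>y. norm (gradient \<rho> y)) differentiable (at x)"
      using differentiable_chain_at[of "gradient \<rho>" x norm] by (simp add: o_def)
  qed (use gne in simp)
  then obtain q' where q': "(q has_derivative q') (at x)" unfolding differentiable_def by blast
  have dq: "((\<lambda>y. q y *\<^sub>R gradient \<rho> y) has_derivative
      (\<lambda>h. q x *\<^sub>R (hessian \<rho> x *v h) + q' h *\<^sub>R gradient \<rho> x)) (at x within frontier \<Omega>)"
    using has_derivative_scaleR[OF q' dg] by (rule has_derivative_at_withinI)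
  obtain d where d: "d > 0" "ball x d \<subseteq> U" using U(1,2) open_contains_ball by blast
  have dN: "(inward_normal \<Omega> has_derivative
      (\<lambda>h. q x *\<^sub>R (hessian \<rho> x *v h) + q' h *\<^sub>R gradient \<rho> x)) (at x within frontier \<Omega>)"
  proof (rule has_derivative_transform_within[OF dq d(1) x])
    show "q y *\<^sub>R gradient \<rho> y = inward_normal \<Omega> y" if "y \<in> frontier \<Omega>" "dist y x < d" for y
      using N[OF that(1)] d(2) that(2) by (auto simp: q_def dist_commute subset_iff)
  qed
  show "E j x \<bullet> (hessian \<rho> x *v E i x) = (if i = j then - (norm (gradient \<rho> x) * \<kappa> i) else 0)"
    if i: "i \<in> I" and j: "j \<in> I" for i j
  proof -
    have "deriv_along (frontier \<Omega>) (E i) (inward_normal \<Omega>) x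
        = q x *\<^sub>R (hessian \<rho> x *v E i x) + q' (E i x) *\<^sub>R gradient \<rho> x"
      using x U(2) tx[OF i] by (intro deriv_along_eq[OF def(1) k(2) _ dN]) auto
    moreover have "deriv_along (frontier \<Omega>) (E i) (inward_normal \<Omega>) x = - (\<kappa> i *\<^sub>R E i x)"
      using pf i unfolding principal_frame_def Let_def I_def by blast
    ultimately have "E j x \<bullet> (q x *\<^sub>R (hessian \<rho> x *v E i x) + q' (E i x) *\<^sub>R gradient \<rho> x)
        = E j x \<bullet> (- (\<kappa> i *\<^sub>R E i x))" by simp
    then have "q x * (E j x \<bullet> (hessian \<rho> x *v E i x)) = - (\<kappa> i * (E j x \<bullet> E i x))"
      using tx[OF j] by (simp add: inner_add_right inner_commute)
    then have "E j x \<bullet> (hessian \<rho> x *v E i x) = - (norm (gradient \<rho> x) * \<kappa> i * (E j x \<bullet> E i x))"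
      using gne by (simp add: q_def field_simps)
    then show ?thesis using orth[OF j i] by auto
  qed
qed

definition tangential_data :: "(real^'n) set \<Rightarrow> (real^'n \<Rightarrow> nat \<Rightarrow> real) \<Rightarrow> real \<Rightarrow> (real^'n \<Rightarrow> real) \<Rightarrow> bool"
  where "tangential_data \<Omega> \<kappa> M \<phi> \<longleftrightarrow>
    (\<exists>V g. open V \<and> frontier \<Omega> \<subseteq> V \<and> times_cont_diff 2 V g \<and> (\<forall>x\<in>frontier \<Omega>. g x = \<phi> x)) \<and>
    (\<forall>x\<in>frontier \<Omega>. \<exists>E. principal_frame \<Omega> x E (\<kappa> x) \<and>
      (\<forall>i\<in>{1..CARD('n) - 1}. \<bar>deriv_along (frontier \<Omega>) (E i) \<phi> x\<bar> \<le> M \<and>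
        (\<forall>j\<in>{1..CARD('n) - 1}.
          \<bar>deriv_along (frontier \<Omega>) (E i) (deriv_along (frontier \<Omega>) (E j) \<phi>) x\<bar> \<le> M)))"

text \<open>The iterated tangential derivative differs from the Hessian of an extension \<open>g\<close> by the
derivative of \<open>g\<close> in the direction \<open>D\<^sub>i E\<^sub>j\<close>, which the frame relations give as \<open>\<kappa>\<^sub>i N\<close> for \<open>i = j\<close> and as zero
otherwise.\<close>

lemma tangential_derivatives:
  fixes \<Omega> :: "(real^'n) set"
  assumes def: "local_defining_function k \<Omega> x U \<rho>" "2 \<le> k" and x: "x \<in> frontier \<Omega>"
    and g: "open V" "frontier \<Omega> \<subseteq> V" "times_cont_diff 2 V g" "\<forall>y\<in>frontier \<Omega>. g y = \<phi> y"
    and pf: "principal_frame \<Omega> x E \<kappa>"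
    and i: "i \<in> {1..CARD('n) - 1}" and j: "j \<in> {1..CARD('n) - 1}"
  shows "deriv_along (frontier \<Omega>) (E i) \<phi> x = gradient g x \<bullet> E i x"
    and "deriv_along (frontier \<Omega>) (E i) (deriv_along (frontier \<Omega>) (E j) \<phi>) x
      = E j x \<bullet> (hessian g x *v E i x)
        + (if i = j then \<kappa> i * (gradient g x \<bullet> (gradient \<rho> x /\<^sub>R norm (gradient \<rho> x))) else 0)"
proof -
  note U = defining_functionD[OF def(1)] and P = principal_frameD[OF pf def x]
  have k: "1 \<le> k" using def(2) order_trans[of 1 2 k] by (auto simp: one_le_numeral)
  obtain W where W: "open W" "x \<in> W" "W \<subseteq> U"
    "\<And>y i. y \<in> frontier \<Omega> \<inter> W \<Longrightarrow> i \<in> {1..CARD('n) - 1} \<Longrightarrow> gradient \<rho> y \<bullet> E i y = 0"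
    using P(1) by blast
  have first: "deriv_along (frontier \<Omega>) (E i) \<phi> y = gradient g y \<bullet> E i y"
    if y: "y \<in> frontier \<Omega>" "y \<in> W" and i: "i \<in> {1..CARD('n) - 1}" for y i
  proof -
    have "(g has_derivative (\<lambda>h. gradient g y \<bullet> h)) (at y within frontier \<Omega>)"
      by (rule has_derivative_at_withinI[OF has_derivative_gradient[OF times_cont_diff_2D(1)[OF g(3)]
            subsetD[OF g(2) y(1)]]])
    then have "(\<phi> has_derivative (\<lambda>h. gradient g y \<bullet> h)) (at y within frontier \<Omega>)"
      by (rule has_derivative_transform[OF y(1), rotated]) (simp add: g(4))
    then show ?thesis
      using y W(3,4) i by (intro deriv_along_eq[OF def(1) k]) auto
  qed
  show "deriv_along (frontier \<Omega>) (E i) \<phi> x = gradient g x \<bullet> E i x" by (rule first[OF x W(2) i])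
  define E' where "E' = frechet_derivative (E j) (at x within frontier \<Omega>)"
  have "(E j has_derivative E') (at x within frontier \<Omega>)"
    using P(5)[OF j] unfolding E'_def frechet_derivative_works .
  moreover have "(gradient g has_derivative (\<lambda>h. hessian g x *v h)) (at x within frontier \<Omega>)"
    by (rule has_derivative_at_withinI[OF has_derivative_gradient_hessian[OF g(1,3) subsetD[OF g(2) x]]])
  ultimately have D: "((\<lambda>y. gradient g y \<bullet> E j y) has_derivative
      (\<lambda>h. gradient g x \<bullet> E' h + (hessian g x *v h) \<bullet> E j x)) (at x within frontier \<Omega>)"
    by (intro has_derivative_inner)
  obtain d where d: "d > 0" "ball x d \<subseteq> W" using W(1,2) open_contains_ball by blast
  have "(deriv_along (frontier \<Omega>) (E j) \<phi> has_derivative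
      (\<lambda>h. gradient g x \<bullet> E' h + (hessian g x *v h) \<bullet> E j x)) (at x within frontier \<Omega>)"
  proof (rule has_derivative_transform_within[OF D d(1) x])
    show "gradient g y \<bullet> E j y = deriv_along (frontier \<Omega>) (E j) \<phi> y" if "y \<in> frontier \<Omega>" "dist y x < d" for y
      using first[OF that(1) _ j] d(2) that(2) by (auto simp: dist_commute subset_iff)
  qed
  then have "deriv_along (frontier \<Omega>) (E i) (deriv_along (frontier \<Omega>) (E j) \<phi>) x
      = gradient g x \<bullet> E' (E i x) + (hessian g x *v E i x) \<bullet> E j x"
    using x U(2) P(2)[OF i] by (intro deriv_along_eq[OF def(1) k]) auto
  moreover have "E' (E i x) = deriv_along (frontier \<Omega>) (E i) (E j) x"
    by (simp add: E'_def deriv_along_def)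
  ultimately show "deriv_along (frontier \<Omega>) (E i) (deriv_along (frontier \<Omega>) (E j) \<phi>) x
      = E j x \<bullet> (hessian g x *v E i x)
        + (if i = j then \<kappa> i * (gradient g x \<bullet> (gradient \<rho> x /\<^sub>R norm (gradient \<rho> x))) else 0)"
    using P(6)[OF j i] by (auto simp: inner_commute)
qed

text \<open>Bounds that do not refer to the frame, for use along a boundary curve with velocity \<open>a\<close> and
acceleration \<open>b\<close>: the second premise is what two derivatives of \<open>\<rho> = 0\<close> along the curve give. It fixes the normal
component of \<open>b\<close> as \<open>\<Sum> \<kappa>\<^sub>i a\<^sub>i\<^sup>2\<close>, which is just the term that completes the Hessian of the extension to the iterated tangential
derivatives. Hence the uncontrolled normal derivative of the extension drops out.\<close>

lemma tangential_data_bounds: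
  fixes \<Omega> :: "(real^'n) set"
  assumes def: "local_defining_function k \<Omega> x U \<rho>" "2 \<le> k" and x: "x \<in> frontier \<Omega>"
    and g: "open V" "frontier \<Omega> \<subseteq> V" "times_cont_diff 2 V g" "\<forall>y\<in>frontier \<Omega>. g y = \<phi> y"
    and \<phi>: "tangential_data \<Omega> \<kappa> M \<phi>" and "M \<ge> 0"
  defines "n \<equiv> real CARD('n)"
  shows "\<exists>l. norm l \<le> n * M \<and> (\<forall>a. gradient \<rho> x \<bullet> a = 0 \<longrightarrow> gradient g x \<bullet> a = l \<bullet> a)"
    and "gradient \<rho> x \<bullet> a = 0 \<Longrightarrow> gradient \<rho> x \<bullet> b + a \<bullet> (hessian \<rho> x *v a) = 0 \<Longrightarrow>
      \<bar>a \<bullet> (hessian g x *v a) + gradient g x \<bullet> b\<bar> \<le> n\<^sup>2 * M * (norm a)\<^sup>2 + n * M * norm b"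
proof -
  let ?I = "{1..CARD('n) - 1}"
  obtain E where pf: "principal_frame \<Omega> x E (\<kappa> x)"
    and E1: "\<And>i. i \<in> ?I \<Longrightarrow> \<bar>deriv_along (frontier \<Omega>) (E i) \<phi> x\<bar> \<le> M"
    and E2: "\<And>i j. i \<in> ?I \<Longrightarrow> j \<in> ?I \<Longrightarrow> \<bar>deriv_along (frontier \<Omega>) (E i) (deriv_along (frontier \<Omega>) (E j) \<phi>) x\<bar> \<le> M"
    using \<phi> x unfolding tangential_data_def by blast
  note U = defining_functionD[OF def(1)] and P = principal_frameD[OF pf def x]
  note T = tangential_derivatives[OF def x g pf]
  define e where "e = (\<lambda>i. E i x)"
  define r where "r = norm (gradient \<rho> x)"
  have "r > 0" using U(2,4) by (auto simp: r_def)
  define \<nu> where "\<nu> = gradient \<rho> x /\<^sub>R r"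
  have \<nu>: "norm \<nu> = 1" "gradient \<rho> x = r *\<^sub>R \<nu>" using \<open>r > 0\<close> by (auto simp: \<nu>_def r_def)
  have e\<nu>: "e i \<bullet> \<nu> = 0" if "i \<in> ?I" for i
    using P(2)[OF that] by (simp add: e_def \<nu>_def inner_commute)
  have ee: "e i \<bullet> e j = (if i = j then 1 else 0)" if "i \<in> ?I" "j \<in> ?I" for i j
    using P(3)[OF that] by (simp add: e_def)
  note expand = orthonormal_frame_expand[OF \<nu>(1) e\<nu> ee]
  have ne: "norm (e i) = 1" if "i \<in> ?I" for i using ee[OF that that] by (simp add: norm_eq_1)
  have coord: "\<bar>w \<bullet> e i\<bar> \<le> norm w" if "i \<in> ?I" for w i
    using Cauchy_Schwarz_ineq2[of w "e i"] ne[OF that] by simp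
  have g1: "\<bar>gradient g x \<bullet> e i\<bar> \<le> M" if "i \<in> ?I" for i
    using T(1)[OF that that] E1[OF that] by (simp add: e_def)
  have cardI: "real (card ?I) \<le> n" by (simp add: n_def)
  show "\<exists>l. norm l \<le> n * M \<and> (\<forall>a. gradient \<rho> x \<bullet> a = 0 \<longrightarrow> gradient g x \<bullet> a = l \<bullet> a)"
  proof (intro exI conjI allI impI)
    let ?l = "\<Sum>i\<in>?I. (gradient g x \<bullet> e i) *\<^sub>R e i"
    have "norm ?l \<le> (\<Sum>i\<in>?I. M)"
      using g1 ne by (intro sum_norm_le) simp
    also have "\<dots> \<le> n * M" using cardI \<open>M \<ge> 0\<close> by (simp add: mult_right_mono)
    finally show "norm ?l \<le> n * M" .
    fix a assume "gradient \<rho> x \<bullet> a = 0"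
    then have "a \<bullet> \<nu> = 0" by (simp add: \<nu>_def inner_commute)
    then have "gradient g x \<bullet> a = gradient g x \<bullet> (\<Sum>i\<in>?I. (a \<bullet> e i) *\<^sub>R e i)"
      using expand[of a] by simp
    then show "gradient g x \<bullet> a = ?l \<bullet> a"
      by (simp add: inner_sum_right inner_sum_left inner_commute mult.commute)
  qed
  assume a: "gradient \<rho> x \<bullet> a = 0" and b: "gradient \<rho> x \<bullet> b + a \<bullet> (hessian \<rho> x *v a) = 0"
  define \<alpha> where "\<alpha> = (\<lambda>i. a \<bullet> e i)"
  have a\<nu>: "a \<bullet> \<nu> = 0" using a by (simp add: \<nu>_def inner_commute)
  then have aexp: "a = (\<Sum>i\<in>?I. \<alpha> i *\<^sub>R e i)" using expand[of a] by (simp add: \<alpha>_def)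
  have quad: "a \<bullet> (Q *v a) = (\<Sum>i\<in>?I. \<Sum>j\<in>?I. \<alpha> i * \<alpha> j * (e j \<bullet> (Q *v e i)))" for Q :: "real^'n^'n"
  proof -
    have "a \<bullet> (Q *v a) = (\<Sum>i\<in>?I. \<alpha> i *\<^sub>R e i) \<bullet> (Q *v (\<Sum>i\<in>?I. \<alpha> i *\<^sub>R e i))"
      using aexp by simp
    also have "\<dots> = (\<Sum>i\<in>?I. \<Sum>j\<in>?I. \<alpha> i * \<alpha> j * (e j \<bullet> (Q *v e i)))"
      by (simp add: linear_sum[OF matrix_vector_mul_linear] matrix_vector_mult_scaleR
          inner_sum_left inner_sum_right sum_distrib_left algebra_simps)
    finally show ?thesis .
  qed
  have "a \<bullet> (hessian \<rho> x *v a) = (\<Sum>i\<in>?I. \<Sum>j\<in>?I. if i = j then - (r * \<kappa> x i) * (\<alpha> i)\<^sup>2 else 0)"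
    unfolding quad by (intro sum.cong refl) (auto simp: e_def P(4) r_def power2_eq_square)
  also have "\<dots> = - r * (\<Sum>i\<in>?I. \<kappa> x i * (\<alpha> i)\<^sup>2)"
    by (simp add: sum_distrib_left sum_negf mult.assoc)
  finally have "r * (\<nu> \<bullet> b) = r * (\<Sum>i\<in>?I. \<kappa> x i * (\<alpha> i)\<^sup>2)"
    using b \<nu>(2) by simp
  then have b\<nu>: "b \<bullet> \<nu> = (\<Sum>i\<in>?I. \<kappa> x i * (\<alpha> i)\<^sup>2)" using \<open>r > 0\<close> by (simp add: inner_commute)
  have gb: "gradient g x \<bullet> b = (b \<bullet> \<nu>) * (gradient g x \<bullet> \<nu>) + (\<Sum>i\<in>?I. (b \<bullet> e i) * (gradient g x \<bullet> e i))"
  proof -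
    have "gradient g x \<bullet> b = gradient g x \<bullet> ((b \<bullet> \<nu>) *\<^sub>R \<nu> + (\<Sum>i\<in>?I. (b \<bullet> e i) *\<^sub>R e i))"
      using expand[of b] by (rule arg_cong[where f = "\<lambda>w. gradient g x \<bullet> w"])
    then show ?thesis by (simp only: inner_add_right inner_scaleR_right inner_sum_right)
  qed
  \<comment> \<open>the iterated tangential derivatives\<close>
  define Z where "Z = (\<lambda>i j. e j \<bullet> (hessian g x *v e i) + (if i = j then \<kappa> x i * (gradient g x \<bullet> \<nu>) else 0))"
  have Z: "\<bar>Z i j\<bar> \<le> M" if "i \<in> ?I" "j \<in> ?I" for i j
    using E2[OF that] unfolding T(2)[OF that] Z_def e_def \<nu>_def r_def .
  have "a \<bullet> (hessian g x *v a) + gradient g x \<bullet> b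
      = (\<Sum>i\<in>?I. \<Sum>j\<in>?I. \<alpha> i * \<alpha> j * Z i j) + (\<Sum>i\<in>?I. (b \<bullet> e i) * (gradient g x \<bullet> e i))"
  proof -
    have "(\<Sum>i\<in>?I. \<Sum>j\<in>?I. \<alpha> i * \<alpha> j * Z i j) = a \<bullet> (hessian g x *v a)
        + (\<Sum>i\<in>?I. \<Sum>j\<in>?I. if i = j then \<kappa> x i * (\<alpha> i)\<^sup>2 * (gradient g x \<bullet> \<nu>) else 0)"
      unfolding quad sum.distrib[symmetric]
      by (intro sum.cong refl) (auto simp: Z_def algebra_simps power2_eq_square)
    also have "(\<Sum>i\<in>?I. \<Sum>j\<in>?I. if i = j then \<kappa> x i * (\<alpha> i)\<^sup>2 * (gradient g x \<bullet> \<nu>) else 0)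
        = (b \<bullet> \<nu>) * (gradient g x \<bullet> \<nu>)"
      by (simp add: b\<nu> sum_distrib_right)
    finally show ?thesis using gb by simp
  qed
  moreover have "\<bar>\<Sum>i\<in>?I. \<Sum>j\<in>?I. \<alpha> i * \<alpha> j * Z i j\<bar> \<le> n\<^sup>2 * M * (norm a)\<^sup>2"
  proof -
    have "\<bar>\<alpha> i * \<alpha> j * Z i j\<bar> \<le> norm a * norm a * M" if "i \<in> ?I" "j \<in> ?I" for i j
      unfolding abs_mult using coord[OF that(1), of a] coord[OF that(2), of a] Z[OF that]
      by (intro mult_mono) (auto simp: \<alpha>_def)
    then have "\<bar>\<Sum>i\<in>?I. \<Sum>j\<in>?I. \<alpha> i * \<alpha> j * Z i j\<bar> \<le> (\<Sum>i\<in>?I. \<Sum>j\<in>?I. norm a * norm a * M)"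
      by (intro order_trans[OF sum_abs] sum_mono) blast
    also have "\<dots> = (real (card ?I))\<^sup>2 * (M * (norm a)\<^sup>2)"
      by (simp add: power2_eq_square)
    also have "\<dots> \<le> n\<^sup>2 * (M * (norm a)\<^sup>2)"
      using cardI \<open>M \<ge> 0\<close> by (intro mult_right_mono power_mono) auto
    finally show ?thesis by (simp add: mult.assoc)
  qed
  moreover have "\<bar>\<Sum>i\<in>?I. (b \<bullet> e i) * (gradient g x \<bullet> e i)\<bar> \<le> n * M * norm b"
  proof -
    have "\<bar>(b \<bullet> e i) * (gradient g x \<bullet> e i)\<bar> \<le> norm b * M" if "i \<in> ?I" for i
      unfolding abs_mult using coord[OF that, of b] g1[OF that] by (intro mult_mono) auto
    then have "\<bar>\<Sum>i\<in>?I. (b \<bullet> e i) * (gradient g x \<bullet> e i)\<bar> \<le> (\<Sum>i\<in>?I. norm b * M)"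
      by (intro order_trans[OF sum_abs] sum_mono)
    also have "\<dots> = real (card ?I) * (M * norm b)" by simp
    also have "\<dots> \<le> n * (M * norm b)" using cardI \<open>M \<ge> 0\<close> by (intro mult_right_mono) auto
    finally show ?thesis by (simp add: mult.assoc)
  qed
  ultimately show "\<bar>a \<bullet> (hessian g x *v a) + gradient g x \<bullet> b\<bar> \<le> n\<^sup>2 * M * (norm a)\<^sup>2 + n * M * norm b"
    by linarith
qed

text \<open>A matrix that annihilates the normal only sees the tangential part of the Hessian of \<open>\<rho>\<close>, which is diagonal in
the principal frame.\<close>

lemma inner_hessian_principal_frame:
  fixes \<Omega> :: "(real^'n) set" and A :: "real^'n^'n"
  assumes pf: "principal_frame \<Omega> x E \<kappa>" and def: "local_defining_function k \<Omega> x U \<rho>" "2 \<le> k"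
    and x: "x \<in> frontier \<Omega>" and A: "transpose A = A" "A *v gradient \<rho> x = 0"
  shows "A \<bullet> hessian \<rho> x = - norm (gradient \<rho> x) * (\<Sum>i=1..CARD('n) - 1. \<kappa> i * (E i x \<bullet> (A *v E i x)))"
proof -
  let ?I = "{1..CARD('n) - 1}" and ?H = "hessian \<rho> x"
  note U = defining_functionD[OF def(1)] and P = principal_frameD[OF pf def x]
  define e where "e = (\<lambda>i. E i x)"
  define r where "r = norm (gradient \<rho> x)"
  have "r > 0" using U(2,4) by (auto simp: r_def)
  define \<nu> where "\<nu> = gradient \<rho> x /\<^sub>R r"
  have \<nu>: "norm \<nu> = 1" "gradient \<rho> x = r *\<^sub>R \<nu>" using \<open>r > 0\<close> by (auto simp: \<nu>_def r_def)
  have e\<nu>: "e i \<bullet> \<nu> = 0" if "i \<in> ?I" for i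
    using P(2)[OF that] by (simp add: e_def \<nu>_def inner_commute)
  have ee: "e i \<bullet> e j = (if i = j then 1 else 0)" if "i \<in> ?I" "j \<in> ?I" for i j
    using P(3)[OF that] by (simp add: e_def)
  have A\<nu>: "A *v \<nu> = 0" using A(2) by (simp add: \<nu>_def matrix_vector_mult_scaleR)
  have "enat 2 \<le> k" using def(2) enat_2_le_2 by (rule order_trans[rotated])
  then have symH: "transpose ?H = ?H" by (intro transpose_hessian[OF U(1) U(3) U(2)])
  have He: "?H *v e i = ((?H *v e i) \<bullet> \<nu>) *\<^sub>R \<nu> + (- r * \<kappa> i) *\<^sub>R e i" if i: "i \<in> ?I" for i
  proof -
    have "?H *v e i = ((?H *v e i) \<bullet> \<nu>) *\<^sub>R \<nu> + (\<Sum>j\<in>?I. ((?H *v e i) \<bullet> e j) *\<^sub>R e j)"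
      by (rule orthonormal_frame_expand[OF \<nu>(1) e\<nu> ee])
    also have "(\<Sum>j\<in>?I. ((?H *v e i) \<bullet> e j) *\<^sub>R e j) = (\<Sum>j\<in>?I. if j = i then (- r * \<kappa> i) *\<^sub>R e i else 0)"
    proof (rule sum.cong[OF refl])
      fix j assume j: "j \<in> ?I"
      have "(?H *v e i) \<bullet> e j = (if i = j then - (r * \<kappa> i) else 0)"
        using P(4)[OF i j] unfolding e_def r_def by (simp only: inner_commute)
      then show "((?H *v e i) \<bullet> e j) *\<^sub>R e j = (if j = i then (- r * \<kappa> i) *\<^sub>R e i else 0)"
        by simp
    qed
    also have "\<dots> = (- r * \<kappa> i) *\<^sub>R e i" using i by (simp only: sum.delta finite_atLeastAtMost if_True)
    finally show ?thesis .
  qed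
  have "A \<bullet> ?H = (A ** ?H) \<bullet> mat 1"
  proof -
    have "?H $ j $ i = ?H $ i $ j" for i j
      using arg_cong[OF symH, of "\<lambda>B. B $ i $ j"] by (simp add: transpose_def)
    then have "A \<bullet> ?H = (\<Sum>i\<in>UNIV. (A ** ?H) $ i $ i)"
      by (simp add: inner_vec_def matrix_matrix_mult_def)
    also have "\<dots> = (A ** ?H) \<bullet> mat 1"
    proof -
      have "((A ** ?H) $ i) \<bullet> (mat 1 :: real^'n^'n) $ i = (A ** ?H) $ i $ i" for i
      proof -
        have "(mat 1 :: real^'n^'n) $ i = axis i 1" by (simp add: mat_def axis_def vec_eq_iff)
        then show ?thesis by (simp add: inner_axis)
      qed
      then show ?thesis by (simp add: inner_vec_def[of "A ** ?H"])
    qed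
    finally show ?thesis .
  qed
  also have "\<dots> = \<nu> \<bullet> (A *v (?H *v \<nu>)) + (\<Sum>i\<in>?I. e i \<bullet> (A *v (?H *v e i)))"
    using inner_mat_1_orthonormal[OF \<nu>(1) e\<nu> ee, of "A ** ?H"]
    by (simp add: matrix_vector_mul_assoc)
  also have "\<nu> \<bullet> (A *v (?H *v \<nu>)) = 0"
    using quadratic_form_commute[OF A(1), of \<nu> "?H *v \<nu>"] A\<nu> by simp
  also have "(\<Sum>i\<in>?I. e i \<bullet> (A *v (?H *v e i))) = (\<Sum>i\<in>?I. (- r * \<kappa> i) * (e i \<bullet> (A *v e i)))"
  proof (rule sum.cong[OF refl])
    fix i assume i: "i \<in> ?I"
    have "A *v (?H *v e i) = A *v (((?H *v e i) \<bullet> \<nu>) *\<^sub>R \<nu> + (- r * \<kappa> i) *\<^sub>R e i)"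
      using He[OF i] by (rule arg_cong[where f = "\<lambda>w. A *v w"])
    also have "\<dots> = (- r * \<kappa> i) *\<^sub>R (A *v e i)"
      by (simp only: matrix_vector_right_distrib matrix_vector_mult_scaleR A\<nu>) simp
    finally show "e i \<bullet> (A *v (?H *v e i)) = (- r * \<kappa> i) * (e i \<bullet> (A *v e i))" by simp
  qed
  finally show ?thesis by (simp add: e_def r_def sum_distrib_left mult.assoc sum_negf)
qed

section \<open>Second-order expansion of the boundary data\<close>

lemma norm_matrix_vector_mult_le:
  fixes A :: "real^'n^'m"
  shows "norm (A *v x) \<le> norm A * norm x"
proof -
  have "norm (A *v x) \<le> L2_set (\<lambda>i. norm (A $ i) * norm x) UNIV"
    unfolding norm_vec_def[of "A *v x"]
    by (intro L2_set_mono) (auto simp: matrix_vector_mul_component Cauchy_Schwarz_ineq2)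
  also have "\<dots> = norm A * norm x"
    by (simp add: L2_set_left_distrib[symmetric] norm_vec_def[of A])
  finally show ?thesis .
qed

lemma second_order_remainder:
  fixes m :: "real \<Rightarrow> real"
  assumes 1: "\<And>s. 0 \<le> s \<Longrightarrow> s \<le> 1 \<Longrightarrow> (m has_real_derivative m1 s) (at s)"
    and 2: "\<And>s. 0 \<le> s \<Longrightarrow> s \<le> 1 \<Longrightarrow> (m1 has_real_derivative m2 s) (at s)"
    and K: "\<And>s. 0 \<le> s \<Longrightarrow> s \<le> 1 \<Longrightarrow> \<bar>m2 s\<bar> \<le> K"
  shows "\<bar>m 1 - m 0 - m1 0\<bar> \<le> K"
proof -
  obtain s where s: "0 < s" "s < 1" "m 1 - m 0 = (1 - 0) * m1 s"
    using MVT2[of 0 1 m m1] 1 by auto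
  obtain r where r: "0 < r" "r < s" "m1 s - m1 0 = (s - 0) * m2 r"
    using MVT2[of 0 s m1 m2] 2 s by auto
  have "\<bar>s * m2 r\<bar> \<le> 1 * K"
    unfolding abs_mult using s r K[of r] by (intro mult_mono) auto
  then show ?thesis using s r by simp
qed

text \<open>The map \<open>\<Phi>\<close> replaces the \<open>\<nu>\<close>-coordinate of a point by the value of \<open>\<rho>\<close>, so it flattens the boundary. The
last conclusion describes the derivative \<open>D\<close> of its inverse by the equation \<open>D\<Phi> (D k) = k\<close>.\<close>

lemma graph_coordinates:
  fixes \<rho> :: "real^'n \<Rightarrow> real"
  assumes U: "open U" "x1 \<in> U" "times_cont_diff (Suc 0) U \<rho>"
    and \<nu>: "norm \<nu> = 1" "gradient \<rho> x1 \<bullet> \<nu> \<noteq> 0" and "\<delta> > 0"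
  defines "\<Phi> \<equiv> \<lambda>x. x + (\<rho> x - x \<bullet> \<nu>) *\<^sub>R \<nu>"
  obtains r W \<Psi> where "r > 0" "open W" "convex W"
    "\<And>x. x \<in> ball x1 r \<Longrightarrow> \<Phi> x \<in> W \<and> \<Psi> (\<Phi> x) = x"
    "\<And>p. p \<in> W \<Longrightarrow> \<Psi> p \<in> ball x1 \<delta> \<and> \<Phi> (\<Psi> p) = p"
    "\<And>p. p \<in> W \<Longrightarrow> \<exists>D. (\<Psi> has_derivative D) (at p) \<and>
      (\<forall>k. D k + (gradient \<rho> (\<Psi> p) \<bullet> D k - D k \<bullet> \<nu>) *\<^sub>R \<nu> = k)"
proof -
  define f' where "f' = (\<lambda>x. id_blinfun + (blinfun_scaleR_left \<nu> o\<^sub>L blinfun_inner_left (gradient \<rho> x - \<nu>)))"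
  have f'_apply: "blinfun_apply (f' x) h = h + (gradient \<rho> x \<bullet> h - h \<bullet> \<nu>) *\<^sub>R \<nu>" for x h
    by (simp add: f'_def blinfun.add_left inner_diff_right inner_commute)
  have der: "(\<Phi> has_derivative blinfun_apply (f' x)) (at x)" if "x \<in> U" for x
    unfolding \<Phi>_def using has_derivative_gradient[OF U(3) that]
    by (auto intro!: derivative_eq_intros simp: f'_apply fun_eq_iff)
  have cont: "continuous_on U f'"
    unfolding f'_def
    by (intro continuous_intros bounded_linear.continuous_on[OF bounded_linear_blinfun_inner_left]
        bounded_bilinear.continuous_on[OF bounded_bilinear_blinfun_compose] continuous_on_gradient[OF U(3)])
  define g1 where "g1 = gradient \<rho> x1"
  define invf where "invf = id_blinfun + (blinfun_scaleR_left \<nu> o\<^sub>L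
    blinfun_inner_left ((1 / (g1 \<bullet> \<nu>)) *\<^sub>R (\<nu> - g1)))"
  have \<nu>\<nu>: "\<nu> \<bullet> \<nu> = 1" using \<nu>(1) by (simp add: norm_eq_1)
  have "invf o\<^sub>L f' x1 = id_blinfun"
  proof (rule blinfun_eqI)
    fix h
    define b where "b = g1 \<bullet> h - h \<bullet> \<nu>"
    have "blinfun_apply invf k = k + ((k \<bullet> \<nu> - g1 \<bullet> k) / (g1 \<bullet> \<nu>)) *\<^sub>R \<nu>" for k
      by (simp add: invf_def blinfun.add_left inner_diff_right inner_commute)
    then have "blinfun_apply (invf o\<^sub>L f' x1) h
        = (h + b *\<^sub>R \<nu>) + (((h + b *\<^sub>R \<nu>) \<bullet> \<nu> - g1 \<bullet> (h + b *\<^sub>R \<nu>)) / (g1 \<bullet> \<nu>)) *\<^sub>R \<nu>"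
      by (simp add: f'_apply b_def g1_def)
    also have "((h + b *\<^sub>R \<nu>) \<bullet> \<nu> - g1 \<bullet> (h + b *\<^sub>R \<nu>)) / (g1 \<bullet> \<nu>) = - b"
    proof -
      have "(h + b *\<^sub>R \<nu>) \<bullet> \<nu> - g1 \<bullet> (h + b *\<^sub>R \<nu>) = h \<bullet> \<nu> - g1 \<bullet> h + b - b * (g1 \<bullet> \<nu>)"
        using \<nu>\<nu> by (simp add: inner_add_left inner_add_right)
      also have "\<dots> = - b * (g1 \<bullet> \<nu>)" by (simp add: b_def algebra_simps)
      finally show ?thesis using \<nu>(2) by (simp add: g1_def)
    qed
    finally show "blinfun_apply (invf o\<^sub>L f' x1) h = blinfun_apply id_blinfun h" by simp
  qed
  then obtain U' V \<Psi> \<Psi>' where inv: "open U'" "U' \<subseteq> U" "x1 \<in> U'" "open V" "\<Phi> x1 \<in> V" "homeomorphism U' V \<Phi> \<Psi>"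
    "\<And>y. y \<in> V \<Longrightarrow> (\<Psi> has_derivative \<Psi>' y) (at y)"
    "\<And>y. y \<in> V \<Longrightarrow> \<Psi>' y = inv (blinfun_apply (f' (\<Psi> y)))"
    "\<And>y. y \<in> V \<Longrightarrow> bij (blinfun_apply (f' (\<Psi> y)))"
    using inverse_function_theorem[OF U(1) der cont U(2)] by blast
  have "open (V \<inter> \<Psi> -` ball x1 \<delta>)"
    using inv(4,6) by (intro continuous_open_preimage) (auto simp: homeomorphism_def)
  moreover have "\<Phi> x1 \<in> V \<inter> \<Psi> -` ball x1 \<delta>"
    using inv(3,5,6) \<open>\<delta> > 0\<close> by (simp add: homeomorphism_def)
  ultimately obtain e where e: "e > 0" "ball (\<Phi> x1) e \<subseteq> V \<inter> \<Psi> -` ball x1 \<delta>"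
    using open_contains_ball by blast
  have "open (U' \<inter> \<Phi> -` ball (\<Phi> x1) e)"
    using inv(1,6) by (intro continuous_open_preimage) (auto simp: homeomorphism_def)
  moreover have "x1 \<in> U' \<inter> \<Phi> -` ball (\<Phi> x1) e" using inv(3) e(1) by simp
  ultimately obtain r where r: "r > 0" "ball x1 r \<subseteq> U' \<inter> \<Phi> -` ball (\<Phi> x1) e"
    using open_contains_ball by blast
  show thesis
  proof (rule that[OF r(1), of "ball (\<Phi> x1) e" \<Psi>])
    show "\<Phi> x \<in> ball (\<Phi> x1) e \<and> \<Psi> (\<Phi> x) = x" if "x \<in> ball x1 r" for x
      using r(2) that inv(6) by (auto simp: homeomorphism_def)
    show "\<Psi> p \<in> ball x1 \<delta> \<and> \<Phi> (\<Psi> p) = p" if "p \<in> ball (\<Phi> x1) e" for p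
      using e(2) that inv(6) by (auto simp: homeomorphism_def)
    show "\<exists>D. (\<Psi> has_derivative D) (at p) \<and>
        (\<forall>k. D k + (gradient \<rho> (\<Psi> p) \<bullet> D k - D k \<bullet> \<nu>) *\<^sub>R \<nu> = k)" if "p \<in> ball (\<Phi> x1) e" for p
    proof (intro exI conjI allI)
      have p: "p \<in> V" using e(2) that by blast
      show "(\<Psi> has_derivative \<Psi>' p) (at p)" by (rule inv(7)[OF p])
      fix k
      have "blinfun_apply (f' (\<Psi> p)) (\<Psi>' p k) = k"
        unfolding inv(8)[OF p] using inv(9)[OF p] by (simp add: bij_is_surj surj_f_inv_f)
      then show "\<Psi>' p k + (gradient \<rho> (\<Psi> p) \<bullet> \<Psi>' p k - \<Psi>' p k \<bullet> \<nu>) *\<^sub>R \<nu> = k"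
        by (simp add: f'_apply)
    qed
  qed auto
qed

text \<open>Two boundary points near \<open>x1\<close> are joined by a boundary curve \<open>z\<close>, the preimage of a segment in the flattening
coordinates. Its acceleration is \<open>O(\<bar>k\<bar>\<^sup>2)\<close>, where \<open>k\<close> is the direction of the segment, and so is the second derivative of \<open>\<phi>\<close> along it by
\<open>tangential_data_bounds\<close>. All constants come from \<open>\<rho>\<close> and \<open>M\<close>, none from an extension of \<open>\<phi>\<close>.\<close>

lemma local_taylor:
  fixes \<Omega> :: "(real^'n) set"
  assumes def: "local_defining_function k \<Omega> x1 U \<rho>" "2 \<le> k" and x1: "x1 \<in> frontier \<Omega>" and "M \<ge> 0"
  shows "\<exists>r>0. \<exists>C. \<forall>\<phi>. tangential_data \<Omega> \<kappa> M \<phi> \<longrightarrow> (\<forall>x0\<in>frontier \<Omega> \<inter> ball x1 r. \<exists>l. norm l \<le> C \<and>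
    (\<forall>y\<in>frontier \<Omega> \<inter> ball x1 r. \<bar>\<phi> y - \<phi> x0 - l \<bullet> (y - x0)\<bar> \<le> C * (norm (y - x0))\<^sup>2))"
proof -
  note U = defining_functionD[OF def(1)]
  have "enat 2 \<le> k" using def(2) enat_2_le_2 by (rule order_trans[rotated])
  then have C2: "times_cont_diff 2 U \<rho>" by (rule U(3))
  note C1 = times_cont_diff_2D(1)[OF C2]
  let ?g = "gradient \<rho>" and ?H = "hessian \<rho>"
  have cont_H: "continuous_on U ?H" by (rule continuous_on_hessian[OF C2])
  have g1: "?g x1 \<noteq> 0" using U(2,4) by blast
  define \<nu> where "\<nu> = ?g x1 /\<^sub>R norm (?g x1)"
  obtain c \<delta>1 where "c > 0" and \<delta>1: "\<delta>1 > 0" "ball x1 \<delta>1 \<subseteq> U" and \<nu>: "norm \<nu> = 1" and g1\<nu>: "?g x1 \<bullet> \<nu> = 2 * c"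
    and near: "\<forall>x\<in>ball x1 \<delta>1. norm (?g x) \<le> 3 * c \<and> c \<le> ?g x \<bullet> \<nu>"
    using normal_neighbourhood[OF U(1,2) C1 g1, folded \<nu>_def] by blast
  have \<nu>\<nu>: "\<nu> \<bullet> \<nu> = 1" using \<nu> by (simp add: norm_eq_1)
  have isH: "isCont ?H x1" using cont_H U(1,2) continuous_on_eq_continuous_at by blast
  obtain \<delta>3 where \<delta>3: "\<delta>3 > 0" "\<And>x. dist x x1 < \<delta>3 \<Longrightarrow> dist (?H x) (?H x1) < 1"
    using isH zero_less_one unfolding continuous_at_eps_delta by blast
  define \<delta> where "\<delta> = min \<delta>1 \<delta>3"
  have \<delta>: "\<delta> > 0" "\<delta> \<le> \<delta>1" "\<delta> \<le> \<delta>3"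
    using \<delta>1(1) \<delta>3(1) by (auto simp: \<delta>_def)
  have ballU: "x \<in> U" if "x \<in> ball x1 \<delta>" for x using that \<delta>1(2) \<delta>(2) by (auto simp: subset_iff)
  define G where "G = 3 * c"
  define h0 where "h0 = norm (?H x1) + 1"
  have g_near: "norm (?g x) \<le> G" "c \<le> ?g x \<bullet> \<nu>" if "x \<in> ball x1 \<delta>" for x
    using near that \<delta>(2) by (auto simp: G_def)
  have H_near: "norm (?H x) \<le> h0" if "x \<in> ball x1 \<delta>" for x
  proof -
    have "norm (?H x - ?H x1) < 1"
      using \<delta>3(2)[of x] that \<delta>(3) by (simp add: dist_norm norm_minus_commute)
    then show ?thesis using norm_triangle_sub[of "?H x" "?H x1"] by (simp add: h0_def)
  qed
  have "h0 \<ge> 0" by (simp add: h0_def)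
  have "?g x1 \<bullet> \<nu> \<noteq> 0" using g1\<nu> \<open>c > 0\<close> by simp
  from graph_coordinates[OF U(1,2) C1 \<nu> this \<delta>(1)]
  obtain r W \<Psi> where W: "r > 0" "open W" "convex W"
    "\<And>x. x \<in> ball x1 r \<Longrightarrow> x + (\<rho> x - x \<bullet> \<nu>) *\<^sub>R \<nu> \<in> W \<and> \<Psi> (x + (\<rho> x - x \<bullet> \<nu>) *\<^sub>R \<nu>) = x"
    "\<And>p. p \<in> W \<Longrightarrow> \<Psi> p \<in> ball x1 \<delta> \<and> \<Psi> p + (\<rho> (\<Psi> p) - \<Psi> p \<bullet> \<nu>) *\<^sub>R \<nu> = p"
    "\<And>p. p \<in> W \<Longrightarrow> \<exists>D. (\<Psi> has_derivative D) (at p) \<and>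
      (\<forall>k. D k + (?g (\<Psi> p) \<bullet> D k - D k \<bullet> \<nu>) *\<^sub>R \<nu> = k)"
    by metis
  define n where "n = real CARD('n)"
  define b0 where "b0 = 16 * h0 / c"
  have "b0 \<ge> 0" using \<open>h0 \<ge> 0\<close> \<open>c > 0\<close> by (simp add: b0_def)
  define C3 where "C3 = n\<^sup>2 * M * 16 + n * M * b0"
  have C3: "C3 \<ge> 0" using \<open>M \<ge> 0\<close> \<open>b0 \<ge> 0\<close> by (simp add: C3_def n_def)
  define C where "C = C3 + n * M * b0 + n * M"
  have "\<exists>l. norm l \<le> C \<and> (\<forall>y\<in>frontier \<Omega> \<inter> ball x1 r. \<bar>\<phi> y - \<phi> x0 - l \<bullet> (y - x0)\<bar> \<le> C * (norm (y - x0))\<^sup>2)"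
    if \<phi>: "tangential_data \<Omega> \<kappa> M \<phi>" and x0: "x0 \<in> frontier \<Omega> \<inter> ball x1 r" for \<phi> x0
  proof -
    obtain V g where g: "open V" "frontier \<Omega> \<subseteq> V" "times_cont_diff 2 V g" "\<forall>y\<in>frontier \<Omega>. g y = \<phi> y"
      using \<phi> unfolding tangential_data_def by blast
    have x0U: "x0 \<in> U" using W(4,5) x0 ballU by (metis IntE)
    note bounds = tangential_data_bounds[OF local_defining_function_move[OF def(1)] def(2) _ g \<phi> \<open>M \<ge> 0\<close>, folded n_def]
    obtain l where l: "norm l \<le> n * M" "\<And>a. ?g x0 \<bullet> a = 0 \<Longrightarrow> gradient g x0 \<bullet> a = l \<bullet> a"
      using bounds(1)[OF x0U] x0 by blast
    have "\<bar>\<phi> y - \<phi> x0 - l \<bullet> (y - x0)\<bar> \<le> C * (norm (y - x0))\<^sup>2" if y: "y \<in> frontier \<Omega> \<inter> ball x1 r" for y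
    proof -
      have yU: "y \<in> U" using W(4,5) y ballU by (metis IntE)
      define p where "p = x0 + (\<rho> x0 - x0 \<bullet> \<nu>) *\<^sub>R \<nu>"
      define q where "q = y + (\<rho> y - y \<bullet> \<nu>) *\<^sub>R \<nu>"
      define k where "k = q - p"
      have pq: "p \<in> W" "q \<in> W" "\<Psi> p = x0" "\<Psi> q = y"
        using W(4) x0 y by (auto simp: p_def q_def)
      have \<rho>0: "\<rho> x0 = 0" "\<rho> y = 0" using U(6) x0U yU x0 y by auto
      have p\<nu>: "p \<bullet> \<nu> = 0" and q\<nu>: "q \<bullet> \<nu> = 0"
        using \<rho>0 \<nu>\<nu> by (auto simp: p_def q_def inner_add_left inner_diff_left)
      then have k\<nu>: "k \<bullet> \<nu> = 0" by (simp add: k_def inner_diff_left)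
      have yx: "y - x0 = k + ((y - x0) \<bullet> \<nu>) *\<^sub>R \<nu>"
        using \<rho>0 by (simp add: k_def p_def q_def inner_diff_left algebra_simps)
      have nk: "norm k \<le> norm (y - x0)"
      proof -
        have "k \<bullet> k = k \<bullet> (y - x0)"
          using arg_cong[OF yx, of "\<lambda>w. k \<bullet> w"] k\<nu> by (simp add: inner_add_right)
        also have "\<dots> \<le> norm k * norm (y - x0)" by (rule norm_cauchy_schwarz)
        finally have "norm k * norm k \<le> norm k * norm (y - x0)"
          by (simp add: power2_norm_eq_inner[symmetric] power2_eq_square)
        then show ?thesis by (cases "norm k = 0") auto
      qed
      \<comment> \<open>it stays in the boundary because \<open>p\<close> and \<open>k\<close> have no \<open>\<nu>\<close>-component, which is the value of \<open>\<rho>\<close>\<close>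
      define z where "z = (\<lambda>s. \<Psi> (p + s *\<^sub>R k))"
      have inW: "p + s *\<^sub>R k \<in> W" if "0 \<le> s" "s \<le> 1" for s
        using convexD_alt[OF W(3) pq(1,2) that] by (simp add: k_def algebra_simps)
      have zb: "z s \<in> ball x1 \<delta>" if "0 \<le> s" "s \<le> 1" for s
        using W(5)[OF inW[OF that]] by (simp add: z_def)
      have zU: "z s \<in> U" if "0 \<le> s" "s \<le> 1" for s using zb[OF that] ballU by blast
      have zfr: "z s \<in> frontier \<Omega>" if "0 \<le> s" "s \<le> 1" for s
      proof -
        have "z s + (\<rho> (z s) - z s \<bullet> \<nu>) *\<^sub>R \<nu> = p + s *\<^sub>R k"
          using W(5)[OF inW[OF that]] by (simp add: z_def)
        then have "(z s + (\<rho> (z s) - z s \<bullet> \<nu>) *\<^sub>R \<nu>) \<bullet> \<nu> = (p + s *\<^sub>R k) \<bullet> \<nu>" by simp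
        then have "\<rho> (z s) = 0" using p\<nu> k\<nu> \<nu>\<nu> by (simp add: inner_add_left)
        then show ?thesis using U(6)[OF zU[OF that]] by blast
      qed
      define \<theta> where "\<theta> = (\<lambda>s. (?g (z s) \<bullet> k) / (?g (z s) \<bullet> \<nu>))"
      define Z where "Z = (\<lambda>s. k - \<theta> s *\<^sub>R \<nu>)"
      have g\<nu>: "?g (z s) \<bullet> \<nu> \<ge> c" if "0 \<le> s" "s \<le> 1" for s using g_near(2)[OF zb[OF that]] .
      have zd: "(z has_derivative (\<lambda>t. t *\<^sub>R Z s)) (at s)" if s: "0 \<le> s" "s \<le> 1" for s
      proof -
        obtain D where D: "(\<Psi> has_derivative D) (at (p + s *\<^sub>R k))"
          "D k + (?g (z s) \<bullet> D k - D k \<bullet> \<nu>) *\<^sub>R \<nu> = k"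
          using W(6)[OF inW[OF s]] unfolding z_def by blast
        have "?g (z s) \<bullet> D k = 0"
          using arg_cong[OF D(2), of "\<lambda>w. w \<bullet> \<nu>"] k\<nu> \<nu>\<nu> by (simp add: inner_add_left)
        then have Dk: "D k = k + (D k \<bullet> \<nu>) *\<^sub>R \<nu>" using D(2) by (simp add: algebra_simps)
        then have "0 = ?g (z s) \<bullet> k + (D k \<bullet> \<nu>) * (?g (z s) \<bullet> \<nu>)"
          using \<open>?g (z s) \<bullet> D k = 0\<close> by (metis inner_add_right inner_scaleR_right)
        then have "D k \<bullet> \<nu> = - \<theta> s"
          using g\<nu>[OF s] \<open>c > 0\<close> by (simp add: \<theta>_def field_simps)
        then have DkZ: "D k = Z s" using Dk by (simp add: Z_def)
        have "((\<lambda>s. p + s *\<^sub>R k) has_derivative (\<lambda>t. t *\<^sub>R k)) (at s)"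
          by (auto intro!: derivative_eq_intros)
        from diff_chain_at[OF this D(1)] have "(z has_derivative (\<lambda>t. D (t *\<^sub>R k))) (at s)"
          by (simp add: z_def o_def)
        moreover have "D (t *\<^sub>R k) = t *\<^sub>R Z s" for t
          using linear_scale[OF has_derivative_linear[OF D(1)]] DkZ by simp
        ultimately show ?thesis by simp
      qed
      have tang: "?g (z s) \<bullet> Z s = 0" if "0 \<le> s" "s \<le> 1" for s
        using g\<nu>[OF that] \<open>c > 0\<close> by (simp add: Z_def \<theta>_def inner_diff_right)
      have \<theta>_le: "\<bar>\<theta> s\<bar> \<le> 3 * norm k" if "0 \<le> s" "s \<le> 1" for s
      proof -
        have "\<bar>?g (z s) \<bullet> k\<bar> \<le> G * norm k"
          using Cauchy_Schwarz_ineq2[of "?g (z s)" k] mult_right_mono[OF g_near(1)[OF zb[OF that]], of "norm k"] by simp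
        also have "\<dots> \<le> 3 * norm k * (?g (z s) \<bullet> \<nu>)"
          using mult_left_mono[OF g\<nu>[OF that], of "3 * norm k"] by (simp add: G_def mult.commute)
        finally show ?thesis
          using g\<nu>[OF that] \<open>c > 0\<close> by (simp add: \<theta>_def abs_divide pos_divide_le_eq)
      qed
      have Z_le: "norm (Z s) \<le> 4 * norm k" if "0 \<le> s" "s \<le> 1" for s
        using norm_triangle_ineq4[of k "\<theta> s *\<^sub>R \<nu>"] \<theta>_le[OF that] \<nu> by (simp add: Z_def)
      \<comment> \<open>velocity and acceleration of the curve are \<open>k - \<theta> \<nu>\<close> and \<open>- \<beta> \<nu>\<close>\<close>
      define \<beta> where "\<beta> = (\<lambda>s. ((?H (z s) *v Z s) \<bullet> Z s) / (?g (z s) \<bullet> \<nu>))"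
      have gd: "((\<lambda>s. ?g (z s)) has_derivative (\<lambda>t. t *\<^sub>R (?H (z s) *v Z s))) (at s)" if "0 \<le> s" "s \<le> 1" for s
        using diff_chain_at[OF zd[OF that] has_derivative_gradient_hessian[OF U(1) C2 zU[OF that]]]
        by (simp add: o_def matrix_vector_mult_scaleR)
      have \<theta>d: "(\<theta> has_real_derivative \<beta> s) (at s)" if s: "0 \<le> s" "s \<le> 1" for s
      proof -
        let ?h = "?H (z s) *v Z s"
        have lin: "((\<lambda>s. ?g (z s) \<bullet> w) has_real_derivative ?h \<bullet> w) (at s)" for w
          using has_derivative_inner_left[OF gd[OF s], of w]
          by (simp add: has_field_derivative_def mult.commute[of _ "_ \<bullet> _"])
        have ne: "?g (z s) \<bullet> \<nu> \<noteq> 0" using g\<nu>[OF s] \<open>c > 0\<close> by simp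
        have "(\<theta> has_real_derivative ((?h \<bullet> k) * (?g (z s) \<bullet> \<nu>) - (?g (z s) \<bullet> k) * (?h \<bullet> \<nu>))
            / ((?g (z s) \<bullet> \<nu>) * (?g (z s) \<bullet> \<nu>))) (at s)"
          unfolding \<theta>_def by (rule DERIV_divide[OF lin lin ne])
        moreover have "((?h \<bullet> k) * (?g (z s) \<bullet> \<nu>) - (?g (z s) \<bullet> k) * (?h \<bullet> \<nu>))
            / ((?g (z s) \<bullet> \<nu>) * (?g (z s) \<bullet> \<nu>)) = \<beta> s"
        proof -
          have "?h \<bullet> Z s = ?h \<bullet> k - \<theta> s * (?h \<bullet> \<nu>)" by (simp add: Z_def inner_diff_right)
          moreover have "(a * d - b * e) / (d * d) = (a - b / d * e) / d" if "d \<noteq> 0" for a b d e :: real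
            using that by (simp add: field_simps)
          ultimately show ?thesis using ne unfolding \<beta>_def \<theta>_def by metis
        qed
        ultimately show ?thesis by simp
      qed
      have \<beta>_le: "\<bar>\<beta> s\<bar> \<le> b0 * (norm k)\<^sup>2" if s: "0 \<le> s" "s \<le> 1" for s
      proof -
        have "\<bar>(?H (z s) *v Z s) \<bullet> Z s\<bar> \<le> norm (?H (z s) *v Z s) * norm (Z s)" by (rule Cauchy_Schwarz_ineq2)
        also have "\<dots> \<le> (norm (?H (z s)) * norm (Z s)) * norm (Z s)"
          by (intro mult_right_mono norm_matrix_vector_mult_le) simp
        also have "\<dots> \<le> (h0 * (4 * norm k)) * (4 * norm k)"
          using H_near[OF zb[OF s]] Z_le[OF s] \<open>h0 \<ge> 0\<close> by (intro mult_mono) auto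
        also have "\<dots> = b0 * (norm k)\<^sup>2 * c"
          using \<open>c > 0\<close> by (simp add: b0_def power2_eq_square)
        also have "\<dots> \<le> b0 * (norm k)\<^sup>2 * (?g (z s) \<bullet> \<nu>)"
          using g\<nu>[OF s] \<open>b0 \<ge> 0\<close> by (intro mult_left_mono) auto
        finally show ?thesis
          using g\<nu>[OF s] \<open>c > 0\<close> by (simp add: \<beta>_def abs_divide pos_divide_le_eq)
      qed
      have Zd: "((\<lambda>s. Z s) has_derivative (\<lambda>t. t *\<^sub>R (- \<beta> s *\<^sub>R \<nu>))) (at s)" if "0 \<le> s" "s \<le> 1" for s
        unfolding Z_def using \<theta>d[OF that]
        by (auto intro!: derivative_eq_intros simp: has_field_derivative_def fun_eq_iff mult.commute)
      have second: "?g (z s) \<bullet> (- \<beta> s *\<^sub>R \<nu>) + Z s \<bullet> (?H (z s) *v Z s) = 0" if "0 \<le> s" "s \<le> 1" for s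
        using g\<nu>[OF that] \<open>c > 0\<close> by (simp add: \<beta>_def inner_commute)
      have z01: "z 0 = x0" "z 1 = y" using pq by (auto simp: z_def k_def)
      have "\<bar>z 1 \<bullet> \<nu> - z 0 \<bullet> \<nu> - - \<theta> 0\<bar> \<le> b0 * (norm k)\<^sup>2"
      proof (rule second_order_remainder)
        fix s :: real assume s: "0 \<le> s" "s \<le> 1"
        have "((\<lambda>s. z s \<bullet> \<nu>) has_real_derivative Z s \<bullet> \<nu>) (at s)"
          using has_derivative_inner_left[OF zd[OF s], of \<nu>]
          by (simp add: has_field_derivative_def mult.commute[of _ "_ \<bullet> _"])
        then show "((\<lambda>s. z s \<bullet> \<nu>) has_real_derivative - \<theta> s) (at s)"
          using k\<nu> \<nu>\<nu> by (simp add: Z_def inner_diff_left)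
        show "((\<lambda>s. - \<theta> s) has_real_derivative - \<beta> s) (at s)"
          using \<theta>d[OF s] by (rule DERIV_minus)
        show "\<bar>- \<beta> s\<bar> \<le> b0 * (norm k)\<^sup>2" using \<beta>_le[OF s] by simp
      qed
      then have "\<bar>(y - x0) \<bullet> \<nu> + \<theta> 0\<bar> \<le> b0 * (norm k)\<^sup>2" by (simp add: z01 inner_diff_left)
      moreover have "(y - x0) - Z 0 = ((y - x0) \<bullet> \<nu> + \<theta> 0) *\<^sub>R \<nu>"
        using yx by (simp add: Z_def algebra_simps)
      ultimately have chord: "norm ((y - x0) - Z 0) \<le> b0 * (norm k)\<^sup>2" using \<nu> by simp
      define m1 where "m1 = (\<lambda>s. gradient g (z s) \<bullet> Z s)"
      have "\<bar>g (z 1) - g (z 0) - m1 0\<bar> \<le> C3 * (norm k)\<^sup>2"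
      proof (rule second_order_remainder)
        fix s :: real assume s: "0 \<le> s" "s \<le> 1"
        have zV: "z s \<in> V" using zfr[OF s] g(2) by blast
        show "((\<lambda>s. g (z s)) has_real_derivative m1 s) (at s)"
          using diff_chain_at[OF zd[OF s] has_derivative_gradient[OF times_cont_diff_2D(1)[OF g(3)] zV]]
          by (simp add: o_def has_field_derivative_def m1_def mult.commute[of _ "_ \<bullet> _"])
        have "((\<lambda>s. gradient g (z s)) has_derivative (\<lambda>t. t *\<^sub>R (hessian g (z s) *v Z s))) (at s)"
          using diff_chain_at[OF zd[OF s] has_derivative_gradient_hessian[OF g(1,3) zV]]
          by (simp add: o_def matrix_vector_mult_scaleR)
        from has_derivative_inner[OF this Zd[OF s]]
        show "(m1 has_real_derivative (Z s \<bullet> (hessian g (z s) *v Z s) + gradient g (z s) \<bullet> (- \<beta> s *\<^sub>R \<nu>))) (at s)"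
          unfolding m1_def has_field_derivative_def
          by (rule has_derivative_eq_rhs) (simp add: fun_eq_iff inner_commute algebra_simps)
        have "\<bar>Z s \<bullet> (hessian g (z s) *v Z s) + gradient g (z s) \<bullet> (- \<beta> s *\<^sub>R \<nu>)\<bar>
            \<le> n\<^sup>2 * M * (norm (Z s))\<^sup>2 + n * M * norm (- \<beta> s *\<^sub>R \<nu>)"
          by (rule bounds(2)[OF zU[OF s] zfr[OF s] tang[OF s] second[OF s]])
        also have "\<dots> \<le> n\<^sup>2 * M * (4 * norm k)\<^sup>2 + n * M * (b0 * (norm k)\<^sup>2)"
          using Z_le[OF s] \<beta>_le[OF s] \<nu> \<open>M \<ge> 0\<close>
          by (intro add_mono mult_left_mono power_mono) (auto simp: n_def)
        also have "\<dots> = C3 * (norm k)\<^sup>2" by (simp add: C3_def algebra_simps power2_eq_square)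
        finally show "\<bar>Z s \<bullet> (hessian g (z s) *v Z s) + gradient g (z s) \<bullet> (- \<beta> s *\<^sub>R \<nu>)\<bar> \<le> C3 * (norm k)\<^sup>2" .
      qed
      moreover have "m1 0 = l \<bullet> Z 0"
        using l(2)[of "Z 0"] tang[of 0] by (simp add: m1_def z01)
      moreover have "g (z 1) = \<phi> y" "g (z 0) = \<phi> x0" using g(4) x0 y by (auto simp: z01)
      moreover have "\<bar>l \<bullet> (y - x0) - l \<bullet> Z 0\<bar> \<le> n * M * (b0 * (norm k)\<^sup>2)"
      proof -
        have "\<bar>l \<bullet> ((y - x0) - Z 0)\<bar> \<le> norm l * norm ((y - x0) - Z 0)" by (rule Cauchy_Schwarz_ineq2)
        also have "\<dots> \<le> (n * M) * (b0 * (norm k)\<^sup>2)"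
          using l(1) chord \<open>M \<ge> 0\<close> by (intro mult_mono) (auto simp: n_def)
        finally show ?thesis by (simp add: inner_diff_right)
      qed
      ultimately have "\<bar>\<phi> y - \<phi> x0 - l \<bullet> (y - x0)\<bar> \<le> C3 * (norm k)\<^sup>2 + n * M * (b0 * (norm k)\<^sup>2)" by linarith
      also have "\<dots> = (C3 + n * M * b0) * (norm k)\<^sup>2" by (simp add: algebra_simps)
      also have "\<dots> \<le> C * (norm (y - x0))\<^sup>2"
        using nk C3 \<open>M \<ge> 0\<close> \<open>b0 \<ge> 0\<close> by (intro mult_mono power_mono) (auto simp: C_def n_def)
      finally show ?thesis .
    qed
    moreover have "norm l \<le> C"
    proof -
      have "0 \<le> n * M * b0" using \<open>M \<ge> 0\<close> \<open>b0 \<ge> 0\<close> by (simp add: n_def)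
      then show ?thesis using l(1) C3 unfolding C_def by linarith
    qed
    ultimately show ?thesis by blast
  qed
  with W(1) show ?thesis by blast
qed

text \<open>The local expansions bound the oscillation of all admissible \<open>\<phi>\<close> near each point by a common
constant. On a connected boundary these bounds chain up to a common bound of the total oscillation, which in turn
yields the expansion for pairs of points that are not close.\<close>

theorem tangential_data_taylor_bounded:
  fixes \<Omega> :: "(real^'n) set"
  assumes "bounded \<Omega>" and boundary: "\<And>x. x \<in> frontier \<Omega> \<Longrightarrow> \<exists>U \<rho>. local_defining_function k \<Omega> x U \<rho>" and "2 \<le> k"
    and conn: "connected (frontier \<Omega>)" and "M \<ge> 0"
  obtains C where "C \<ge> 0" "\<And>\<phi>. tangential_data \<Omega> \<kappa> M \<phi> \<Longrightarrow> taylor_bounded C (frontier \<Omega>) \<phi>"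
proof -
  define S where "S = frontier \<Omega>"
  define TD where "TD = Collect (tangential_data \<Omega> \<kappa> M)"
  define taylor where "taylor = (\<lambda>C l \<phi> x y. \<bar>\<phi> y - \<phi> x - l \<bullet> (y - x)\<bar> \<le> C * (norm (y - x :: real^'n))\<^sup>2)"
  have "compact S" unfolding S_def using \<open>bounded \<Omega>\<close> by (rule compact_frontier_bounded)
  define Q where "Q = (\<lambda>x1 r C. \<forall>\<phi>\<in>TD. \<forall>x\<in>S \<inter> ball x1 r. \<exists>l. norm l \<le> C \<and> (\<forall>y\<in>S \<inter> ball x1 r. taylor C l \<phi> x y))"
  have "\<exists>r C. r > 0 \<and> Q x1 r C" if x1: "x1 \<in> S" for x1
  proof -
    obtain U \<rho> where "local_defining_function k \<Omega> x1 U \<rho>" using boundary x1 unfolding S_def by blast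
    from local_taylor[OF this \<open>2 \<le> k\<close> _ \<open>M \<ge> 0\<close>, of \<kappa>] x1
    show ?thesis unfolding Q_def TD_def S_def taylor_def by auto
  qed
  then obtain r C where rC: "\<And>x. x \<in> S \<Longrightarrow> r x > 0" "\<And>x. x \<in> S \<Longrightarrow> Q x (r x) (C x)" by metis
  have "S \<subseteq> (\<Union>x\<in>S. ball x (r x / 2))" using rC(1) by force
  from compactE_image[OF \<open>compact S\<close> _ this] obtain X
    where X: "X \<subseteq> S" "finite X" "S \<subseteq> (\<Union>x\<in>X. ball x (r x / 2))" by auto
  define C0 where "C0 = (\<Sum>x\<in>X. \<bar>C x\<bar>)"
  have C0: "C0 \<ge> 0" by (simp add: C0_def sum_nonneg)
  have CX: "C x \<le> C0" if "x \<in> X" for x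
  proof -
    have "C x \<le> \<bar>C x\<bar>" by simp
    also have "\<dots> \<le> C0" unfolding C0_def using that X by (intro member_le_sum) auto
    finally show ?thesis .
  qed
  define \<delta> where "\<delta> = Min (insert 1 (r ` X)) / 2"
  have \<delta>: "\<delta> > 0" "\<delta> \<le> 1" "\<And>x. x \<in> X \<Longrightarrow> \<delta> \<le> r x / 2"
  proof -
    have "Min (insert 1 (r ` X)) > 0" using X rC(1) by (subst Min_gr_iff) auto
    then show "\<delta> > 0" by (simp add: \<delta>_def)
    have "Min (insert 1 (r ` X)) \<le> 1" using X(2) by (intro Min_le) auto
    then show "\<delta> \<le> 1" by (simp add: \<delta>_def)
    show "\<delta> \<le> r x / 2" if "x \<in> X" for x
      using X(2) that Min_le[of "insert 1 (r ` X)" "r x"] by (simp add: \<delta>_def)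
  qed
  have near: "\<exists>l. norm l \<le> C0 \<and> (\<forall>y\<in>S. norm (y - x) < \<delta> \<longrightarrow> taylor C0 l \<phi> x y)"
    if \<phi>: "\<phi> \<in> TD" and x: "x \<in> S" for \<phi> x
  proof -
    obtain x1 where x1: "x1 \<in> X" "dist x1 x < r x1 / 2" using X(3) x by auto
    have "dist x1 x < r x1" using x1(2) zero_le_dist[of x1 x] by linarith
    then have "x \<in> S \<inter> ball x1 (r x1)" using x by simp
    then obtain l where l: "norm l \<le> C x1" "\<And>y. y \<in> S \<inter> ball x1 (r x1) \<Longrightarrow> taylor (C x1) l \<phi> x y"
      using rC(2)[of x1] x1(1) X(1) \<phi> unfolding Q_def by blast
    have "taylor C0 l \<phi> x y" if y: "y \<in> S" "norm (y - x) < \<delta>" for y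
    proof -
      have "dist x1 y \<le> dist x1 x + dist x y" by (rule dist_triangle)
      then have "dist x1 y < r x1"
        using x1(2) y(2) \<delta>(3)[OF x1(1)] by (simp add: dist_norm norm_minus_commute)
      then have "taylor (C x1) l \<phi> x y" using l(2) y(1) by simp
      moreover have "C x1 * (norm (y - x))\<^sup>2 \<le> C0 * (norm (y - x))\<^sup>2"
        using CX[OF x1(1)] by (rule mult_right_mono) simp
      ultimately show ?thesis unfolding taylor_def by linarith
    qed
    with l(1) CX[OF x1(1)] show ?thesis by (intro exI[of _ l]) auto
  qed
  have step: "\<bar>\<phi> y - \<phi> x\<bar> \<le> 2 * C0" if \<phi>: "\<phi> \<in> TD" and xy: "x \<in> S" "y \<in> S" "norm (y - x) < \<delta>" for \<phi> x y
  proof -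
    obtain l where l: "norm l \<le> C0" "taylor C0 l \<phi> x y" using near[OF \<phi> xy(1)] xy(2,3) by blast
    have n1: "norm (y - x) \<le> 1" using xy(3) \<delta>(2) by simp
    have "\<bar>l \<bullet> (y - x)\<bar> \<le> norm l * norm (y - x)" by (rule Cauchy_Schwarz_ineq2)
    also have "\<dots> \<le> C0 * 1" using l(1) n1 C0 by (intro mult_mono) auto
    finally have "\<bar>l \<bullet> (y - x)\<bar> \<le> C0" by simp
    moreover have "C0 * (norm (y - x))\<^sup>2 \<le> C0 * 1"
      using n1 C0 by (intro mult_left_mono power_le_one) auto
    ultimately show ?thesis using l(2) unfolding taylor_def by linarith
  qed
  have osc: "\<exists>D\<ge>0. \<forall>\<phi>\<in>TD. \<forall>x\<in>S. \<forall>y\<in>S. \<bar>\<phi> y - \<phi> x\<bar> \<le> D"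
  proof (cases "S = {}")
    case True
    then show ?thesis by auto
  next
    case False
    then obtain b where b: "b \<in> S" by blast
    define R where "R = (\<lambda>x y. \<exists>c. \<forall>\<phi>\<in>TD. \<bar>\<phi> y - \<phi> x\<bar> \<le> (c::real))"
    have R: "R b y" if "y \<in> S" for y
    proof (rule connected_equivalence_relation[of S])
      show "connected S" using conn by (simp add: S_def)
      show "R y x" if "R x y" for x y
        using that unfolding R_def by (simp add: abs_minus_commute)
      show "R x z" if Rxy: "R x y" "R y z" for x y z
      proof -
        obtain c d where cd: "\<And>\<phi>. \<phi> \<in> TD \<Longrightarrow> \<bar>\<phi> y - \<phi> x\<bar> \<le> c" "\<And>\<phi>. \<phi> \<in> TD \<Longrightarrow> \<bar>\<phi> z - \<phi> y\<bar> \<le> d"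
          using Rxy unfolding R_def by blast
        have "\<bar>\<phi> z - \<phi> x\<bar> \<le> c + d" if "\<phi> \<in> TD" for \<phi> using cd[OF that] by linarith
        then show ?thesis unfolding R_def by blast
      qed
      show "\<exists>T. openin (top_of_set S) T \<and> a \<in> T \<and> (\<forall>x\<in>T. R a x)" if a: "a \<in> S" for a
      proof (intro exI conjI ballI)
        show "openin (top_of_set S) (S \<inter> ball a \<delta>)" by (simp add: openin_open_Int)
        show "a \<in> S \<inter> ball a \<delta>" using a \<delta>(1) by simp
        show "R a x" if "x \<in> S \<inter> ball a \<delta>" for x
          unfolding R_def using step[OF _ a, of _ x] that
          by (intro exI[of _ "2 * C0"]) (auto simp: dist_norm norm_minus_commute)
      qed
    qed (use b that in auto)
    let ?P = "\<lambda>L y. \<forall>\<phi>\<in>TD. \<bar>\<phi> y - \<phi> b\<bar> \<le> L"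
    show ?thesis
    proof (rule compact_uniform_constant[OF \<open>compact S\<close>, of ?P])
      show "\<exists>r>0. \<exists>L. \<forall>y\<in>S \<inter> ball x r. ?P L y" if x: "x \<in> S" for x
      proof -
        obtain c where c: "\<And>\<phi>. \<phi> \<in> TD \<Longrightarrow> \<bar>\<phi> x - \<phi> b\<bar> \<le> c" using R[OF x] unfolding R_def by blast
        have "\<bar>\<phi> y - \<phi> b\<bar> \<le> c + 2 * C0" if "y \<in> S \<inter> ball x \<delta>" "\<phi> \<in> TD" for y \<phi>
          using c[OF that(2)] step[OF that(2) x, of y] that(1) by (simp add: dist_norm norm_minus_commute)
        then show ?thesis using \<delta>(1) by blast
      qed
      show "?P L' y" if "?P L y" "L \<le> L'" for L L' y using that by force
      fix L assume L: "L \<ge> 0" "\<And>y. y \<in> S \<Longrightarrow> ?P L y"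
      have "\<bar>\<phi> y - \<phi> x\<bar> \<le> 2 * L" if "\<phi> \<in> TD" "x \<in> S" "y \<in> S" for \<phi> x y
      proof -
        have "\<bar>\<phi> x - \<phi> b\<bar> \<le> L" "\<bar>\<phi> y - \<phi> b\<bar> \<le> L" using L(2) that by blast+
        then show ?thesis by linarith
      qed
      then show ?thesis using L(1) by (intro exI[of _ "2 * L"]) auto
    qed
  qed
  then obtain D where D: "D \<ge> 0" "\<And>\<phi> x y. \<phi> \<in> TD \<Longrightarrow> x \<in> S \<Longrightarrow> y \<in> S \<Longrightarrow> \<bar>\<phi> y - \<phi> x\<bar> \<le> D" by blast
  define C1 where "C1 = C0 + D / \<delta>\<^sup>2 + C0 / \<delta>"
  have C1: "C0 \<le> C1" using C0 D(1) \<delta>(1) by (simp add: C1_def)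
  show thesis
  proof (rule that[of C1])
    show "C1 \<ge> 0" using C0 C1 by simp
    fix \<phi> assume "tangential_data \<Omega> \<kappa> M \<phi>"
    then have \<phi>: "\<phi> \<in> TD" by (simp add: TD_def)
    show "taylor_bounded C1 (frontier \<Omega>) \<phi>"
      unfolding taylor_bounded_def S_def[symmetric]
    proof
      fix x assume x: "x \<in> S"
      obtain l where l: "norm l \<le> C0" "\<And>y. y \<in> S \<Longrightarrow> norm (y - x) < \<delta> \<Longrightarrow> taylor C0 l \<phi> x y"
        using near[OF \<phi> x] by blast
      have "\<bar>\<phi> y - \<phi> x - l \<bullet> (y - x)\<bar> \<le> C1 * (norm (y - x))\<^sup>2" if y: "y \<in> S" for y
      proof (cases "norm (y - x) < \<delta>")
        case True
        have "C0 * (norm (y - x))\<^sup>2 \<le> C1 * (norm (y - x))\<^sup>2" using C1 by (rule mult_right_mono) simp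
        then show ?thesis using l(2)[OF y True] unfolding taylor_def by linarith
      next
        case False
        define w where "w = norm (y - x)"
        have w: "w \<ge> \<delta>" using False by (simp add: w_def)
        have "\<bar>l \<bullet> (y - x)\<bar> \<le> norm l * w" unfolding w_def by (rule Cauchy_Schwarz_ineq2)
        also have "\<dots> \<le> C0 * w" using l(1) by (intro mult_right_mono) (auto simp: w_def)
        finally have 1: "\<bar>\<phi> y - \<phi> x - l \<bullet> (y - x)\<bar> \<le> D + C0 * w" using D(2)[OF \<phi> x y] by linarith
        have "1 \<le> w / \<delta>" using w \<delta>(1) by simp
        then have "1 \<le> (w / \<delta>)\<^sup>2" by (rule one_le_power)
        then have "D * 1 \<le> D * (w / \<delta>)\<^sup>2" using D(1) by (rule mult_left_mono)
        moreover have "C0 * w * 1 \<le> C0 * w * (w / \<delta>)"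
          using \<open>1 \<le> w / \<delta>\<close> C0 w \<delta>(1) by (intro mult_left_mono) auto
        moreover have "C1 * w\<^sup>2 = C0 * w\<^sup>2 + D * (w / \<delta>)\<^sup>2 + C0 * w * (w / \<delta>)"
          using \<delta>(1) by (simp add: C1_def power2_eq_square field_simps)
        moreover have "0 \<le> C0 * w\<^sup>2" using C0 by simp
        ultimately show ?thesis using 1 unfolding w_def[symmetric] by linarith
      qed
      then show "\<exists>l. norm l \<le> C1 \<and> (\<forall>y\<in>S. \<bar>\<phi> y - \<phi> x - l \<bullet> (y - x)\<bar> \<le> C1 * (norm (y - x))\<^sup>2)"
        using l(1) C1 by (intro exI[of _ l]) auto
    qed
  qed
qed

section \<open>Mean convex domains have connected boundary\<close>

text \<open>The half-space of directions that enter the ball is contained in the half-space of directions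
in which \<open>\<rho>\<close> does not decrease, so their normals agree.\<close>

lemma touching_ball_gradient:
  fixes \<Omega> :: "(real^'n) set"
  assumes def: "local_defining_function k \<Omega> y U \<rho>" "1 \<le> k" and y: "y \<in> frontier \<Omega>"
    and ball: "ball (y + r *\<^sub>R e) r \<subseteq> \<Omega>" and "r > 0" and e: "norm e = 1"
  shows "gradient \<rho> y = norm (gradient \<rho> y) *\<^sub>R e"
proof -
  note U = defining_functionD[OF def(1)]
  have C1: "times_cont_diff (Suc 0) U \<rho>"
    using U(3)[of "Suc 0"] def(2) by (simp add: one_enat_def del: times_cont_diff.simps)
  define g where "g = gradient \<rho> y"
  have \<rho>y: "\<rho> y = 0" using U(2,6) y by blast
  have ee: "e \<bullet> e = 1" using e by (simp add: norm_eq_1)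
  have half: "g \<bullet> v \<ge> 0" if v: "v \<bullet> e > 0" for v
  proof (rule ccontr)
    assume "\<not> g \<bullet> v \<ge> 0"
    then have "gradient \<rho> y \<bullet> v < 0" by (simp add: g_def)
    from ray_neg[OF U(1) C1 U(2) \<rho>y this]
    obtain d where d: "d > 0" "\<And>s. 0 < s \<Longrightarrow> s < d \<Longrightarrow> y + s *\<^sub>R v \<in> U \<and> \<rho> (y + s *\<^sub>R v) < 0"
      by blast
    have vv: "v \<bullet> v > 0" using v by auto
    define q where "q = 2 * r * (v \<bullet> e) / (v \<bullet> v)"
    have "q > 0" using \<open>r > 0\<close> v vv by (simp add: q_def)
    define s where "s = min d q / 2"
    have s: "0 < s" "s < d" "s < q" using d(1) \<open>q > 0\<close> by (auto simp: s_def)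
    have "s * (v \<bullet> v) < 2 * r * (v \<bullet> e)" using s(3) vv by (simp add: q_def field_simps)
    then have "s * (s * (v \<bullet> v)) < s * (2 * r * (v \<bullet> e))" using s(1) by (rule mult_strict_left_mono)
    moreover have "(norm (s *\<^sub>R v - r *\<^sub>R e))\<^sup>2 = s * (s * (v \<bullet> v)) - s * (2 * r * (v \<bullet> e)) + r\<^sup>2"
      using ee by (simp only: power2_norm_eq_inner)
        (simp add: inner_diff_left inner_diff_right inner_commute power2_eq_square algebra_simps)
    ultimately have "(norm (s *\<^sub>R v - r *\<^sub>R e))\<^sup>2 < r\<^sup>2" by simp
    then have "norm (s *\<^sub>R v - r *\<^sub>R e) < r" using \<open>r > 0\<close> by (simp add: power_less_imp_less_base)
    then have "y + s *\<^sub>R v \<in> ball (y + r *\<^sub>R e) r"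
      by (simp add: dist_norm norm_minus_commute)
    then have "y + s *\<^sub>R v \<in> \<Omega>" using ball by blast
    then show False using d(2)[OF s(1,2)] U(5)[of "y + s *\<^sub>R v"] by simp
  qed
  define w where "w = g - (g \<bullet> e) *\<^sub>R e"
  have we: "w \<bullet> e = 0" using ee by (simp add: w_def inner_diff_left)
  have gw: "g \<bullet> w = w \<bullet> w" using we by (simp add: w_def inner_diff_left inner_commute)
  have "w = 0"
  proof (rule ccontr)
    assume "w \<noteq> 0"
    then have ww: "w \<bullet> w > 0" by simp
    define t where "t = (g \<bullet> e + 1) / (w \<bullet> w)"
    have "(e - t *\<^sub>R w) \<bullet> e = 1" using we ee by (simp add: inner_diff_left)
    then have "g \<bullet> (e - t *\<^sub>R w) \<ge> 0" by (intro half) simp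
    moreover have "g \<bullet> (e - t *\<^sub>R w) = - 1" using ww by (simp add: inner_diff_right gw t_def)
    ultimately show False by simp
  qed
  then have ge: "g = (g \<bullet> e) *\<^sub>R e" by (simp add: w_def)
  have "g \<bullet> e \<ge> 0" using half[of e] ee by simp
  then have "norm g = g \<bullet> e" using ge e by (metis abs_of_nonneg mult.right_neutral norm_scaleR)
  then show ?thesis using ge by (simp add: g_def)
qed

text \<open>Along \<open>s \<mapsto> y + s T + c s\<^sup>2 e\<close> the first derivative of \<open>\<rho>\<close> vanishes at \<open>y\<close>, and the second one is the
expression in the last assumption.\<close>

lemma parabola_outside:
  fixes \<rho> :: "real^'n \<Rightarrow> real"
  assumes "open U" "times_cont_diff 2 U \<rho>" "y \<in> U" "\<rho> y = 0"
    and grad: "gradient \<rho> y = \<mu> *\<^sub>R e" and e: "norm e = 1" and T: "T \<bullet> e = 0"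
    and neg: "2 * \<mu> * c + T \<bullet> (hessian \<rho> y *v T) < 0"
  obtains d where "d > 0"
    "\<And>s. 0 < s \<Longrightarrow> s < d \<Longrightarrow> y + s *\<^sub>R T + (c * s\<^sup>2) *\<^sub>R e \<in> U \<and> \<rho> (y + s *\<^sub>R T + (c * s\<^sup>2) *\<^sub>R e) < 0"
proof -
  define \<gamma> where "\<gamma> = (\<lambda>s. y + s *\<^sub>R T + (c * s\<^sup>2) *\<^sub>R e)"
  define \<gamma>' where "\<gamma>' = (\<lambda>s. T + (2 * c * s) *\<^sub>R e)"
  have \<gamma>d: "(\<gamma> has_derivative (\<lambda>t. t *\<^sub>R \<gamma>' s)) (at s)" for s
    unfolding \<gamma>_def \<gamma>'_def
    by (auto intro!: derivative_eq_intros simp: fun_eq_iff algebra_simps)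
  have \<gamma>'d: "(\<gamma>' has_derivative (\<lambda>t. t *\<^sub>R ((2 * c) *\<^sub>R e))) (at s)" for s
    unfolding \<gamma>'_def by (auto intro!: derivative_eq_intros simp: fun_eq_iff algebra_simps)
  have "open (\<gamma> -` U)"
    unfolding \<gamma>_def by (intro open_vimage assms continuous_intros)
  moreover have "0 \<in> \<gamma> -` U" using assms by (simp add: \<gamma>_def)
  ultimately obtain d0 where d0: "d0 > 0" "ball 0 d0 \<subseteq> \<gamma> -` U" using open_contains_ball by blast
  have inU: "\<gamma> s \<in> U" if "\<bar>s\<bar> < d0" for s using d0(2) that by (auto simp: subset_iff)
  define m1 where "m1 = (\<lambda>s. gradient \<rho> (\<gamma> s) \<bullet> \<gamma>' s)"
  have m: "((\<lambda>s. \<rho> (\<gamma> s)) has_real_derivative m1 s) (at s)" if "\<bar>s\<bar> < d0" for s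
    using diff_chain_at[OF \<gamma>d has_derivative_gradient[OF times_cont_diff_2D(1)[OF assms(2)] inU[OF that]]]
    by (simp add: o_def has_field_derivative_def m1_def mult.commute[of _ "_ \<bullet> _"])
  have gd: "((\<lambda>s. gradient \<rho> (\<gamma> s)) has_derivative (\<lambda>t. t *\<^sub>R (hessian \<rho> (\<gamma> 0) *v \<gamma>' 0))) (at 0)"
    using diff_chain_at[OF \<gamma>d has_derivative_gradient_hessian[OF assms(1,2) inU[of 0]]] d0(1)
    by (simp add: o_def matrix_vector_mult_scaleR)
  have ee: "e \<bullet> e = 1" using e by (simp add: norm_eq_1)
  have \<gamma>0: "\<gamma> 0 = y" "\<gamma>' 0 = T" by (simp_all add: \<gamma>_def \<gamma>'_def)
  have "(m1 has_derivative (\<lambda>t. gradient \<rho> (\<gamma> 0) \<bullet> (t *\<^sub>R ((2 * c) *\<^sub>R e)) + (t *\<^sub>R (hessian \<rho> (\<gamma> 0) *v \<gamma>' 0)) \<bullet> \<gamma>' 0)) (at 0)"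
    unfolding m1_def by (rule has_derivative_inner[OF gd \<gamma>'d])
  moreover have "gradient \<rho> (\<gamma> 0) \<bullet> (t *\<^sub>R ((2 * c) *\<^sub>R e)) + (t *\<^sub>R (hessian \<rho> (\<gamma> 0) *v \<gamma>' 0)) \<bullet> \<gamma>' 0
      = (2 * \<mu> * c + T \<bullet> (hessian \<rho> y *v T)) * t" for t
    using ee by (simp add: \<gamma>0 grad inner_commute algebra_simps)
  ultimately have m2: "(m1 has_real_derivative (2 * \<mu> * c + T \<bullet> (hessian \<rho> y *v T))) (at 0)"
    unfolding has_field_derivative_def by simp
  have m10: "m1 0 = 0" using T by (simp add: m1_def \<gamma>0 grad inner_commute)
  obtain d1 where d1: "d1 > 0" "\<And>s. 0 < s \<Longrightarrow> s < d1 \<Longrightarrow> m1 s < 0"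
    using DERIV_neg_dec_right[OF m2 neg] m10 by auto
  show thesis
  proof (rule that[of "min d0 d1"])
    show "min d0 d1 > 0" using d0(1) d1(1) by simp
    fix s :: real assume s: "0 < s" "s < min d0 d1"
    obtain \<xi> where \<xi>: "0 < \<xi>" "\<xi> < s" "\<rho> (\<gamma> s) - \<rho> (\<gamma> 0) = (s - 0) * m1 \<xi>"
      using MVT2[OF s(1), of "\<lambda>s. \<rho> (\<gamma> s)" m1] m s(2) by auto
    have "m1 \<xi> < 0" using d1(2) \<xi>(1,2) s(2) by simp
    then have "s * m1 \<xi> < 0" using s(1) by (simp add: mult_pos_neg)
    then have "\<rho> (\<gamma> s) < 0" using \<xi>(3) \<gamma>0(1) \<open>\<rho> y = 0\<close> by simp
    then show "y + s *\<^sub>R T + (c * s\<^sup>2) *\<^sub>R e \<in> U \<and> \<rho> (y + s *\<^sub>R T + (c * s\<^sup>2) *\<^sub>R e) < 0"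
      using inU[of s] s by (simp add: \<gamma>_def)
  qed
qed

text \<open>The boundary near \<open>y\<close>, seen as a graph over the tangent direction \<open>T\<close>, lies above the parabola
\<open>c s\<^sup>2\<close>: the vertical segment starts outside of \<open>\<Omega>\<close> on the parabola and ends in the touching ball.\<close>

lemma boundary_above_parabola:
  fixes \<Omega> :: "(real^'n) set"
  assumes def: "local_defining_function k \<Omega> y U \<rho>" "2 \<le> k" and y: "y \<in> frontier \<Omega>"
    and ball: "ball (y + r *\<^sub>R e) r \<subseteq> \<Omega>" and "r > 0" and e: "norm e = 1"
    and T: "T \<bullet> e = 0" "norm T = 1"
    and neg: "2 * norm (gradient \<rho> y) * c + T \<bullet> (hessian \<rho> y *v T) < 0" and "\<eta> > 0"
  shows "\<exists>d>0. \<forall>s. 0 < s \<longrightarrow> s < d \<longrightarrow>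
    (\<exists>\<tau>. c * s\<^sup>2 < \<tau> \<and> \<bar>\<tau>\<bar> < \<eta> \<and> y + s *\<^sub>R T + \<tau> *\<^sub>R e \<in> frontier \<Omega>)"
proof -
  note U = defining_functionD[OF def(1)]
  have k: "1 \<le> k" "enat 2 \<le> k" using def(2) order_trans[of 1 2 k] enat_2_le_2 by (auto simp: one_le_numeral)
  have grad: "gradient \<rho> y = norm (gradient \<rho> y) *\<^sub>R e"
    by (rule touching_ball_gradient[OF def(1) k(1) y ball \<open>r > 0\<close> e])
  have \<rho>y: "\<rho> y = 0" using U(2,6) y by blast
  obtain d1 where d1: "d1 > 0" "\<And>s. 0 < s \<Longrightarrow> s < d1 \<Longrightarrow>
      y + s *\<^sub>R T + (c * s\<^sup>2) *\<^sub>R e \<in> U \<and> \<rho> (y + s *\<^sub>R T + (c * s\<^sup>2) *\<^sub>R e) < 0"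
    using parabola_outside[OF U(1) U(3)[OF k(2)] U(2) \<rho>y grad e T(1) neg] by blast
  define h where "h = min \<eta> r / 2"
  have h: "0 < h" "h < \<eta>" "h < r" using \<open>\<eta> > 0\<close> \<open>r > 0\<close> by (auto simp: h_def)
  define d where "d = min (min d1 1) (min h (h / (\<bar>c\<bar> + 1)))"
  have "d > 0" using d1(1) h(1) by (simp add: d_def)
  have "\<exists>\<tau>. c * s\<^sup>2 < \<tau> \<and> \<bar>\<tau>\<bar> < \<eta> \<and> y + s *\<^sub>R T + \<tau> *\<^sub>R e \<in> frontier \<Omega>" if s: "0 < s" "s < d" for s
  proof -
    have sd: "s < d1" "s < 1" "s < h" "s < h / (\<bar>c\<bar> + 1)" using s(2) by (auto simp: d_def)
    have out: "y + s *\<^sub>R T + (c * s\<^sup>2) *\<^sub>R e \<in> U" "\<rho> (y + s *\<^sub>R T + (c * s\<^sup>2) *\<^sub>R e) < 0"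
      using d1(2)[OF s(1) sd(1)] by blast+
    have "s\<^sup>2 \<le> s" using s(1) sd(2) by (simp add: power2_eq_square mult_left_le)
    then have "\<bar>c\<bar> * s\<^sup>2 \<le> (\<bar>c\<bar> + 1) * s" using s(1) by (intro mult_mono) auto
    also have "\<dots> < h" using sd(4) by (simp add: pos_less_divide_eq mult.commute add_nonneg_pos)
    finally have ch: "\<bar>c * s\<^sup>2\<bar> < h" by (simp add: abs_mult)
    define L where "L = (\<lambda>\<tau>. y + s *\<^sub>R T + \<tau> *\<^sub>R e) ` {c * s\<^sup>2..h}"
    have "connected L"
      unfolding L_def by (intro connected_continuous_image continuous_intros) simp
    moreover have "L \<inter> \<Omega> \<noteq> {}"
    proof -
      have "(norm (s *\<^sub>R T - (r - h) *\<^sub>R e))\<^sup>2 = s\<^sup>2 + (r - h)\<^sup>2"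
        using T e by (simp only: power2_norm_eq_inner norm_eq_1)
          (simp add: inner_diff_left inner_diff_right inner_commute power2_eq_square)
      also have "\<dots> < r\<^sup>2"
      proof -
        have "s\<^sup>2 < h\<^sup>2" using s(1) sd(3) by (intro power_strict_mono) auto
        moreover have "h * h < h * r" using h by (intro mult_strict_left_mono) auto
        ultimately show ?thesis by (simp add: power2_eq_square algebra_simps)
      qed
      finally have "norm (s *\<^sub>R T - (r - h) *\<^sub>R e) < r" using \<open>r > 0\<close> by (simp add: power_less_imp_less_base)
      moreover have "(y + s *\<^sub>R T + h *\<^sub>R e) - (y + r *\<^sub>R e) = s *\<^sub>R T - (r - h) *\<^sub>R e"
        by (simp add: algebra_simps)
      ultimately have "y + s *\<^sub>R T + h *\<^sub>R e \<in> ball (y + r *\<^sub>R e) r"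
        by (simp only: mem_ball dist_norm norm_minus_commute[of "y + r *\<^sub>R e" "y + s *\<^sub>R T + h *\<^sub>R e"])
      moreover have "y + s *\<^sub>R T + h *\<^sub>R e \<in> L" using ch unfolding L_def by (intro imageI) auto
      ultimately show ?thesis using ball by blast
    qed
    moreover have "L - \<Omega> \<noteq> {}"
    proof -
      have "y + s *\<^sub>R T + (c * s\<^sup>2) *\<^sub>R e \<in> L" using ch unfolding L_def by (intro imageI) auto
      moreover have "y + s *\<^sub>R T + (c * s\<^sup>2) *\<^sub>R e \<notin> \<Omega>" using U(5)[OF out(1)] out(2) by simp
      ultimately show ?thesis by blast
    qed
    ultimately have "L \<inter> frontier \<Omega> \<noteq> {}" by (rule connected_Int_frontier)
    then obtain \<tau> where \<tau>: "c * s\<^sup>2 \<le> \<tau>" "\<tau> \<le> h" "y + s *\<^sub>R T + \<tau> *\<^sub>R e \<in> frontier \<Omega>"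
      unfolding L_def by auto
    have "\<tau> \<noteq> c * s\<^sup>2" using \<tau>(3) U(6)[OF out(1)] out(2) by auto
    then have "c * s\<^sup>2 < \<tau>" using \<tau>(1) by simp
    moreover have "\<bar>\<tau>\<bar> < \<eta>" using \<tau>(1,2) ch h(2) by simp
    ultimately show ?thesis using \<tau>(3) by blast
  qed
  then show ?thesis using \<open>d > 0\<close> by blast
qed

text \<open>Let \<open>r\<close> be the smallest common distance of points of \<open>closure \<Omega>\<close> that are equidistant from \<open>A\<close> and \<open>B\<close>. No
point \<open>z\<close> close to a minimiser has both distances below \<open>r\<close>: on the way from \<open>z\<close> to the nearest point \<open>y\<close> of \<open>B\<close> there would be an
equidistant point with smaller distance. This way stays in \<open>\<Omega>\<close>, because \<open>y\<close> is nearest in \<open>B\<close> and because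
a point of \<open>A\<close> on it would be closer to \<open>y\<close> than \<open>\<sigma>\<close>.\<close>

lemma equidistant_descent:
  fixes \<Omega> A B :: "(real^'n) set"
  assumes \<Omega>: "open \<Omega>" and AB: "closed A" "closed B" "A \<noteq> {}" "B \<noteq> {}" "A \<union> B = frontier \<Omega>"
    and sep: "\<And>x y. x \<in> A \<Longrightarrow> y \<in> B \<Longrightarrow> \<sigma> \<le> dist x y" and "\<sigma> > 0"
    and min: "\<And>q. q \<in> closure \<Omega> \<Longrightarrow> infdist q A = infdist q B \<Longrightarrow> r \<le> infdist q A"
    and x0: "infdist x0 A = r"
    and z: "z \<in> \<Omega>" "dist z x0 < \<sigma>" and le: "infdist z A \<le> infdist z B" and lt: "infdist z B < r"
  shows False
proof -
  obtain y where y: "y \<in> B" "infdist z B = dist z y" using infdist_attains_inf[OF AB(2,4)] by blast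
  have "y \<notin> A" using sep[of y y] y(1) \<open>\<sigma> > 0\<close> by auto
  then have yA: "infdist y A > 0" using AB(1,3) in_closed_iff_infdist_zero infdist_nonneg
    by (metis less_eq_real_def)
  have "y \<notin> \<Omega>" using y(1) AB(5) \<Omega> by (auto simp: frontier_def interior_open)
  then have "z \<noteq> y" using z(1) by blast
  define h where "h = (\<lambda>s. infdist (z + s *\<^sub>R (y - z)) A - infdist (z + s *\<^sub>R (y - z)) B)"
  have "continuous_on {0..1} h" unfolding h_def by (intro continuous_intros)
  moreover have "h 0 \<le> 0" using le by (simp add: h_def)
  moreover have h1: "h 1 > 0" using yA y(1) by (simp add: h_def)
  ultimately obtain s where s: "0 \<le> s" "s \<le> 1" "h s = 0" using IVT'[of h 0 0 1] by auto
  have "s \<noteq> 1" using s(3) h1 by auto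
  then have "s < 1" using s(2) by simp
  define q where "q = z + s *\<^sub>R (y - z)"
  have eq: "infdist q A = infdist q B" using s(3) by (simp add: h_def q_def)
  have seg: "dist z (z + t *\<^sub>R (y - z)) = t * dist z y" "dist (z + t *\<^sub>R (y - z)) y = (1 - t) * dist z y"
    if "0 \<le> t" "t \<le> 1" for t
  proof -
    show "dist z (z + t *\<^sub>R (y - z)) = t * dist z y"
      using that by (simp add: dist_norm norm_minus_commute)
    have "(z + t *\<^sub>R (y - z)) - y = (1 - t) *\<^sub>R (z - y)" by (simp add: algebra_simps)
    then show "dist (z + t *\<^sub>R (y - z)) y = (1 - t) * dist z y" using that by (simp add: dist_norm)
  qed
  have "infdist q B \<le> dist q y" by (rule infdist_le[OF y(1)])
  also have "\<dots> \<le> dist z y" using seg(2)[OF s(1,2)] s(1,2) by (simp add: q_def mult_left_le_one_le)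
  also have "\<dots> < r" using lt y(2) by simp
  finally have "infdist q A < r" using eq by simp
  then have "q \<notin> closure \<Omega>" using min[OF _ eq] by force
  then have qn: "q \<notin> \<Omega>" using closure_subset by blast
  define L where "L = (\<lambda>t. z + t *\<^sub>R (y - z)) ` {0..s}"
  have "connected L" unfolding L_def by (intro connected_continuous_image continuous_intros) simp
  moreover have "z \<in> L" unfolding L_def using s(1) by (intro image_eqI[of _ _ 0]) auto
  then have "L \<inter> \<Omega> \<noteq> {}" using z(1) by blast
  moreover have "q \<in> L" unfolding L_def q_def using s(1) by (intro imageI) auto
  then have "L - \<Omega> \<noteq> {}" using qn by blast
  ultimately have "L \<inter> frontier \<Omega> \<noteq> {}" by (rule connected_Int_frontier)
  then obtain t where t: "0 \<le> t" "t \<le> s" "z + t *\<^sub>R (y - z) \<in> frontier \<Omega>" unfolding L_def by auto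
  define b where "b = z + t *\<^sub>R (y - z)"
  have tb: "dist z b = t * dist z y" "dist b y = (1 - t) * dist z y"
    using seg[of t] t(1,2) \<open>s < 1\<close> by (auto simp: b_def)
  have "b \<in> A \<or> b \<in> B" using t(3) AB(5) by (auto simp: b_def)
  then show False
  proof
    assume "b \<in> B"
    then have "dist z y \<le> t * dist z y" using infdist_le[of b B z] y(2) tb(1) by simp
    moreover have "t * dist z y < 1 * dist z y"
      using \<open>z \<noteq> y\<close> t(2) \<open>s < 1\<close> by (intro mult_strict_right_mono) auto
    ultimately show False by simp
  next
    assume bA: "b \<in> A"
    have "r \<le> infdist z A + dist x0 z" using infdist_triangle[of x0 A z] x0 by simp
    then have "r - \<sigma> < infdist z A" using z(2) by (simp add: dist_commute)
    also have "\<dots> \<le> dist z b" by (rule infdist_le[OF bA])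
    finally have "dist b y < \<sigma>" using tb lt y(2) by (simp add: algebra_simps)
    then show False using sep[OF bA y(1)] by simp
  qed
qed

lemma mean_curvature_inner:
  fixes \<Omega> :: "(real^'n) set"
  assumes pf: "principal_frame \<Omega> x E \<kappa>" and def: "local_defining_function k \<Omega> x U \<rho>" "2 \<le> k"
    and x: "x \<in> frontier \<Omega>" and e: "gradient \<rho> x = norm (gradient \<rho> x) *\<^sub>R e" "norm e = 1"
  shows "hessian \<rho> x \<bullet> mat 1 - e \<bullet> (hessian \<rho> x *v e)
    = - norm (gradient \<rho> x) * (\<Sum>i=1..CARD('n) - 1. \<kappa> i)"
proof -
  note P = principal_frameD[OF pf def x]
  have "norm (gradient \<rho> x) \<noteq> 0" using defining_functionD(2,4)[OF def(1)] by simp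
  then have Ee: "E i x \<bullet> e = 0" if "i \<in> {1..CARD('n) - 1}" for i
    using P(2)[OF that] e(1) by (metis inner_commute inner_scaleR_left mult_eq_0_iff)
  have EE: "E i x \<bullet> E j x = (if i = j then 1 else 0)"
    if "i \<in> {1..CARD('n) - 1}" "j \<in> {1..CARD('n) - 1}" for i j
    by (rule P(3)[OF that])
  have "(\<Sum>i=1..CARD('n) - 1. E i x \<bullet> (hessian \<rho> x *v E i x))
      = (\<Sum>i=1..CARD('n) - 1. - norm (gradient \<rho> x) * \<kappa> i)"
    by (rule sum.cong[OF refl]) (simp add: P(4))
  with inner_mat_1_orthonormal[OF e(2) Ee EE, of "hessian \<rho> x"] show ?thesis
    by (simp add: sum_distrib_left)
qed

text \<open>Suppose that the boundary splits into closed parts \<open>A\<close> and \<open>B\<close>. Among the points of \<open>closure \<Omega>\<close> equidistant from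
both, let \<open>x0\<close> have the smallest distance \<open>r\<close>. The ball of radius \<open>r\<close> around \<open>x0\<close> lies in \<open>\<Omega>\<close> and touches \<open>A\<close> and \<open>B\<close> at
antipodal points, and it is the shortest bridge between the two in this neighbourhood. Shifting both ends in
the same tangent direction \<open>T\<close> changes the length of the bridge to second order by the sum of the normal curvatures of \<open>A\<close>
and \<open>B\<close> in the direction \<open>T\<close>, with a negative sign. As the mean curvatures are positive, this sum is positive for some member of an orthonormal frame, and the bridge
becomes shorter.\<close>

theorem connected_mean_convex_frontier:
  fixes \<Omega> :: "(real^'n) set"
  assumes \<Omega>: "open \<Omega>" "connected \<Omega>" "bounded \<Omega>"
    and boundary: "\<And>x. x \<in> frontier \<Omega> \<Longrightarrow> \<exists>U \<rho>. local_defining_function k \<Omega> x U \<rho>" and "2 \<le> k"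
    and frame: "\<And>x. x \<in> frontier \<Omega> \<Longrightarrow> \<exists>E. principal_frame \<Omega> x E (\<kappa> x)"
    and convex: "\<And>x. x \<in> frontier \<Omega> \<Longrightarrow> (\<Sum>i=1..CARD('n) - 1. \<kappa> x i) > 0"
  shows "connected (frontier \<Omega>)"
proof (rule ccontr)
  assume "\<not> connected (frontier \<Omega>)"
  then obtain A B where AB: "closed A" "closed B" "A \<noteq> {}" "B \<noteq> {}" "A \<union> B = frontier \<Omega>" "A \<inter> B = {}"
    using connected_closed_set[of "frontier \<Omega>"] by auto
  have "compact A" using AB(1,5) \<Omega>(3) compact_frontier_bounded[OF \<Omega>(3)]
    by (metis Un_upper1 bounded_subset compact_eq_bounded_closed)
  define \<sigma> where "\<sigma> = setdist A B"
  have "\<sigma> > 0" unfolding \<sigma>_def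
    using setdist_gt_0_compact_closed[OF \<open>compact A\<close> AB(2)] AB(3,4,6) by blast
  have sep: "\<sigma> \<le> dist x y" if "x \<in> A" "y \<in> B" for x y
    unfolding \<sigma>_def using that by (rule setdist_le_dist)
  have sep': "\<sigma> \<le> dist x y" if "x \<in> B" "y \<in> A" for x y
    using sep[OF that(2,1)] by (simp add: dist_commute)
  define h where "h = (\<lambda>x. infdist x A - infdist x B)"
  have cont_h: "continuous_on X h" for X unfolding h_def by (intro continuous_intros)
  have close: "\<exists>w\<in>\<Omega>. infdist w P < infdist w Q"
    if PQ: "closed Q" "P \<noteq> {}" "Q \<noteq> {}" "P \<subseteq> frontier \<Omega>" "\<And>x y. x \<in> P \<Longrightarrow> y \<in> Q \<Longrightarrow> \<sigma> \<le> dist x y" for P Q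
  proof -
    obtain y where y: "y \<in> P" using PQ(2) by blast
    then have "y \<in> closure \<Omega>" using PQ(4) by (auto simp: frontier_def)
    then obtain w where w: "w \<in> \<Omega>" "dist w y < \<sigma> / 2"
      using \<open>\<sigma> > 0\<close> closure_approachable[of y \<Omega>] half_gt_zero by blast
    obtain q where q: "q \<in> Q" "infdist w Q = dist w q" using infdist_attains_inf[OF PQ(1,3)] by blast
    have "infdist w P \<le> dist w y" by (rule infdist_le[OF y])
    moreover have "\<sigma> \<le> dist y q" by (rule PQ(5)[OF y q(1)])
    moreover have "dist y q \<le> dist w y + dist w q" by (rule dist_triangle3)
    ultimately have "infdist w P < infdist w Q" using w(2) q(2) by simp
    then show ?thesis using w(1) by blast
  qed
  obtain w1 where w1: "w1 \<in> \<Omega>" "h w1 < 0"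
    using close[OF AB(2,3,4) _ sep] AB(5) unfolding h_def by auto
  obtain w2 where w2: "w2 \<in> \<Omega>" "h w2 > 0"
    using close[OF AB(1,4,3) _ sep'] AB(5) unfolding h_def by auto
  have "connected (h ` \<Omega>)" by (rule connected_continuous_image[OF cont_h \<Omega>(2)])
  then have "0 \<in> h ` \<Omega>"
    using connected_contains_Icc[of "h ` \<Omega>" "h w1" "h w2"] w1 w2 by fastforce
  then obtain w where w: "w \<in> \<Omega>" "h w = 0" by auto
  define Z where "Z = closure \<Omega> \<inter> h -` {0}"
  have "compact (closure \<Omega>)" using \<Omega>(3) by simp
  then have "compact Z"
    unfolding Z_def using cont_h[of UNIV] by (intro compact_Int_closed closed_vimage) auto
  moreover have "w \<in> Z" using w closure_subset by (auto simp: Z_def)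
  moreover have "continuous_on Z (\<lambda>x. infdist x A)" by (intro continuous_intros)
  ultimately obtain x0 where x0: "x0 \<in> Z" "\<And>q. q \<in> Z \<Longrightarrow> infdist x0 A \<le> infdist q A"
    using continuous_attains_inf[of Z "\<lambda>x. infdist x A"] by blast
  define r where "r = infdist x0 A"
  have r: "infdist x0 A = r" "infdist x0 B = r" using x0(1) by (auto simp: Z_def h_def r_def)
  have min: "r \<le> infdist q A" "r \<le> infdist q B" if "q \<in> closure \<Omega>" "infdist q A = infdist q B" for q
    using x0(2)[of q] that by (auto simp: Z_def h_def r_def)
  have x0f: "x0 \<notin> frontier \<Omega>"
  proof
    assume "x0 \<in> frontier \<Omega>"
    then have "x0 \<in> A \<or> x0 \<in> B" using AB(5) by blast
    then have "r = 0" using r by auto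
    then have "x0 \<in> A" "x0 \<in> B"
      using r in_closed_iff_infdist_zero[OF AB(1,3)] in_closed_iff_infdist_zero[OF AB(2,4)] by auto
    then show False using AB(6) by blast
  qed
  then have x0\<Omega>: "x0 \<in> \<Omega>" using x0(1) \<Omega>(1) by (auto simp: Z_def frontier_def interior_open)
  have "r > 0"
  proof -
    have "x0 \<notin> A" using x0f AB(5) by blast
    then show ?thesis using in_closed_iff_infdist_zero[OF AB(1,3)] r(1) infdist_nonneg[of x0 A] by force
  qed
  have ball: "ball x0 r \<subseteq> \<Omega>"
  proof (rule ccontr)
    assume "\<not> ball x0 r \<subseteq> \<Omega>"
    then have "ball x0 r \<inter> frontier \<Omega> \<noteq> {}"
    proof (intro connected_Int_frontier)
      show "ball x0 r \<inter> \<Omega> \<noteq> {}" using x0\<Omega> centre_in_ball[of x0 r] \<open>r > 0\<close> by blast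
    qed auto
    then obtain b where "b \<in> ball x0 r" "b \<in> frontier \<Omega>" by blast
    then have b: "dist x0 b < r" "b \<in> A \<or> b \<in> B" unfolding AB(5)[symmetric] by auto
    then show False using infdist_le[of b A x0] infdist_le[of b B x0] r by auto
  qed
  have descent: "r \<le> infdist z A \<or> r \<le> infdist z B" if z: "dist z x0 < min \<sigma> r" for z
  proof (rule ccontr)
    assume n: "\<not> (r \<le> infdist z A \<or> r \<le> infdist z B)"
    have z\<Omega>: "z \<in> \<Omega>" using ball z by (auto simp: dist_commute)
    show False
    proof (cases "infdist z A \<le> infdist z B")
      case True
      show False
        by (rule equidistant_descent[OF \<Omega>(1) AB(1-5) sep \<open>\<sigma> > 0\<close> min(1) r(1) z\<Omega> _ True])
          (use z n in auto)
    next
      case False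
      have BA: "B \<union> A = frontier \<Omega>" using AB(5) by blast
      show False
        by (rule equidistant_descent[OF \<Omega>(1) AB(2,1,4,3) BA sep' \<open>\<sigma> > 0\<close> min(2) r(2) z\<Omega>])
          (use z n False in auto)
    qed
  qed
  obtain y1 where y1: "y1 \<in> A" "r = dist x0 y1" using infdist_attains_inf[OF AB(1,3), of x0] r by metis
  obtain y2 where y2: "y2 \<in> B" "r = dist x0 y2" using infdist_attains_inf[OF AB(2,4), of x0] r by metis
  \<comment> \<open>the two touching points are antipodal\<close>
  \<comment> \<open>otherwise moving \<open>x0\<close> in the direction of this sum brings it closer to both touching points\<close>
  have antipodal: "(y1 - x0) + (y2 - x0) = 0"
  proof (rule ccontr)
    define u where "u = y1 - x0"
    define v where "v = y2 - x0"
    assume "(y1 - x0) + (y2 - x0) \<noteq> 0"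
    then have uv: "u + v \<noteq> 0" by (simp add: u_def v_def)
    have uu: "u \<bullet> u = r\<^sup>2" and vv: "v \<bullet> v = r\<^sup>2"
      using y1(2) y2(2) by (simp_all add: u_def v_def dist_norm norm_minus_commute power2_norm_eq_inner[symmetric])
    have n0: "norm (u + v) > 0" using uv by simp
    define m where "m = min \<sigma> r / norm (u + v)"
    define s where "s = min 1 m / 2"
    have "min \<sigma> r > 0" using \<open>\<sigma> > 0\<close> \<open>r > 0\<close> by simp
    then have "m > 0" using n0 by (simp add: m_def)
    then have s: "0 < s" "s < 1" "s < m" by (auto simp: s_def)
    define z where "z = x0 + s *\<^sub>R (u + v)"
    have "s * norm (u + v) < min \<sigma> r" using s(3) n0 by (simp only: m_def pos_less_divide_eq)
    then have dz: "dist z x0 < min \<sigma> r" using s(1) by (simp add: z_def dist_norm)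
    have sq: "(norm (w - s *\<^sub>R (u + v)))\<^sup>2 < r\<^sup>2"
      if w: "w \<bullet> w = r\<^sup>2" "2 * (w \<bullet> (u + v)) = (u + v) \<bullet> (u + v)" for w
    proof -
      have "(norm (w - s *\<^sub>R (u + v)))\<^sup>2 = w \<bullet> w - s * (2 * (w \<bullet> (u + v))) + s * s * ((u + v) \<bullet> (u + v))"
        by (simp only: power2_norm_eq_inner inner_diff_left inner_diff_right inner_scaleR_left inner_scaleR_right
            inner_commute[of "u + v" w]) (simp add: right_diff_distrib)
      also have "\<dots> = r\<^sup>2 - s * (1 - s) * ((u + v) \<bullet> (u + v))" by (simp only: w) (simp add: right_diff_distrib left_diff_distrib)
      also have "\<dots> < r\<^sup>2" using s(1,2) uv by simp
      finally show ?thesis .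
    qed
    have "2 * (u \<bullet> (u + v)) = (u + v) \<bullet> (u + v)" "2 * (v \<bullet> (u + v)) = (u + v) \<bullet> (u + v)"
      using uu vv by (simp_all add: inner_add_left inner_add_right inner_commute)
    with sq uu vv have "norm (u - s *\<^sub>R (u + v)) < r" "norm (v - s *\<^sub>R (u + v)) < r"
      using \<open>r > 0\<close> power_less_imp_less_base[of _ 2 r] by (metis less_imp_le)+
    moreover have "u - s *\<^sub>R (u + v) = y1 - z" "v - s *\<^sub>R (u + v) = y2 - z"
      by (simp_all add: u_def v_def z_def)
    ultimately have "dist z y1 < r" "dist z y2 < r" by (simp_all add: dist_norm norm_minus_commute)
    then have "infdist z A < r" "infdist z B < r"
      using infdist_le[OF y1(1), of z] infdist_le[OF y2(1), of z] by simp_all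
    then show False using descent[OF dz] by simp
  qed
  define e where "e = (x0 - y1) /\<^sub>R r"
  have e: "norm e = 1" using y1(2) \<open>r > 0\<close> by (simp add: e_def dist_norm)
  have y1e: "y1 + r *\<^sub>R e = x0" using \<open>r > 0\<close> by (simp add: e_def)
  have y2e: "y2 + r *\<^sub>R (- e) = x0"
  proof -
    have "r *\<^sub>R e = x0 - y1" using \<open>r > 0\<close> by (simp add: e_def)
    also have "\<dots> = y2 - x0" using antipodal by (simp add: algebra_simps)
    finally show ?thesis by simp
  qed
  have y1f: "y1 \<in> frontier \<Omega>" and y2f: "y2 \<in> frontier \<Omega>" using y1(1) y2(1) AB(5) by auto
  have k1: "1 \<le> k" using \<open>2 \<le> k\<close> order_trans[of 1 2 k] by (auto simp: one_le_numeral)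
  obtain U1 \<rho>1 where d1: "local_defining_function k \<Omega> y1 U1 \<rho>1" using boundary[OF y1f] by blast
  obtain U2 \<rho>2 where d2: "local_defining_function k \<Omega> y2 U2 \<rho>2" using boundary[OF y2f] by blast
  obtain E1 where E1: "principal_frame \<Omega> y1 E1 (\<kappa> y1)" using frame[OF y1f] by blast
  obtain E2 where E2: "principal_frame \<Omega> y2 E2 (\<kappa> y2)" using frame[OF y2f] by blast
  have b1: "ball (y1 + r *\<^sub>R e) r \<subseteq> \<Omega>" and b2: "ball (y2 + r *\<^sub>R (- e)) r \<subseteq> \<Omega>"
    using ball y1e y2e by simp_all
  have ne: "norm (- e) = 1" using e by simp
  note g1 = touching_ball_gradient[OF d1 k1 y1f b1 \<open>r > 0\<close> e]
  note g2 = touching_ball_gradient[OF d2 k1 y2f b2 \<open>r > 0\<close> ne]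
  define l1 where "l1 = norm (gradient \<rho>1 y1)"
  define l2 where "l2 = norm (gradient \<rho>2 y2)"
  have l: "l1 > 0" "l2 > 0"
    using defining_functionD(2,4)[OF d1] defining_functionD(2,4)[OF d2] by (auto simp: l1_def l2_def)
  define Q1 where "Q1 = hessian \<rho>1 y1"
  define Q2 where "Q2 = hessian \<rho>2 y2"
  have H1: "Q1 \<bullet> mat 1 - e \<bullet> (Q1 *v e) = - l1 * (\<Sum>i=1..CARD('n) - 1. \<kappa> y1 i)"
    unfolding Q1_def l1_def by (rule mean_curvature_inner[OF E1 d1 \<open>2 \<le> k\<close> y1f g1 e])
  have H2: "Q2 \<bullet> mat 1 - e \<bullet> (Q2 *v e) = - l2 * (\<Sum>i=1..CARD('n) - 1. \<kappa> y2 i)"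
    using mean_curvature_inner[OF E2 d2 \<open>2 \<le> k\<close> y2f g2 ne]
    by (simp add: Q2_def l2_def linear_neg[OF matrix_vector_mul_linear])
  note P = principal_frameD[OF E1 d1 \<open>2 \<le> k\<close> y1f]
  define T where "T = (\<lambda>i. E1 i y1)"
  have Te: "T i \<bullet> e = 0" if "i \<in> {1..CARD('n) - 1}" for i
  proof -
    have "l1 * (e \<bullet> T i) = gradient \<rho>1 y1 \<bullet> T i" by (subst g1) (simp add: l1_def)
    then show ?thesis using P(2)[OF that] l(1) by (simp add: T_def inner_commute)
  qed
  have TT: "T i \<bullet> T j = (if i = j then 1 else 0)"
    if "i \<in> {1..CARD('n) - 1}" "j \<in> {1..CARD('n) - 1}" for i j
    using P(3)[OF that] by (simp add: T_def)
  have tr: "(\<Sum>i=1..CARD('n) - 1. T i \<bullet> (Q *v T i)) = Q \<bullet> mat 1 - e \<bullet> (Q *v e)" for Q :: "real^'n^'n"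
    using inner_mat_1_orthonormal[OF e Te TT, of Q] by simp
  have "(\<Sum>i=1..CARD('n) - 1. (T i \<bullet> (Q1 *v T i)) / l1 + (T i \<bullet> (Q2 *v T i)) / l2)
      = (Q1 \<bullet> mat 1 - e \<bullet> (Q1 *v e)) / l1 + (Q2 \<bullet> mat 1 - e \<bullet> (Q2 *v e)) / l2"
    by (simp only: sum.distrib sum_divide_distrib[symmetric] tr)
  also have "\<dots> = - (\<Sum>i=1..CARD('n) - 1. \<kappa> y1 i) - (\<Sum>i=1..CARD('n) - 1. \<kappa> y2 i)"
    unfolding H1 H2 using l by simp
  also have "\<dots> < 0" using convex[OF y1f] convex[OF y2f] by simp
  finally have "\<exists>i\<in>{1..CARD('n) - 1}. (T i \<bullet> (Q1 *v T i)) / l1 + (T i \<bullet> (Q2 *v T i)) / l2 < 0"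
    by (meson not_le sum_nonneg)
  then obtain i where i: "i \<in> {1..CARD('n) - 1}"
    "(T i \<bullet> (Q1 *v T i)) / l1 + (T i \<bullet> (Q2 *v T i)) / l2 < 0" by blast
  define t where "t = T i"
  have t: "t \<bullet> e = 0" "norm t = 1" "t \<bullet> (- e) = 0"
    using Te[OF i(1)] TT[OF i(1) i(1)] by (simp_all add: t_def norm_eq_1)
  define a1 where "a1 = (t \<bullet> (Q1 *v t)) / l1"
  define a2 where "a2 = (t \<bullet> (Q2 *v t)) / l2"
  have a: "a1 + a2 < 0" using i(2) by (simp add: a1_def a2_def t_def)
  \<comment> \<open>the midpoint of the interval from \<open>a2 / 2\<close> to \<open>- a1 / 2\<close>: one boundary part lies above \<open>c s\<^sup>2\<close>, the other one above \<open>- c s\<^sup>2\<close>\<close>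
  define c where "c = (a2 - a1) / 4"
  have n1: "2 * norm (gradient \<rho>1 y1) * c + t \<bullet> (hessian \<rho>1 y1 *v t) < 0"
  proof -
    have "t \<bullet> (Q1 *v t) = l1 * a1" using l by (simp add: a1_def)
    moreover have "l1 * (2 * c + a1) < 0" using l(1) a by (intro mult_pos_neg) (auto simp: c_def field_simps)
    ultimately show ?thesis by (simp add: Q1_def[symmetric] l1_def[symmetric] algebra_simps)
  qed
  have n2: "2 * norm (gradient \<rho>2 y2) * (- c) + t \<bullet> (hessian \<rho>2 y2 *v t) < 0"
  proof -
    have "t \<bullet> (Q2 *v t) = l2 * a2" using l by (simp add: a2_def)
    moreover have "l2 * (2 * (- c) + a2) < 0" using l(2) a by (intro mult_pos_neg) (auto simp: c_def field_simps)
    ultimately show ?thesis by (simp add: Q2_def[symmetric] l2_def[symmetric] algebra_simps)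
  qed
  define \<eta> where "\<eta> = min \<sigma> r / 4"
  have \<eta>: "\<eta> > 0" "4 * \<eta> \<le> \<sigma>" "4 * \<eta> \<le> r" using \<open>\<sigma> > 0\<close> \<open>r > 0\<close> by (auto simp: \<eta>_def)
  obtain s1 where s1: "s1 > 0" "\<And>s. 0 < s \<Longrightarrow> s < s1 \<Longrightarrow>
      \<exists>\<tau>. c * s\<^sup>2 < \<tau> \<and> \<bar>\<tau>\<bar> < \<eta> \<and> y1 + s *\<^sub>R t + \<tau> *\<^sub>R e \<in> frontier \<Omega>"
    using boundary_above_parabola[OF d1 \<open>2 \<le> k\<close> y1f b1 \<open>r > 0\<close> e t(1,2) n1 \<eta>(1)] by blast
  obtain s2 where s2: "s2 > 0" "\<And>s. 0 < s \<Longrightarrow> s < s2 \<Longrightarrow>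
      \<exists>\<tau>. - c * s\<^sup>2 < \<tau> \<and> \<bar>\<tau>\<bar> < \<eta> \<and> y2 + s *\<^sub>R t + \<tau> *\<^sub>R (- e) \<in> frontier \<Omega>"
    using boundary_above_parabola[OF d2 \<open>2 \<le> k\<close> y2f b2 \<open>r > 0\<close> ne t(3,2) n2 \<eta>(1)] by blast
  define s where "s = min (min s1 s2) \<eta> / 2"
  have s: "0 < s" "s < s1" "s < s2" "s < \<eta>" using s1(1) s2(1) \<eta>(1) by (auto simp: s_def)
  obtain \<tau>1 where \<tau>1: "c * s\<^sup>2 < \<tau>1" "\<bar>\<tau>1\<bar> < \<eta>" "y1 + s *\<^sub>R t + \<tau>1 *\<^sub>R e \<in> frontier \<Omega>"
    using s1(2)[OF s(1,2)] by blast
  obtain \<tau>2 where \<tau>2: "- c * s\<^sup>2 < \<tau>2" "\<bar>\<tau>2\<bar> < \<eta>" "y2 + s *\<^sub>R t + \<tau>2 *\<^sub>R (- e) \<in> frontier \<Omega>"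
    using s2(2)[OF s(1,3)] by blast
  define p1 where "p1 = y1 + s *\<^sub>R t + \<tau>1 *\<^sub>R e"
  define p2 where "p2 = y2 + s *\<^sub>R t + \<tau>2 *\<^sub>R (- e)"
  have short: "norm (s *\<^sub>R t + q *\<^sub>R e) < 2 * \<eta>" if "\<bar>q\<bar> < \<eta>" for q
    using norm_triangle_ineq[of "s *\<^sub>R t" "q *\<^sub>R e"] t(2) e s(1,4) that by simp
  have p1A: "p1 \<in> A"
  proof (rule ccontr)
    assume "p1 \<notin> A"
    then have "\<sigma> \<le> dist y1 p1" using \<tau>1(3) AB(5) y1(1) by (intro sep) (auto simp: p1_def)
    also have "dist y1 p1 = norm (s *\<^sub>R t + \<tau>1 *\<^sub>R e)"
    proof -
      have "p1 - y1 = s *\<^sub>R t + \<tau>1 *\<^sub>R e" by (simp add: p1_def)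
      then show ?thesis by (metis dist_commute dist_norm)
    qed
    also have "\<dots> < 2 * \<eta>" by (rule short[OF \<tau>1(2)])
    finally show False using \<eta> by simp
  qed
  have p2B: "p2 \<in> B"
  proof (rule ccontr)
    assume "p2 \<notin> B"
    then have "\<sigma> \<le> dist p2 y2" using \<tau>2(3) AB(5) y2(1) by (intro sep) (auto simp: p2_def)
    also have "dist p2 y2 = norm (s *\<^sub>R t + (- \<tau>2) *\<^sub>R e)"
    proof -
      have "p2 - y2 = s *\<^sub>R t + (- \<tau>2) *\<^sub>R e" by (simp add: p2_def)
      then show ?thesis by (simp only: dist_norm)
    qed
    also have "\<dots> < 2 * \<eta>" using \<tau>2(2) by (intro short) simp
    finally show False using \<eta> by simp
  qed
  \<comment> \<open>the midpoint of \<open>p1\<close> and \<open>p2\<close>, whose distance is less than \<open>2 r\<close>\<close>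
  define z where "z = x0 + (s *\<^sub>R t + ((\<tau>1 - \<tau>2) / 2) *\<^sub>R e)"
  have b: "\<tau>1 < \<eta>" "- \<tau>1 < \<eta>" "\<tau>2 < \<eta>" "- \<tau>2 < \<eta>"
    using \<tau>1(2) \<tau>2(2) unfolding abs_less_iff by blast+
  have "\<bar>(\<tau>1 - \<tau>2) / 2\<bar> < \<eta>" 
  proof -
    have "\<tau>1 - \<tau>2 < 2 * \<eta>" "\<tau>2 - \<tau>1 < 2 * \<eta>" using b by linarith+
    then show ?thesis by (simp add: abs_less_iff)
  qed
  from short[OF this] have dz: "dist z x0 < min \<sigma> r" using \<eta> by (simp add: z_def dist_norm)
  define q where "q = r - (\<tau>1 + \<tau>2) / 2"
  have q: "\<bar>q\<bar> < r" 
  proof -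
    have "0 < \<tau>1 + \<tau>2" "\<tau>1 + \<tau>2 < 4 * r" using \<tau>1(1) \<tau>2(1) b \<eta> by linarith+
    then show ?thesis by (simp add: abs_less_iff q_def)
  qed
  have "z - p1 = q *\<^sub>R e"
  proof -
    have "z - p1 = r *\<^sub>R e + ((\<tau>1 - \<tau>2) / 2) *\<^sub>R e - \<tau>1 *\<^sub>R e"
      unfolding z_def p1_def y1e[symmetric] by simp
    also have "\<dots> = (r + (\<tau>1 - \<tau>2) / 2 - \<tau>1) *\<^sub>R e"
      by (simp only: scaleR_add_left scaleR_diff_left)
    also have "r + (\<tau>1 - \<tau>2) / 2 - \<tau>1 = q" by (simp add: q_def field_simps)
    finally show ?thesis .
  qed
  then have "dist z p1 < r" using q e by (simp add: dist_norm)
  moreover have "z - p2 = (- q) *\<^sub>R e"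
  proof -
    have "z - p2 = \<tau>2 *\<^sub>R e + ((\<tau>1 - \<tau>2) / 2) *\<^sub>R e - r *\<^sub>R e"
      unfolding z_def p2_def y2e[symmetric] by simp
    also have "\<dots> = (\<tau>2 + (\<tau>1 - \<tau>2) / 2 - r) *\<^sub>R e"
      by (simp only: scaleR_add_left scaleR_diff_left)
    also have "\<tau>2 + (\<tau>1 - \<tau>2) / 2 - r = - q" by (simp add: q_def field_simps)
    finally show ?thesis .
  qed
  then have "dist z p2 < r" using q e by (simp add: dist_norm)
  ultimately have "infdist z A < r" "infdist z B < r"
    using infdist_le[OF p1A, of z] infdist_le[OF p2B, of z] by simp_all
  then show False using descent[OF dz] by simp
qed

section \<open>Homogeneous integrands\<close>

lemma open_nonzero: "open (- {0::'a::real_normed_vector})"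
  by (rule open_Compl[OF closed_singleton])

lemma times_cont_diff_add:
  fixes f g :: "'a::real_normed_vector \<Rightarrow> real"
  assumes "open U"
  shows "times_cont_diff k U f \<Longrightarrow> times_cont_diff k U g \<Longrightarrow> times_cont_diff k U (\<lambda>x. f x + g x)"
proof (induction k arbitrary: f g)
  case 0
  then show ?case by (simp add: continuous_on_add)
next
  case (Suc k)
  have D: "((\<lambda>x. f x + g x) has_derivative (\<lambda>v. dir_deriv v f x + dir_deriv v g x)) (at x)" if "x \<in> U" for x
    using has_derivative_dir_deriv[OF Suc.prems(1) that] has_derivative_dir_deriv[OF Suc.prems(2) that]
    by (rule has_derivative_add)
  have "times_cont_diff k U (dir_deriv v (\<lambda>x. f x + g x))" for v
    using Suc.IH[of "dir_deriv v f" "dir_deriv v g"] Suc.prems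
    unfolding times_cont_diff_Suc_dir_deriv
    by (subst times_cont_diff_cong[OF \<open>open U\<close> dir_deriv_at[OF D]]) auto
  with D show ?case unfolding times_cont_diff_Suc_dir_deriv differentiable_def by blast
qed

lemma times_cont_diff_mult:
  fixes f g :: "'a::real_normed_vector \<Rightarrow> real"
  assumes "open U"
  shows "times_cont_diff k U f \<Longrightarrow> times_cont_diff k U g \<Longrightarrow> times_cont_diff k U (\<lambda>x. f x * g x)"
proof (induction k arbitrary: f g)
  case 0
  then show ?case by (simp add: continuous_on_mult)
next
  case (Suc k)
  have D: "((\<lambda>x. f x * g x) has_derivative (\<lambda>v. f x * dir_deriv v g x + dir_deriv v f x * g x)) (at x)" if "x \<in> U" for x
    using has_derivative_dir_deriv[OF Suc.prems(1) that] has_derivative_dir_deriv[OF Suc.prems(2) that]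
    by (rule has_derivative_mult)
  have low: "times_cont_diff k U f" "times_cont_diff k U g"
    using times_cont_diff_mono[OF Suc.prems(1), of k] times_cont_diff_mono[OF Suc.prems(2), of k] by simp_all
  have dd: "times_cont_diff k U (dir_deriv v f)" "times_cont_diff k U (dir_deriv v g)" for v
    using Suc.prems unfolding times_cont_diff_Suc_dir_deriv by blast+
  have "times_cont_diff k U (dir_deriv v (\<lambda>x. f x * g x))" for v
    using times_cont_diff_add[OF \<open>open U\<close> Suc.IH[OF low(1) dd(2)] Suc.IH[OF dd(1) low(2)]]
    by (subst times_cont_diff_cong[OF \<open>open U\<close> dir_deriv_at[OF D]]) auto
  with D show ?case unfolding times_cont_diff_Suc_dir_deriv differentiable_def by blast
qed

lemma times_cont_diff_const: "times_cont_diff k U (\<lambda>x. c)"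
  by (induction k arbitrary: c) (auto simp: frechet_derivative_const)

lemma times_cont_diff_bounded_linear:
  assumes "bounded_linear L" shows "times_cont_diff k U L"
proof (cases k)
  case 0
  then show ?thesis using assms by (simp add: linear_continuous_on)
next
  case (Suc k')
  have "(L has_derivative L) (at x)" for x using assms by (rule bounded_linear_imp_has_derivative)
  moreover from this have "frechet_derivative L (at x) = L" for x
    by (rule frechet_derivative_at[symmetric])
  ultimately show ?thesis
    using Suc by (auto simp: differentiable_def times_cont_diff_const)
qed

text \<open>The derivative \<open>- (p \<bullet> v) / \<bar>p\<bar>\<^sup>3\<close> is a product of a linear function and powers of the function itself, so
induction applies.\<close>

lemma times_cont_diff_inverse_norm:
  "times_cont_diff k (- {0}) (\<lambda>p::'a::real_inner. inverse (norm p))"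
proof (induction k)
  case 0
  show ?case by (auto intro!: continuous_intros)
next
  case (Suc k)
  have D: "((\<lambda>p. inverse (norm p)) has_derivative
      (\<lambda>v. (- 1) * (p \<bullet> v) * (inverse (norm p) * (inverse (norm p) * inverse (norm p))))) (at p)"
    if "p \<in> - {0}" for p :: 'a
  proof -
    have "(norm has_derivative (\<lambda>v. v \<bullet> sgn p)) (at p)" using that by (intro has_derivative_norm) auto
    from Deriv.has_derivative_inverse[OF _ this] that show ?thesis
      by (simp add: sgn_div_norm inner_commute divide_inverse mult.commute mult.left_commute)
  qed
  have op: "open (- {0::'a})" by (rule open_nonzero)
  have "times_cont_diff k (- {0}) (\<lambda>p::'a. (- 1) * (p \<bullet> v) * (inverse (norm p) * (inverse (norm p) * inverse (norm p))))" for v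
    by (intro times_cont_diff_mult[OF op] Suc times_cont_diff_const times_cont_diff_bounded_linear
        bounded_linear_inner_left)
  then have "times_cont_diff k (- {0}) (dir_deriv v (\<lambda>p::'a. inverse (norm p)))" for v
    by (subst times_cont_diff_cong[OF op dir_deriv_at[OF D]]) auto
  with D show ?case unfolding times_cont_diff_Suc_dir_deriv differentiable_def by blast
qed

lemma dir_deriv_slice:
  fixes \<Phi> :: "'a::real_normed_vector \<times> real \<Rightarrow> real"
  assumes "\<Phi> differentiable (at (q, s))"
  shows "((\<lambda>x. \<Phi> (x, s)) has_derivative (\<lambda>v. dir_deriv (v, 0) \<Phi> (q, s))) (at q)"
    and "dir_deriv v (\<lambda>x. \<Phi> (x, s)) q = dir_deriv (v, 0) \<Phi> (q, s)"
proof -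
  have "((\<lambda>x. (x, s)) has_derivative (\<lambda>v. (v, 0))) (at q)"
    by (auto intro!: derivative_eq_intros)
  moreover have "(\<Phi> has_derivative frechet_derivative \<Phi> (at (q, s))) (at (q, s))"
    using assms by (simp add: frechet_derivative_works)
  ultimately show D: "((\<lambda>x. \<Phi> (x, s)) has_derivative (\<lambda>v. dir_deriv (v, 0) \<Phi> (q, s))) (at q)"
    using diff_chain_at[of "\<lambda>x. (x, s)" "\<lambda>v. (v, 0)" q \<Phi>] by (simp add: o_def dir_deriv_def)
  show "dir_deriv v (\<lambda>x. \<Phi> (x, s)) q = dir_deriv (v, 0) \<Phi> (q, s)" by (rule dir_deriv_at[OF D])
qed

text \<open>The derivatives in the first \<open>n\<close> variables are those of a slice, which makes the results on functions
on \<open>real^'n\<close> available.\<close>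

lemma hessian_slice:
  fixes \<Phi> :: "(real^'n) \<times> real \<Rightarrow> real"
  assumes "open U" "times_cont_diff 2 U \<Phi>" "(q, s) \<in> U"
  shows "hessian (\<lambda>x. \<Phi> (x, s)) q = hessian_p \<Phi> (q, s)"
proof -
  have op: "open {x. (x, s) \<in> U}" by (rule times_cont_diff_slice(2)[OF assms(1,2)])
  have d1: "\<Phi> differentiable (at (x, s))" if "(x, s) \<in> U" for x
    using times_cont_diff_2D(1)[OF assms(2)] that by simp
  have d2: "dir_deriv v \<Phi> differentiable (at (x, s))" if "(x, s) \<in> U" for v x
    using times_cont_diff_2_dir_deriv[OF assms(2), of v] that by simp
  have "dir_deriv w (dir_deriv v (\<lambda>x. \<Phi> (x, s))) q = dir_deriv (w, 0) (dir_deriv (v, 0) \<Phi>) (q, s)" for v w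
  proof -
    have "((\<lambda>x. dir_deriv (v, 0) \<Phi> (x, s)) has_derivative (\<lambda>w. dir_deriv (w, 0) (dir_deriv (v, 0) \<Phi>) (q, s))) (at q)"
      by (rule dir_deriv_slice(1)[OF d2[OF assms(3)]])
    then have "(dir_deriv v (\<lambda>x. \<Phi> (x, s)) has_derivative (\<lambda>w. dir_deriv (w, 0) (dir_deriv (v, 0) \<Phi>) (q, s))) (at q)"
      by (rule has_derivative_transform_within_open[OF _ op]) (use assms(3) dir_deriv_slice(2)[OF d1] in auto)
    then show ?thesis by (rule dir_deriv_at)
  qed
  moreover have "deriv_p j \<Phi> = dir_deriv (axis j 1, 0) \<Phi>" for j by (simp add: fun_eq_iff deriv_p_def)
  ultimately show ?thesis by (simp add: hessian_def hessian_p_def deriv_p_def vec_eq_iff)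
qed

lemma continuous_on_hessian_p:
  fixes \<Phi> :: "(real^'n) \<times> real \<Rightarrow> real"
  assumes "times_cont_diff 2 U \<Phi>"
  shows "continuous_on U (hessian_p \<Phi>)"
proof -
  have "continuous_on U (dir_deriv w (dir_deriv v \<Phi>))" for v w
    using times_cont_diff_2_dir_deriv[OF assms, of v]
    unfolding times_cont_diff_Suc_dir_deriv times_cont_diff.simps(1) by blast
  moreover have "deriv_p j \<Phi> = dir_deriv (axis j 1, 0) \<Phi>" for j and \<Phi> :: "(real^'n) \<times> real \<Rightarrow> real"
    by (simp add: fun_eq_iff deriv_p_def)
  ultimately show ?thesis
    unfolding hessian_p_def[abs_def] by (intro continuous_on_vec_lambda) simp
qed

text \<open>Differentiation lowers the degree of homogeneity by one.\<close>

lemma dir_deriv_homogeneous: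
  fixes \<Phi> :: "'a::real_normed_vector \<Rightarrow> real"
  assumes diff: "\<And>p. p \<noteq> 0 \<Longrightarrow> \<Phi> differentiable (at p)" and hom: "\<And>p. p \<noteq> 0 \<Longrightarrow> \<Phi> (r *\<^sub>R p) = b * \<Phi> p"
    and "r > 0" "p \<noteq> 0"
  shows "r * dir_deriv v \<Phi> (r *\<^sub>R p) = b * dir_deriv v \<Phi> p"
proof -
  have rp: "r *\<^sub>R p \<noteq> 0" using assms(3,4) by simp
  have D: "(\<Phi> has_derivative (\<lambda>v. dir_deriv v \<Phi> (r *\<^sub>R p))) (at (r *\<^sub>R p))"
    "(\<Phi> has_derivative (\<lambda>v. dir_deriv v \<Phi> p)) (at p)"
    using diff[OF rp] diff[OF \<open>p \<noteq> 0\<close>] by (simp_all add: dir_deriv_def frechet_derivative_works)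
  have "((\<lambda>p. r *\<^sub>R p) has_derivative (\<lambda>v. r *\<^sub>R v)) (at p)" by (auto intro!: derivative_eq_intros)
  from diff_chain_at[OF this D(1)]
  have 1: "((\<lambda>p. \<Phi> (r *\<^sub>R p)) has_derivative (\<lambda>v. dir_deriv (r *\<^sub>R v) \<Phi> (r *\<^sub>R p))) (at p)" by (simp add: o_def)
  have 2: "((\<lambda>p. b * \<Phi> p) has_derivative (\<lambda>v. b * dir_deriv v \<Phi> p)) (at p)"
    using D(2) by (auto intro!: derivative_eq_intros)
  have "((\<lambda>p. b * \<Phi> p) has_derivative (\<lambda>v. dir_deriv (r *\<^sub>R v) \<Phi> (r *\<^sub>R p))) (at p)"
    by (rule has_derivative_transform_within_open[OF 1, of "- {0}"]) (use \<open>p \<noteq> 0\<close> hom in auto)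
  from has_derivative_unique[OF this 2]
  have "dir_deriv (r *\<^sub>R v) \<Phi> (r *\<^sub>R p) = b * dir_deriv v \<Phi> p" by (rule fun_cong)
  moreover have "dir_deriv (r *\<^sub>R v) \<Phi> (r *\<^sub>R p) = r * dir_deriv v \<Phi> (r *\<^sub>R p)"
    using linear_scale[OF has_derivative_linear[OF D(1)], of r v] by simp
  ultimately show ?thesis by simp
qed

lemma homogeneous_integrandD:
  assumes "homogeneous_integrand \<Phi>"
  shows "norm p = 1 \<Longrightarrow> \<Phi> p > 0" "r > 0 \<Longrightarrow> \<Phi> (r *\<^sub>R p) = r * \<Phi> p" "times_cont_diff m (- {0}) \<Phi>"
proof -
  show "norm p = 1 \<Longrightarrow> \<Phi> p > 0" "r > 0 \<Longrightarrow> \<Phi> (r *\<^sub>R p) = r * \<Phi> p"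
    using assms unfolding homogeneous_integrand_def by blast+
  have "Ck_on \<infinity> (- {0}) \<Phi>" using assms unfolding homogeneous_integrand_def by blast
  then show "times_cont_diff m (- {0}) \<Phi>" by (rule Ck_on_times_cont_diff[OF _ open_nonzero]) simp
qed

lemma deriv_p_homogeneous:
  fixes F :: "(real^'n) \<times> real \<Rightarrow> real"
  assumes F: "homogeneous_integrand F" and "p \<noteq> 0" "r > 0"
  shows "dir_deriv v F (r *\<^sub>R p) = dir_deriv v F p"
    and "hessian_p F (r *\<^sub>R p) = (1 / r) *\<^sub>R hessian_p F p"
proof -
  note H = homogeneous_integrandD[OF F]
  have d1: "F differentiable (at p)" if "p \<noteq> 0" for p
    using H(3)[of "Suc 0"] that by simp
  have first: "dir_deriv v F (r *\<^sub>R p) = dir_deriv v F p" if "p \<noteq> 0" for v p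
    using dir_deriv_homogeneous[of F r r p v] d1 H(2)[OF \<open>r > 0\<close>] \<open>r > 0\<close> that by simp
  then show "dir_deriv v F (r *\<^sub>R p) = dir_deriv v F p" using \<open>p \<noteq> 0\<close> .
  have d2: "dir_deriv v F differentiable (at p)" if "p \<noteq> 0" for v p
    using times_cont_diff_2_dir_deriv[OF H(3), of v] that by simp
  have "r * dir_deriv w (dir_deriv v F) (r *\<^sub>R p) = dir_deriv w (dir_deriv v F) p" for v w
    using dir_deriv_homogeneous[of "dir_deriv v F" r 1 p w] d2 first \<open>r > 0\<close> \<open>p \<noteq> 0\<close> by simp
  then have "dir_deriv w (dir_deriv v F) (r *\<^sub>R p) = dir_deriv w (dir_deriv v F) p / r" for v w
    using \<open>r > 0\<close> by (simp add: field_simps)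
  moreover have "deriv_p j F = dir_deriv (axis j 1, 0) F" for j by (simp add: fun_eq_iff deriv_p_def)
  ultimately show "hessian_p F (r *\<^sub>R p) = (1 / r) *\<^sub>R hessian_p F p"
    by (simp add: hessian_p_def deriv_p_def vec_eq_iff)
qed

lemma norm_Pair_orthogonal:
  fixes q T :: "real^'n"
  assumes "q \<bullet> T = 0" "norm T = 1"
  shows "norm (q + s *\<^sub>R T, t) = sqrt ((norm (q, t))\<^sup>2 + s\<^sup>2)"
proof -
  have "T \<bullet> T = 1" using assms by (simp add: norm_eq_1)
  then have "(norm (q + s *\<^sub>R T))\<^sup>2 = (norm q)\<^sup>2 + s\<^sup>2"
    using assms by (simp only: power2_norm_eq_inner)
      (simp add: inner_add_left inner_add_right inner_commute power2_eq_square)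
  then show ?thesis by (simp add: norm_Pair)
qed

lemma on_direction_eq:
  assumes "homogeneous_integrand F" "p \<noteq> 0"
  shows "on_direction F p = F p * inverse (norm p)"
  using homogeneous_integrandD(2)[OF assms(1), of "inverse (norm p)" p] assms(2)
  by (simp add: on_direction_def mult.commute)

lemma times_cont_diff_on_direction:
  fixes F :: "(real^'n) \<times> real \<Rightarrow> real"
  assumes "homogeneous_integrand F"
  shows "times_cont_diff k (- {0}) (on_direction F)"
proof (subst times_cont_diff_cong[of "- {0}" "on_direction F" "\<lambda>p. F p * inverse (norm p)"])
  show "times_cont_diff k (- {0}) (\<lambda>p. F p * inverse (norm p))"
    by (intro times_cont_diff_mult[OF open_nonzero] times_cont_diff_inverse_norm homogeneous_integrandD(3)[OF assms])
qed (auto simp: on_direction_eq[OF assms] open_nonzero)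

lemma line_slice:
  fixes \<Phi> :: "(real^'n) \<times> real \<Rightarrow> real" and q T :: "real^'n" and t :: real
  assumes "open U" "times_cont_diff 2 U \<Phi>"
  defines "m1 \<equiv> \<lambda>s. gradient (\<lambda>x. \<Phi> (x, t)) (q + s *\<^sub>R T) \<bullet> T"
  shows "(q + s *\<^sub>R T, t) \<in> U \<Longrightarrow> ((\<lambda>s. \<Phi> (q + s *\<^sub>R T, t)) has_real_derivative m1 s) (at s)"
    and "(q, t) \<in> U \<Longrightarrow> (m1 has_real_derivative T \<bullet> (hessian_p \<Phi> (q, t) *v T)) (at 0)"
proof -
  note sl = times_cont_diff_slice[OF assms(1,2), of t]
  show "((\<lambda>s. \<Phi> (q + s *\<^sub>R T, t)) has_real_derivative m1 s) (at s)" if "(q + s *\<^sub>R T, t) \<in> U"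
    unfolding m1_def using line_derivative[OF times_cont_diff_2D(1)[OF sl(1)], of q s T] that by simp
  show "(m1 has_real_derivative T \<bullet> (hessian_p \<Phi> (q, t) *v T)) (at 0)" if "(q, t) \<in> U"
    unfolding m1_def using line_second_derivative[OF sl(2,1), of q 0 T T] that
    by (simp add: hessian_slice[OF assms(1,2) that] inner_commute)
qed

text \<open>Computes the second derivative of \<open>F (p) = \<bar>p\<bar> F (p / \<bar>p\<bar>)\<close> in a direction orthogonal to \<open>p\<close>. Along the line
\<open>p + s T\<close> the norm is \<open>sqrt (\<bar>p\<bar>\<^sup>2 + s\<^sup>2)\<close>, so its first derivative vanishes at \<open>s = 0\<close> and with it the mixed term that would
involve the first derivatives of \<open>F\<close>.\<close>

lemma hessian_p_orthogonal:
  fixes F :: "(real^'n) \<times> real \<Rightarrow> real"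
  assumes F: "homogeneous_integrand F" and p: "(q, t) \<noteq> 0" and T: "q \<bullet> T = 0" "norm T = 1"
  shows "norm (q, t) * (T \<bullet> (hessian_p F (q, t) *v T))
    = on_direction F (q, t) + (norm (q, t))\<^sup>2 * (T \<bullet> (hessian_p (on_direction F) (q, t) *v T))"
proof -
  define n where "n = norm (q, t)"
  have n: "n > 0" using p by (simp add: n_def)
  have op: "open (- {0 :: (real^'n) \<times> real})" by (rule open_nonzero)
  have C: "times_cont_diff 2 (- {0}) F" "times_cont_diff 2 (- {0}) (on_direction F)"
    using homogeneous_integrandD(3)[OF F] times_cont_diff_on_direction[OF F] by blast+
  have nrm: "norm (q + s *\<^sub>R T, t) = sqrt (n\<^sup>2 + s\<^sup>2)" for s
    unfolding n_def by (rule norm_Pair_orthogonal[OF T])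
  have pos: "n\<^sup>2 + s\<^sup>2 > 0" for s using n by (simp add: add_pos_nonneg)
  have ne: "(q + s *\<^sub>R T, t) \<in> - {0}" for s
  proof -
    have "norm (q + s *\<^sub>R T, t) > 0" unfolding nrm using pos[of s] by (simp only: real_sqrt_gt_0_iff)
    then show ?thesis by auto
  qed
  have ne0: "(q, t) \<in> - {0}" using p by simp
  define f1 where "f1 = (\<lambda>s. gradient (\<lambda>x. F (x, t)) (q + s *\<^sub>R T) \<bullet> T)"
  define h1 where "h1 = (\<lambda>s. gradient (\<lambda>x. on_direction F (x, t)) (q + s *\<^sub>R T) \<bullet> T)"
  have f: "((\<lambda>s. F (q + s *\<^sub>R T, t)) has_real_derivative f1 s) (at s)"
    "(f1 has_real_derivative T \<bullet> (hessian_p F (q, t) *v T)) (at 0)" for s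
    unfolding f1_def by (rule line_slice(1)[OF op C(1) ne], rule line_slice(2)[OF op C(1) ne0])
  have h: "((\<lambda>s. on_direction F (q + s *\<^sub>R T, t)) has_real_derivative h1 s) (at s)"
    "(h1 has_real_derivative T \<bullet> (hessian_p (on_direction F) (q, t) *v T)) (at 0)" for s
    unfolding h1_def by (rule line_slice(1)[OF op C(2) ne], rule line_slice(2)[OF op C(2) ne0])
  define N where "N = (\<lambda>s. sqrt (n\<^sup>2 + s\<^sup>2))"
  have nN: "norm (q + s *\<^sub>R T, t) = N s" for s by (simp only: nrm N_def)
  have Npos: "N s > 0" for s using pos by (simp add: N_def)
  have N0: "N 0 = n" using n by (simp add: N_def)
  have Nd: "(N has_real_derivative s / N s) (at s)" for s
    unfolding N_def using pos[of s]
    by (auto intro!: derivative_eq_intros simp: field_simps)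
  have FN: "F (q + s *\<^sub>R T, t) = N s * on_direction F (q + s *\<^sub>R T, t)" for s
    using on_direction_eq[OF F, of "(q + s *\<^sub>R T, t)"] ne[of s] Npos[of s]
    by (simp add: nN)
  have "f1 s = (s / N s) * on_direction F (q + s *\<^sub>R T, t) + N s * h1 s" for s
  proof (rule DERIV_unique[OF f(1)])
    show "((\<lambda>s. F (q + s *\<^sub>R T, t)) has_real_derivative
        (s / N s) * on_direction F (q + s *\<^sub>R T, t) + N s * h1 s) (at s)"
      unfolding FN using Nd h(1) by (auto intro!: derivative_eq_intros simp: mult.commute)
  qed
  then have f1: "f1 = (\<lambda>s. (s / N s) * on_direction F (q + s *\<^sub>R T, t) + N s * h1 s)" by (rule ext)
  have "(f1 has_real_derivative on_direction F (q, t) / n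
      + n * (T \<bullet> (hessian_p (on_direction F) (q, t) *v T))) (at 0)"
  proof -
    have "((\<lambda>s. s / N s) has_real_derivative 1 / n) (at 0)"
      using Nd[of 0] n by (auto intro!: derivative_eq_intros simp: N0)
    from DERIV_add[OF DERIV_mult[OF this h(1)[of 0]] DERIV_mult[OF Nd[of 0] h(2)]]
    show ?thesis unfolding f1 by (simp add: N0 algebra_simps)
  qed
  from DERIV_unique[OF f(2) this]
  have "n * (T \<bullet> (hessian_p F (q, t) *v T))
      = n * (on_direction F (q, t) / n + n * (T \<bullet> (hessian_p (on_direction F) (q, t) *v T)))" by simp
  also have "\<dots> = on_direction F (q, t) + n\<^sup>2 * (T \<bullet> (hessian_p (on_direction F) (q, t) *v T))"
    using n by (simp add: distrib_left power2_eq_square)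
  finally show ?thesis by (simp add: n_def)
qed

text \<open>Euler's relation for the gradient, which is homogeneous of degree zero.\<close>

lemma hessian_p_kernel:
  fixes F :: "(real^'n) \<times> real \<Rightarrow> real"
  assumes F: "homogeneous_integrand F" and q: "q \<noteq> 0"
  shows "hessian_p F (q, 0) *v q = 0"
proof -
  have op: "open (- {0 :: (real^'n) \<times> real})" by (rule open_nonzero)
  have C2: "times_cont_diff 2 (- {0}) F" using homogeneous_integrandD(3)[OF F] .
  have p: "(q, 0::real) \<in> - {0}" "(q, 0::real) \<noteq> 0" using q by (auto simp: prod_eq_iff)
  have op': "open {x. (x, 0::real) \<in> - {0 :: (real^'n) \<times> real}}" by (rule times_cont_diff_slice(2)[OF op C2])
  note sl = times_cont_diff_slice(1)[OF op C2, of 0]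
  have d1: "F differentiable (at p)" if "p \<noteq> 0" for p
    using homogeneous_integrandD(3)[OF F, of "Suc 0"] that by simp
  have grad: "gradient (\<lambda>x. F (x, 0)) (r *\<^sub>R q) = gradient (\<lambda>x. F (x, 0)) q" if "r > 0" for r
  proof -
    have "(r *\<^sub>R q, 0::real) = r *\<^sub>R (q, 0)" by simp
    then have "dir_deriv (v, 0) F (r *\<^sub>R q, 0) = dir_deriv (v, 0) F (q, 0)" for v
      using deriv_p_homogeneous(1)[OF F p(2) that, of "(v, 0)"] by simp
    moreover have "(r *\<^sub>R q, 0::real) \<noteq> 0" using q that by (simp add: prod_eq_iff)
    ultimately show ?thesis
      using dir_deriv_slice(2)[OF d1] p(2) by (simp add: gradient_def)
  qed
  have "((\<lambda>s. gradient (\<lambda>x. F (x, 0)) (q + s *\<^sub>R q) \<bullet> k) has_real_derivative (hessian_p F (q, 0) *v q) \<bullet> k) (at 0)" for k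
    using line_second_derivative[OF op' sl, of q 0 q k] p
    by (simp add: hessian_slice[OF op C2 p(1)])
  moreover have "((\<lambda>s. gradient (\<lambda>x. F (x, 0)) (q + s *\<^sub>R q) \<bullet> k) has_real_derivative 0) (at 0)" for k
  proof (rule has_field_derivative_transform_within_open[of "\<lambda>s. gradient (\<lambda>x. F (x, 0)) q \<bullet> k" _ _ "{-1<..}"])
    show "gradient (\<lambda>x. F (x, 0)) q \<bullet> k = gradient (\<lambda>x. F (x, 0)) (q + s *\<^sub>R q) \<bullet> k" if "s \<in> {-1<..}" for s
      using grad[of "1 + s"] that by (simp add: scaleR_add_left)
  qed auto
  ultimately have "(hessian_p F (q, 0) *v q) \<bullet> k = 0" for k
    using DERIV_unique by blast
  then show ?thesis using inner_eq_zero_iff by blast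
qed

text \<open>Convexity along the line \<open>p + s h\<close> makes \<open>- F (p + s h) - F (p - s h)\<close> maximal at \<open>s = 0\<close>.\<close>

lemma hessian_p_psd:
  fixes F :: "(real^'n) \<times> real \<Rightarrow> real"
  assumes F: "homogeneous_integrand F" and "convex_on UNIV F" and p: "p \<noteq> 0"
  shows "0 \<le> h \<bullet> (hessian_p F p *v h)"
proof -
  obtain q t where qt: "p = (q, t)" by (cases p)
  have op: "open (- {0 :: (real^'n) \<times> real})" by (rule open_nonzero)
  have C2: "times_cont_diff 2 (- {0}) F" using homogeneous_integrandD(3)[OF F] .
  have "open ((\<lambda>s. (q + s *\<^sub>R h, t)) -` (- {0}))" by (intro open_vimage op continuous_intros)
  moreover have "0 \<in> (\<lambda>s. (q + s *\<^sub>R h, t)) -` (- {0})" using p qt by simp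
  ultimately obtain d where d: "d > 0" "ball 0 d \<subseteq> (\<lambda>s. (q + s *\<^sub>R h, t)) -` (- {0})"
    using open_contains_ball by blast
  have inU: "(q + s *\<^sub>R h, t) \<in> - {0}" if "\<bar>s\<bar> < d" for s
  proof -
    have "s \<in> ball 0 d" using that by simp
    then show ?thesis using d(2) by blast
  qed
  define f where "f = (\<lambda>s. F (q + s *\<^sub>R h, t))"
  define f1 where "f1 = (\<lambda>s. gradient (\<lambda>x. F (x, t)) (q + s *\<^sub>R h) \<bullet> h)"
  have fd: "(f has_real_derivative f1 s) (at s)" if "\<bar>s\<bar> < d" for s
    unfolding f_def f1_def by (rule line_slice(1)[OF op C2 inU[OF that]])
  have f1d: "(f1 has_real_derivative h \<bullet> (hessian_p F p *v h)) (at 0)"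
    unfolding f1_def qt by (rule line_slice(2)[OF op C2]) (use p qt in simp)
  have conv: "2 * f 0 \<le> f s + f (- s)" for s
  proof -
    have "F ((1/2) *\<^sub>R (q + s *\<^sub>R h, t) + (1/2) *\<^sub>R (q + (- s) *\<^sub>R h, t))
        \<le> (1/2) * F (q + s *\<^sub>R h, t) + (1/2) * F (q + (- s) *\<^sub>R h, t)"
      using convex_onD[OF assms(2), of "1/2" "(q + s *\<^sub>R h, t)" "(q + (- s) *\<^sub>R h, t)"] by simp
    moreover have "(1/2) *\<^sub>R (q + s *\<^sub>R h, t) + (1/2) *\<^sub>R (q + (- s) *\<^sub>R h, t) = (q, t)"
      by (simp add: algebra_simps scaleR_add_left[symmetric])
    ultimately show ?thesis by (simp add: f_def)
  qed
  have "- (h \<bullet> (hessian_p F p *v h)) - (h \<bullet> (hessian_p F p *v h)) \<le> 0"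
  proof (rule second_derivative_test_max[OF d(1), of "\<lambda>s. - f s - f (- s)" "\<lambda>s. - f1 s + f1 (- s)"])
    show "((\<lambda>s. - f s - f (- s)) has_real_derivative - f1 s + f1 (- s)) (at s)" if "\<bar>s\<bar> < d" for s
    proof -
      have "((\<lambda>s. f (- s)) has_real_derivative f1 (- s) * (- 1)) (at s)"
        using that by (intro DERIV_chain'[of uminus] fd) (auto intro!: derivative_eq_intros)
      with fd[OF that] show ?thesis by (auto intro!: derivative_eq_intros)
    qed
    have "((\<lambda>s. f1 (- s)) has_real_derivative (h \<bullet> (hessian_p F p *v h)) * (- 1)) (at 0)"
      using f1d by (intro DERIV_chain'[of uminus]) (auto intro!: derivative_eq_intros)
    with f1d show "((\<lambda>s. - f1 s + f1 (- s)) has_real_derivative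
        - (h \<bullet> (hessian_p F p *v h)) - (h \<bullet> (hessian_p F p *v h))) (at 0)"
      by (auto intro!: derivative_eq_intros)
    show "- f s - f (- s) \<le> - f 0 - f (- 0)" for s using conv[of s] by simp
  qed simp
  then show ?thesis by simp
qed

section \<open>The operator of the anisotropic flow\<close>

text \<open>Homogeneous of degree zero, as \<open>G\<close> has degree one and the second derivatives of \<open>F\<close> have degree minus
one.\<close>

definition flow_operator ::
    "((real^'n) \<times> real \<Rightarrow> real) \<Rightarrow> ((real^'n) \<times> real \<Rightarrow> real) \<Rightarrow> (real^'n) \<times> real \<Rightarrow> real^'n^'n"
  where "flow_operator F G p = G p *\<^sub>R hessian_p F p"

lemma frobenius_norm_eq_norm: "frobenius_norm (A :: real^'n^'n) = norm A"
proof -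
  have "trace (transpose A ** A) = (\<Sum>i\<in>UNIV. \<Sum>j\<in>UNIV. A $ j $ i * A $ j $ i)"
    by (simp add: trace_def transpose_def matrix_matrix_mult_def)
  also have "\<dots> = A \<bullet> A" by (subst sum.swap) (simp add: inner_vec_def)
  finally show ?thesis by (simp add: frobenius_norm_def norm_eq_sqrt_inner)
qed

lemma structural_boundsD:
  assumes "structural_bounds F G g0 G0 m0 M0 m1 m2"
  shows "0 < g0" "0 < m0" "0 < m1" "0 < m2"
    and "p \<noteq> 0 \<Longrightarrow> g0 \<le> on_direction G p" "p \<noteq> 0 \<Longrightarrow> on_direction G p \<le> G0"
    and "p \<noteq> 0 \<Longrightarrow> m0 \<le> on_direction F p" "p \<noteq> 0 \<Longrightarrow> on_direction F p \<le> M0"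
    and "p \<noteq> 0 \<Longrightarrow> frobenius_norm (hessian_p (on_direction F) p) < m2 / (norm p)\<^sup>2"
  using assms unfolding structural_bounds_def by blast+

lemma flow_operator_tangential_bounds:
  fixes F G :: "(real^'n) \<times> real \<Rightarrow> real"
  assumes F: "homogeneous_integrand F" and G: "homogeneous_integrand G"
    and sb: "structural_bounds F G g0 G0 m0 M0 m1 m2" and "m2 \<le> m0"
    and p: "p \<noteq> 0" and T: "fst p \<bullet> T = 0" "norm T = 1"
  shows "g0 * (m0 - m2) \<le> T \<bullet> (flow_operator F G p *v T)"
    and "T \<bullet> (flow_operator F G p *v T) \<le> G0 * (M0 + m2)"
proof -
  note S = structural_boundsD[OF sb]
  define n where "n = norm p"
  have n: "n > 0" using p by (simp add: n_def)
  define h where "h = T \<bullet> (hessian_p (on_direction F) p *v T)"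
  have "\<bar>h\<bar> \<le> norm T * norm (hessian_p (on_direction F) p *v T)"
    unfolding h_def by (rule Cauchy_Schwarz_ineq2)
  also have "\<dots> \<le> norm (hessian_p (on_direction F) p)"
    using norm_matrix_vector_mult_le[of "hessian_p (on_direction F) p" T] T(2) by simp
  also have "\<dots> \<le> m2 / n\<^sup>2" using S(9)[OF p] by (simp add: frobenius_norm_eq_norm n_def)
  finally have "\<bar>h\<bar> * n\<^sup>2 \<le> m2" using n by (simp add: pos_le_divide_eq)
  then have h: "\<bar>n\<^sup>2 * h\<bar> \<le> m2" by (simp add: abs_mult mult.commute)
  have Gn: "G p = n * on_direction G p"
    using on_direction_eq[OF G p] n by (simp add: n_def)
  have form: "n * (T \<bullet> (hessian_p F p *v T)) = on_direction F p + n\<^sup>2 * h"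
    using hessian_p_orthogonal[OF F, of "fst p" "snd p" T] p T by (simp add: n_def h_def)
  have "T \<bullet> (flow_operator F G p *v T) = G p * (T \<bullet> (hessian_p F p *v T))"
    by (simp add: flow_operator_def scaleR_matrix_vector_assoc[symmetric])
  also have "\<dots> = on_direction G p * (n * (T \<bullet> (hessian_p F p *v T)))"
    by (simp add: Gn)
  finally have eq: "T \<bullet> (flow_operator F G p *v T) = on_direction G p * (on_direction F p + n\<^sup>2 * h)"
    by (simp only: form)
  have "m0 - m2 \<le> on_direction F p + n\<^sup>2 * h" "on_direction F p + n\<^sup>2 * h \<le> M0 + m2"
    using S(7,8)[OF p] h by (simp_all add: abs_le_iff)
  then show "g0 * (m0 - m2) \<le> T \<bullet> (flow_operator F G p *v T)"
    "T \<bullet> (flow_operator F G p *v T) \<le> G0 * (M0 + m2)"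
    unfolding eq using S(1) S(5,6)[OF p] \<open>m2 \<le> m0\<close> by (auto intro!: mult_mono)
qed

text \<open>The trace is bounded below by the diffusion in a single direction orthogonal to \<open>fst p\<close>, which exists in
dimension at least two.\<close>

lemma anisotropic_flow_operator:
  fixes F G :: "(real^'n) \<times> real \<Rightarrow> real"
  assumes "CARD('n) \<ge> 2" and F: "homogeneous_integrand F" "convex_on UNIV F" and G: "homogeneous_integrand G"
    and sb: "structural_bounds F G g0 G0 m0 M0 m1 m2" and "m2 < m0"
  shows "anisotropic_operator (flow_operator F G) (g0 * (m0 - m2))"
proof
  let ?a = "flow_operator F G"
  note S = structural_boundsD[OF sb]
  have C: "times_cont_diff 2 (- {0}) F" "times_cont_diff 0 (- {0}) G"
    using homogeneous_integrandD(3)[OF F(1)] homogeneous_integrandD(3)[OF G] by blast+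
  show "continuous_on (- {0}) ?a"
    unfolding flow_operator_def[abs_def] using C(2)
    by (intro continuous_on_scaleR continuous_on_hessian_p[OF C(1)]) simp
  show "g0 * (m0 - m2) > 0" using S(1) \<open>m2 < m0\<close> by simp
  fix p :: "(real^'n) \<times> real" assume p: "p \<noteq> 0"
  show "?a (r *\<^sub>R p) = ?a p" if "r > 0" for r
    using deriv_p_homogeneous(2)[OF F(1) p that] homogeneous_integrandD(2)[OF G that] that
    by (simp add: flow_operator_def)
  have op: "open (- {0 :: (real^'n) \<times> real})" by (rule open_nonzero)
  obtain q t where qt: "p = (q, t)" by (cases p)
  have pU: "(q, t) \<in> - {0}" using p qt by simp
  have "transpose (hessian_p F p) = hessian_p F p"
    using transpose_hessian[OF times_cont_diff_slice(2,1)[OF op C(1), of t], of q] pU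
    by (simp add: hessian_slice[OF op C(1) pU] qt)
  then show sym: "transpose (?a p) = ?a p"
    by (simp add: flow_operator_def transpose_def vec_eq_iff)
  have "G p = on_direction G p * norm p" using on_direction_eq[OF G p] p by simp
  moreover have "on_direction G p > 0" using S(1) S(5)[OF p] by linarith
  ultimately have "G p > 0" using p by simp
  then show psd: "0 \<le> h \<bullet> (?a p *v h)" for h
    using hessian_p_psd[OF F p, of h]
    by (simp add: flow_operator_def scaleR_matrix_vector_assoc[symmetric])
  obtain v where v: "v \<noteq> 0" "orthogonal q v"
    using orthogonal_to_vector_exists[of q] \<open>CARD('n) \<ge> 2\<close> by auto
  define T where "T = v /\<^sub>R norm v"
  have T: "norm T = 1" "fst p \<bullet> T = 0" using v by (auto simp: T_def qt orthogonal_def)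
  define X :: "real^'n^'n" where "X = (\<chi> i j. T $ i * T $ j)"
  have X: "w \<bullet> (X *v w) = (T \<bullet> w)\<^sup>2" for w
    by (simp only: quadratic_form_sum) (simp add: X_def inner_vec_def power2_eq_square sum_product
        mult.commute mult.left_commute)
  have "?a p \<bullet> (X - mat 1) \<le> 0"
  proof (rule inner_psd_nsd_nonpos[OF sym psd])
    fix h
    have "(T \<bullet> h)\<^sup>2 \<le> (norm T * norm h)\<^sup>2"
      using Cauchy_Schwarz_ineq2[of T h] by (simp add: abs_le_square_iff[symmetric])
    then show "h \<bullet> ((X - mat 1) *v h) \<le> 0"
      using T(1) by (simp add: matrix_vector_mult_diff_rdistrib inner_diff_right X power2_norm_eq_inner)
  qed
  moreover have "?a p \<bullet> X = T \<bullet> (?a p *v T)"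
    by (simp only: quadratic_form_sum) (simp add: X_def inner_vec_def mult.commute mult.left_commute)
  moreover have "g0 * (m0 - m2) \<le> T \<bullet> (?a p *v T)"
    using flow_operator_tangential_bounds(1)[OF F(1) G sb _ p T(2,1)] \<open>m2 < m0\<close> by simp
  ultimately show "g0 * (m0 - m2) \<le> ?a p \<bullet> mat 1" by (simp add: inner_diff_right)
qed

section \<open>The gradient bound\<close>

lemma C1_lipschitz_on_compact:
  fixes f :: "real^'n \<Rightarrow> real"
  assumes "Ck_on 1 K f" "compact K"
  obtains L where "L-lipschitz_on K f"
proof -
  obtain V g where V: "open V" "K \<subseteq> V" "times_cont_diff (Suc 0) V g" "\<And>x. x \<in> K \<Longrightarrow> g x = f x"
    using assms(1) unfolding Ck_on_def by (metis One_nat_def one_enat_def order_refl)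
  have "local_lipschitz {0::real} K (\<lambda>_. g)"
  proof (rule local_lipschitzI)
    fix x assume "x \<in> K"
    then obtain u where u: "u > 0" "cball x u \<subseteq> V" using V(1,2) open_contains_cball by blast
    have "bounded (gradient g ` cball x u)"
      using continuous_on_subset[OF continuous_on_gradient[OF V(3)] u(2)]
      by (intro compact_imp_bounded compact_continuous_image) auto
    then obtain L where L: "L > 0" "\<And>y. y \<in> cball x u \<Longrightarrow> norm (gradient g y) \<le> L"
      unfolding bounded_pos by blast
    have "L-lipschitz_on (cball x u \<inter> K) g"
    proof (rule lipschitz_onI)
      fix y z assume yz: "y \<in> cball x u \<inter> K" "z \<in> cball x u \<inter> K"
      have seg: "closed_segment z y \<subseteq> cball x u" using yz by (intro closed_segment_subset) auto
      obtain w where w: "w \<in> closed_segment z y" "g y - g z = gradient g w \<bullet> (y - z)"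
        using mvt_segment_le[OF V(3), of z y] seg u(2) by blast
      have "\<bar>g y - g z\<bar> \<le> norm (gradient g w) * norm (y - z)"
        unfolding w(2) by (rule Cauchy_Schwarz_ineq2)
      also have "\<dots> \<le> L * norm (y - z)" using L(2) w(1) seg by (intro mult_right_mono) auto
      finally show "dist (g y) (g z) \<le> L * dist y z" by (simp add: dist_norm)
    qed (use L(1) in simp)
    then show "\<exists>u>0. \<exists>L. \<forall>t\<in>cball t u \<inter> {0}. L-lipschitz_on (cball x u \<inter> K) g" for t :: real
      using u(1) by blast
  qed
  then show thesis
  proof (rule local_lipschitz_compact_implies_lipschitz[OF _ assms(2)])
    fix L assume "\<And>t. t \<in> {0::real} \<Longrightarrow> L-lipschitz_on K g"
    then have "L-lipschitz_on K g" by simp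
    then have "L-lipschitz_on K f" using V(4) by (auto simp: lipschitz_on_def)
    then show thesis by (rule that)
  qed auto
qed

lemma time_derivative_of_extension:
  fixes g :: "(real^'n) \<times> real \<Rightarrow> real"
  assumes "times_cont_diff 2 W g" and S: "S \<times> {0..T} \<subseteq> W" and eq: "\<And>z. z \<in> S \<times> {0..T} \<Longrightarrow> g z = (\<lambda>(x, t). f x t) z"
    and x: "x \<in> S" and t: "t \<in> {0..T}"
  shows "((\<lambda>s. f x s) has_real_derivative vector_derivative (\<lambda>s. f x s) (at t within {0..T})) (at t within {0..T})"
proof -
  have "(x, t) \<in> W" using S x t by auto
  then have "(g has_derivative (\<lambda>v. dir_deriv v g (x, t))) (at (x, t))"
    by (rule has_derivative_dir_deriv[OF times_cont_diff_2D(1)[OF assms(1)]])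
  moreover have "((\<lambda>s. (x, s)) has_derivative (\<lambda>r. (0, r))) (at t)"
    by (auto intro!: derivative_eq_intros)
  ultimately have "((\<lambda>s. g (x, s)) has_derivative (\<lambda>r. dir_deriv (0, r) g (x, t))) (at t)"
    using diff_chain_at[of "\<lambda>s. (x, s)" "\<lambda>r. (0, r)" t g] by (simp add: o_def)
  then have "((\<lambda>s. g (x, s)) has_derivative (\<lambda>r. dir_deriv (0, r) g (x, t))) (at t within {0..T})"
    by (rule has_derivative_at_withinI)
  then have "((\<lambda>s. f x s) has_derivative (\<lambda>r. dir_deriv (0, r) g (x, t))) (at t within {0..T})"
    by (rule has_derivative_transform[OF t, rotated]) (use eq x in auto)
  then have "(\<lambda>s. f x s) differentiable (at t within {0..T})" by (rule differentiableI)
  then show ?thesis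
    unfolding has_real_derivative_iff_has_vector_derivative by (simp add: vector_derivative_works)
qed

lemma smooth_solution_sub_supersolution:
  fixes F G :: "(real^'n) \<times> real \<Rightarrow> real"
  assumes u: "smooth_solution F G \<Omega> T f u0 u" and \<Omega>: "open \<Omega>" and "T > 0"
    and u0: "continuous_on (closure \<Omega>) u0"
  shows "subsolution (flow_operator F G) \<Omega> T u"
    and "supersolution (flow_operator F G) \<Omega> T u"
    and "attains_data \<Omega> T f u0 u"
proof -
  have cont: "continuous_on (closure \<Omega> \<times> {0..T}) (\<lambda>(x, t). u x t)"
    and ck: "Ck_on \<infinity> (\<Omega> \<times> {0..T}) (\<lambda>(x, t). u x t)"
    and pde: "\<And>x t. x \<in> \<Omega> \<Longrightarrow> t \<in> {0..T} \<Longrightarrow> vector_derivative (\<lambda>s. u x s) (at t within {0..T}) =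
        (let p = (gradient (\<lambda>y. u y t) x, -1) in
          G p * (\<Sum>i\<in>UNIV. \<Sum>j\<in>UNIV. hessian_p F p $ i $ j * hessian (\<lambda>y. u y t) x $ i $ j))"
    and bc: "\<And>x t. x \<in> frontier \<Omega> \<Longrightarrow> t \<in> {0..T} \<Longrightarrow> u x t = f x t" and ic: "\<And>x. x \<in> \<Omega> \<Longrightarrow> u x 0 = u0 x"
    using u unfolding smooth_solution_def by blast+
  obtain W g where W: "open W" "\<Omega> \<times> {0..T} \<subseteq> W" "times_cont_diff 2 W g"
    "\<And>z. z \<in> \<Omega> \<times> {0..T} \<Longrightarrow> g z = (\<lambda>(x, t). u x t) z"
    using ck unfolding Ck_on_def by (metis enat_ord_simps(3))
  have C2: "times_cont_diff 2 \<Omega> (\<lambda>y. u y t)" if t: "t \<in> {0..T}" for t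
  proof -
    have "\<Omega> \<subseteq> {x. (x, t) \<in> W}" using W(2) t by auto
    then have "times_cont_diff 2 \<Omega> (\<lambda>x. g (x, t))"
      using times_cont_diff_subset[OF times_cont_diff_slice(1)[OF W(1,3), of t]] by blast
    then show ?thesis
      using times_cont_diff_cong[OF \<Omega>, of "\<lambda>x. g (x, t)" "\<lambda>y. u y t" 2] W(4) t by simp
  qed
  have der: "((\<lambda>s. u x s) has_real_derivative
      flow_operator F G (gradient (\<lambda>y. u y t) x, -1) \<bullet> hessian (\<lambda>y. u y t) x) (at t within {0..T})"
    if x: "x \<in> \<Omega>" and t: "t \<in> {0..T}" for x t
    using time_derivative_of_extension[OF W(3,2,4) x t]
    unfolding pde[OF x t] Let_def flow_operator_def
    by (simp add: inner_vec_def sum_distrib_left mult.assoc)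
  show "subsolution (flow_operator F G) \<Omega> T u" "supersolution (flow_operator F G) \<Omega> T u"
    unfolding subsolution_def supersolution_def using cont C2 der by blast+
  have "continuous_on (closure \<Omega>) (\<lambda>x. (\<lambda>(x, t). u x t) (x, 0))"
    by (rule continuous_on_compose2[OF cont]) (use \<open>T > 0\<close> in \<open>auto intro!: continuous_intros\<close>)
  then have "continuous_on (closure \<Omega>) (\<lambda>x. u x 0)" by simp
  then have diff: "continuous_on (closure \<Omega>) (\<lambda>x. u x 0 - u0 x)" using u0 by (intro continuous_on_diff)
  have "u x 0 = u0 x" if "x \<in> closure \<Omega>" for x
    using continuous_constant_on_closure[OF diff, of 0 x] ic that by simp
  then show "attains_data \<Omega> T f u0 u" unfolding attains_data_def using bc by blast
qed

lemma boundary_dataI: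
  fixes \<Omega> :: "(real^'n) set"
  assumes f: "Ck_on 3 (frontier \<Omega> \<times> {0..T}) (\<lambda>(x, t). f x t)" and bound: "boundary_data_bound \<Omega> \<kappa> T M f"
    and "T > 0" and C: "\<And>\<phi>. tangential_data \<Omega> \<kappa> M \<phi> \<Longrightarrow> taylor_bounded C (frontier \<Omega>) \<phi>"
  shows "boundary_data C M (frontier \<Omega>) T f"
proof -
  have "enat 2 \<le> 3" by (simp add: numeral_eq_enat)
  then obtain W g where W: "open W" "frontier \<Omega> \<times> {0..T} \<subseteq> W" "times_cont_diff 2 W g"
    "\<And>z. z \<in> frontier \<Omega> \<times> {0..T} \<Longrightarrow> g z = (\<lambda>(x, t). f x t) z"
    using f unfolding Ck_on_def by metis
  show ?thesis
    unfolding boundary_data_def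
  proof (intro conjI ballI)
    fix t assume t: "t \<in> {0..T}"
    have ext: "\<exists>V g. open V \<and> frontier \<Omega> \<subseteq> V \<and> times_cont_diff 2 V g \<and> (\<forall>x\<in>frontier \<Omega>. g x = f x t)"
    proof (intro exI conjI ballI)
      show "open {x. (x, t) \<in> W}" "times_cont_diff 2 {x. (x, t) \<in> W} (\<lambda>x. g (x, t))"
        using times_cont_diff_slice[OF W(1,3), of t] by blast+
      show "frontier \<Omega> \<subseteq> {x. (x, t) \<in> W}" using W(2) t by auto
      show "g (x, t) = f x t" if "x \<in> frontier \<Omega>" for x using W(4)[of "(x, t)"] that t by simp
    qed
    have "tangential_data \<Omega> \<kappa> M (\<lambda>y. f y t)"
      unfolding tangential_data_def
    proof (intro conjI ballI)
      fix x assume x: "x \<in> frontier \<Omega>"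
      obtain E where "principal_frame \<Omega> x E (\<kappa> x)"
        "\<And>i. i \<in> {1..CARD('n) - 1} \<Longrightarrow> \<bar>deriv_along (frontier \<Omega>) (E i) (\<lambda>y. f y t) x\<bar> \<le> M \<and>
          (\<forall>j\<in>{1..CARD('n) - 1}.
            \<bar>deriv_along (frontier \<Omega>) (E i) (deriv_along (frontier \<Omega>) (E j) (\<lambda>y. f y t)) x\<bar> \<le> M)"
        using bound x t unfolding boundary_data_bound_def by blast
      then show "\<exists>E. principal_frame \<Omega> x E (\<kappa> x) \<and>
        (\<forall>i\<in>{1..CARD('n) - 1}. \<bar>deriv_along (frontier \<Omega>) (E i) (\<lambda>y. f y t) x\<bar> \<le> M \<and>
          (\<forall>j\<in>{1..CARD('n) - 1}.
            \<bar>deriv_along (frontier \<Omega>) (E i) (deriv_along (frontier \<Omega>) (E j) (\<lambda>y. f y t)) x\<bar> \<le> M))"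
        by blast
    qed (rule ext)
    then show "taylor_bounded C (frontier \<Omega>) (\<lambda>y. f y t)" by (rule C)
  next
    fix x s t assume x: "x \<in> frontier \<Omega>" and s: "s \<in> {0..T}" and t: "t \<in> {0..T}"
    have "norm (f x s - f x t) \<le> M * norm (s - t)"
    proof (rule field_differentiable_bound[OF convex_closed_interval _ _ s t])
      fix r assume r: "r \<in> {0..T}"
      show "((\<lambda>s. f x s) has_field_derivative vector_derivative (\<lambda>s. f x s) (at r within {0..T}))
          (at r within {0..T})"
        by (rule time_derivative_of_extension[OF W(3,2,4) x r])
      show "norm (vector_derivative (\<lambda>s. f x s) (at r within {0..T})) \<le> M"
        using bound x r unfolding boundary_data_bound_def by auto
    qed
    then show "\<bar>f x s - f x t\<bar> \<le> M * \<bar>s - t\<bar>" by simp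
  qed
qed

text \<open>The numbers \<open>\<gamma>\<^sub>1\<close> and \<open>\<gamma>\<^sub>2\<close> enclose the range of the operator on tangent directions.\<close>

lemma gamma_bounds:
  assumes sb: "structural_bounds F G g0 G0 m0 M0 m1 m2" and "M \<ge> 0" and pos: "gamma1 g0 m0 m1 m2 M > 0"
  shows "m2 < m0" and "gamma1 g0 m0 m1 m2 M \<le> g0 * (m0 - m2)" and "G0 * (M0 + m2) \<le> gamma2 G0 M0 m1 m2 M"
    and "gamma1 g0 m0 m1 m2 M \<le> gamma2 G0 M0 m1 m2 M"
proof -
  note S = structural_boundsD[OF sb]
  have ne: "(0, 1) \<noteq> (0 :: (real^'n) \<times> real)" by (simp add: prod_eq_iff)
  have GM: "g0 \<le> G0" "m0 \<le> M0" using S(5,6)[OF ne] S(7,8)[OF ne] by linarith+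
  have "2 / (2 + M\<^sup>2) * m0 \<le> 1 * m0"
    using S(2) by (intro mult_right_mono) (auto simp: divide_le_eq add_pos_nonneg)
  moreover have Mm: "0 \<le> sqrt 2 * M * m1" using S(3) \<open>M \<ge> 0\<close> by simp
  ultimately have le: "2 / (2 + M\<^sup>2) * m0 - sqrt 2 * M * m1 - m2 \<le> m0 - m2" by linarith
  then show g1: "gamma1 g0 m0 m1 m2 M \<le> g0 * (m0 - m2)"
    unfolding gamma1_def using S(1) by (intro mult_left_mono) auto
  have "0 < g0 * (m0 - m2)" using pos g1 by linarith
  then show "m2 < m0" using S(1) by (simp add: zero_less_mult_iff)
  show g2: "G0 * (M0 + m2) \<le> gamma2 G0 M0 m1 m2 M"
    unfolding gamma2_def using Mm S(1) GM(1) by (intro mult_left_mono) auto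
  have "g0 * (m0 - m2) \<le> G0 * (M0 + m2)" using GM S(1,2,4) \<open>m2 < m0\<close> by (intro mult_mono) auto
  then show "gamma1 g0 m0 m1 m2 M \<le> gamma2 G0 M0 m1 m2 M" using g1 g2 by linarith
qed

text \<open>Nonnegative terms are smallest for the smallest weight, negative ones for the largest.\<close>

lemma weighted_curvature_sum_pos:
  fixes k w :: "nat \<Rightarrow> real"
  assumes \<alpha>: "\<alpha> \<le> n" and pos: "\<And>i. i \<in> {1..\<alpha>} \<Longrightarrow> k i \<ge> 0" and neg: "\<And>i. i \<in> {\<alpha>+1..n} \<Longrightarrow> k i < 0"
    and sum: "c1 * (\<Sum>i=1..\<alpha>. k i) + c2 * (\<Sum>i=\<alpha>+1..n. k i) > 0"
    and w: "\<And>i. i \<in> {1..n} \<Longrightarrow> c1 \<le> w i" "\<And>i. i \<in> {1..n} \<Longrightarrow> w i \<le> c2"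
  shows "(\<Sum>i=1..n. k i * w i) > 0"
proof -
  have "c1 * (\<Sum>i=1..\<alpha>. k i) \<le> (\<Sum>i=1..\<alpha>. k i * w i)"
    unfolding sum_distrib_left using \<alpha> pos w(1)
    by (intro sum_mono) (auto simp: mult.commute[of c1] intro!: mult_left_mono)
  moreover have "c2 * (\<Sum>i=\<alpha>+1..n. k i) \<le> (\<Sum>i=\<alpha>+1..n. k i * w i)"
    unfolding sum_distrib_left using neg w(2)
    by (intro sum_mono) (auto simp: mult.commute[of c2] intro!: mult_left_mono_neg less_imp_le)
  moreover have "(\<Sum>i=1..n. k i * w i) = (\<Sum>i=1..\<alpha>. k i * w i) + (\<Sum>i=\<alpha>+1..n. k i * w i)"
  proof -
    have "{1..n} = {1..\<alpha>} \<union> {\<alpha>+1..n}" using \<alpha> by auto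
    moreover have "{1..\<alpha>} \<inter> {\<alpha>+1..n} = {}" by auto
    ultimately show ?thesis by (simp add: sum.union_disjoint)
  qed
  ultimately show ?thesis using sum by linarith
qed

theorem theorem4p1:
  fixes \<Omega> :: "(real^'n) set"
    and F G :: "(real^'n) \<times> real \<Rightarrow> real"
    and g0 G0 m0 M0 m1 m2 M :: real
    and \<kappa> :: "real^'n \<Rightarrow> nat \<Rightarrow> real"
    and u0 :: "real^'n \<Rightarrow> real"
  assumes dim: "CARD('n) \<ge> 2"
    and domain: "open \<Omega>" "connected \<Omega>" "bounded \<Omega>" "\<Omega> \<noteq> {}"
    and boundary: "Ck_boundary 3 \<Omega>"
    and anisotropy: "homogeneous_integrand F" "convex_on UNIV F"
    and mobility: "homogeneous_integrand G"
    and constants: "structural_bounds F G g0 G0 m0 M0 m1 m2"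
    and curvatures: "\<forall>x\<in>frontier \<Omega>. \<exists>E. principal_frame \<Omega> x E (\<kappa> x)"
    and curvatures_bounded: "\<exists>K. \<forall>x\<in>frontier \<Omega>. \<forall>i\<in>{1..CARD('n) - 1}. \<bar>\<kappa> x i\<bar> \<le> K"
    and gamma1_pos: "gamma1 g0 m0 m1 m2 M > 0"
    and curvature_condition:
      "\<forall>x\<in>frontier \<Omega>. antimono_on {1..CARD('n) - 1} (\<kappa> x) \<and>
        (\<exists>\<alpha>\<in>{1..CARD('n) - 1}.
          (\<forall>i\<in>{1..\<alpha>}. \<kappa> x i \<ge> 0) \<and> (\<forall>i\<in>{\<alpha>+1..CARD('n) - 1}. \<kappa> x i < 0) \<and>
          gamma1 g0 m0 m1 m2 M * (\<Sum>i=1..\<alpha>. \<kappa> x i)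
            + gamma2 G0 M0 m1 m2 M * (\<Sum>i=\<alpha>+1..CARD('n) - 1. \<kappa> x i) > 0)"
    and initial: "Ck_on 1 (closure \<Omega>) u0"
  shows "\<exists>C. \<forall>T>0. \<forall>f u.
      Ck_on 3 (frontier \<Omega> \<times> {0..T}) (\<lambda>(x, t). f x t) \<longrightarrow>
      boundary_data_bound \<Omega> \<kappa> T M f \<longrightarrow>
      smooth_solution F G \<Omega> T f u0 u \<longrightarrow>
      (\<forall>x\<in>\<Omega>. \<forall>t\<in>{0..T}. norm (gradient (\<lambda>y. u y t) x) \<le> C)"
proof (cases "M \<ge> 0")
  case False
  have "frontier \<Omega> \<noteq> {}"
  proof
    assume "frontier \<Omega> = {}"
    then have "\<Omega> = UNIV" using frontier_eq_empty[of \<Omega>] domain(4) by blast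
    then show False using domain(3) not_bounded_UNIV by blast
  qed
  then obtain x where x: "x \<in> frontier \<Omega>" by blast
  have "\<not> boundary_data_bound \<Omega> \<kappa> T M f" if "T > 0" for T f
  proof
    assume b: "boundary_data_bound \<Omega> \<kappa> T M f"
    have "0 \<in> {0..T}" using that by simp
    then have "\<bar>vector_derivative (\<lambda>s. f x s) (at 0 within {0..T})\<bar> \<le> M"
      using b x unfolding boundary_data_bound_def by blast
    then show False using False by linarith
  qed
  then show ?thesis by blast
next
  case True
  let ?a = "flow_operator F G" and ?I = "{1..CARD('n) - 1}"
  note g = gamma_bounds[OF constants True gamma1_pos]
  have op: "anisotropic_operator ?a (g0 * (m0 - m2))"
    by (rule anisotropic_flow_operator[OF dim anisotropy mobility constants g(1)])
  then interpret anisotropic_operator ?a "g0 * (m0 - m2)" .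
  have bd: "\<exists>U \<rho>. local_defining_function 3 \<Omega> x U \<rho>" if "x \<in> frontier \<Omega>" for x
    using boundary that unfolding Ck_boundary_def by blast
  have wsum: "(\<Sum>i\<in>?I. \<kappa> x i * w i) > 0"
    if x: "x \<in> frontier \<Omega>" and w: "\<And>i. i \<in> ?I \<Longrightarrow> gamma1 g0 m0 m1 m2 M \<le> w i"
      "\<And>i. i \<in> ?I \<Longrightarrow> w i \<le> gamma2 G0 M0 m1 m2 M" for x w
  proof -
    obtain \<alpha> where \<alpha>: "\<alpha> \<in> ?I" "\<forall>i\<in>{1..\<alpha>}. \<kappa> x i \<ge> 0" "\<forall>i\<in>{\<alpha>+1..CARD('n) - 1}. \<kappa> x i < 0"
      "gamma1 g0 m0 m1 m2 M * (\<Sum>i=1..\<alpha>. \<kappa> x i)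
            + gamma2 G0 M0 m1 m2 M * (\<Sum>i=\<alpha>+1..CARD('n) - 1. \<kappa> x i) > 0"
      using curvature_condition x by blast
    show ?thesis
      by (rule weighted_curvature_sum_pos[OF _ _ _ \<alpha>(4) w]) (use \<alpha>(1-3) in auto)
  qed
  have mean_convex: "(\<Sum>i\<in>?I. \<kappa> x i) > 0" if x: "x \<in> frontier \<Omega>" for x
  proof -
    have "(\<Sum>i\<in>?I. \<kappa> x i * gamma1 g0 m0 m1 m2 M) > 0" by (rule wsum[OF x]) (use g(4) in auto)
    then have "(\<Sum>i\<in>?I. \<kappa> x i) * gamma1 g0 m0 m1 m2 M > 0" by (simp add: sum_distrib_right)
    then show ?thesis using gamma1_pos by (simp add: zero_less_mult_iff)
  qed
  have "2 \<le> (3::enat)" by simp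
  have conn: "connected (frontier \<Omega>)"
    by (rule connected_mean_convex_frontier[OF domain(1-3) bd \<open>2 \<le> 3\<close> curvatures[rule_format] mean_convex])
  obtain C where C: "C \<ge> 0" "\<And>\<phi>. tangential_data \<Omega> \<kappa> M \<phi> \<Longrightarrow> taylor_bounded C (frontier \<Omega>) \<phi>"
    using tangential_data_taylor_bounded[OF domain(3) bd \<open>2 \<le> 3\<close> conn True] by blast
  have convex_neg: "?a (\<sigma> *\<^sub>R gradient \<rho> x, 0) \<bullet> hessian \<rho> x < 0"
    if x: "x \<in> frontier \<Omega>" and def: "local_defining_function 3 \<Omega> x U \<rho>" and \<sigma>: "\<sigma> \<noteq> 0" for x U \<rho> \<sigma>
  proof -
    obtain E where E: "principal_frame \<Omega> x E (\<kappa> x)" using curvatures x by blast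
    note P = principal_frameD[OF E def \<open>2 \<le> 3\<close> x]
    have grad: "gradient \<rho> x \<noteq> 0" using defining_functionD(2,4)[OF def] by blast
    define p where "p = (\<sigma> *\<^sub>R gradient \<rho> x, 0::real)"
    have p: "p \<noteq> 0" using grad \<sigma> by (simp add: p_def prod_eq_iff)
    have "?a p *v (\<sigma> *\<^sub>R gradient \<rho> x) = 0"
      using hessian_p_kernel[OF anisotropy(1), of "\<sigma> *\<^sub>R gradient \<rho> x"] grad \<sigma>
      by (simp add: p_def flow_operator_def scaleR_matrix_vector_assoc[symmetric])
    then have ker: "?a p *v gradient \<rho> x = 0" using \<sigma> by (simp add: matrix_vector_mult_scaleR)
    have "(\<Sum>i\<in>?I. \<kappa> x i * (E i x \<bullet> (?a p *v E i x))) > 0"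
    proof (rule wsum[OF x])
      fix i assume i: "i \<in> ?I"
      have T: "fst p \<bullet> E i x = 0" "norm (E i x) = 1"
        using P(2)[OF i] P(3)[OF i i] by (simp_all add: p_def norm_eq_1)
      note b = flow_operator_tangential_bounds[OF anisotropy(1) mobility constants less_imp_le[OF g(1)] p T]
      show "gamma1 g0 m0 m1 m2 M \<le> E i x \<bullet> (?a p *v E i x)" using b(1) g(2) by linarith
      show "E i x \<bullet> (?a p *v E i x) \<le> gamma2 G0 M0 m1 m2 M" using b(2) g(3) by linarith
    qed
    then have "norm (gradient \<rho> x) * (\<Sum>i\<in>?I. \<kappa> x i * (E i x \<bullet> (?a p *v E i x))) > 0"
      using grad by simp
    then show ?thesis
      using inner_hessian_principal_frame[OF E def \<open>2 \<le> 3\<close> x symmetric[OF p] ker] by (simp add: p_def)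
  qed
  have conv: "\<exists>U \<rho>. local_defining_function 2 \<Omega> x U \<rho> \<and> ?a (\<sigma> *\<^sub>R gradient \<rho> x, 0) \<bullet> hessian \<rho> x < 0"
    if x: "x \<in> frontier \<Omega>" and \<sigma>: "\<sigma> \<noteq> 0" for x \<sigma>
  proof -
    obtain U \<rho> where def: "local_defining_function 3 \<Omega> x U \<rho>" using bd[OF x] by blast
    show ?thesis
      using local_defining_function_mono[OF def \<open>2 \<le> 3\<close>] convex_neg[OF x def \<sigma>] by blast
  qed
  have conv1: "operator_convex_boundary ?a \<Omega>"
    unfolding operator_convex_boundary_def using conv[of _ 1] by simp
  have conv2: "operator_convex_boundary (\<lambda>p. ?a (- fst p, snd p)) \<Omega>"
    unfolding operator_convex_boundary_def using conv[of _ "- 1"] by simp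
  have "compact (closure \<Omega>)" using domain(3) by simp
  then obtain L0 where L0: "L0-lipschitz_on (closure \<Omega>) u0"
    using C1_lipschitz_on_compact[OF initial] by blast
  have u0: "\<bar>u0 x - u0 y\<bar> \<le> L0 * norm (x - y)" if "x \<in> closure \<Omega>" "y \<in> closure \<Omega>" for x y
    using lipschitz_onD[OF L0 that] by (simp add: dist_norm)
  obtain L where L: "\<And>T f u x t. boundary_data C M (frontier \<Omega>) T f \<Longrightarrow>
    subsolution ?a \<Omega> T u \<Longrightarrow> supersolution ?a \<Omega> T u \<Longrightarrow> attains_data \<Omega> T f u0 u \<Longrightarrow>
    x \<in> \<Omega> \<Longrightarrow> t \<in> {0..T} \<Longrightarrow> norm (gradient (\<lambda>y. u y t) x) \<le> L"
    using gradient_estimate[OF op domain(1,3) C(1) True u0 lipschitz_on_nonneg[OF L0] conv1 conv2] by blast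
  show ?thesis
  proof (intro exI allI impI ballI)
    fix T :: real and f u x t
    assume T: "0 < T" and f: "Ck_on 3 (frontier \<Omega> \<times> {0..T}) (\<lambda>(x, t). f x t)"
      and bound: "boundary_data_bound \<Omega> \<kappa> T M f" and u: "smooth_solution F G \<Omega> T f u0 u"
      and x: "x \<in> \<Omega>" and t: "t \<in> {0..T}"
    note sol = smooth_solution_sub_supersolution[OF u domain(1) T lipschitz_on_continuous_on[OF L0]]
    show "norm (gradient (\<lambda>y. u y t) x) \<le> L"
      by (rule L[OF boundary_dataI[OF f bound T C(2)] sol x t])
  qed
qed

end
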